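(* Let $R$ be a $d$-dimensional local ring which is essentially of finite type over a field $k$, and let $I\subset R$ be an ideal. Then the limit $$ \lim_{n\rightarrow\infty} \frac{a(I^n,(I^n)^{\rm sat})}{n^d} $$ exists in $\mathbb R$, where $a(K,J)$ denotes the Amao multiplicity and $J^{\rm sat}$ denotes the saturation of $J$ with respect to the maximal ideal of $R$.
   Context: Let $R$ be a $d$-dimensional Noetherian local ring with maximal ideal $m_R$, and let $\ell_R(M)$ denote the length of an $R$-module $M$. Saturation: for an ideal $J$ of $R$, $J^{\rm sat}=J:m_R^{\infty}=\bigcup_{i\ge 0}(J:m_R^i)$. The quotient $J^{\rm sat}/J$ has finite length. Amao multiplicity: let $K\subset J$ be ideals of $R$ such that $J/K$ has finite length. Then $J^n/K^n$ has finite length for all $n\ge 0$, and $\ell_R(J^n/K^n)$ agrees with a numerical polynomial $p(n)$ for all $n$ sufficiently large. The Amao multiplicity $a(K,J)$ is $d!$ times the coefficient of the degree $d$ term of $p(n)$, that is, $$ a(K,J)=\lim_{n\rightarrow\infty}\frac{\ell_R(J^n/K^n)}{n^d/d!}. $$ It is a nonnegative integer. *)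

theory Defs
  imports Complex_Main "HOL-Library.Extended_Nat" "HOL-Algebra.Algebra"
begin

section \<open>Local rings and Krull dimension\<close>

locale local_ring = cring +
  assumes unique_maximal: "\<exists>!M. maximalideal M R"

definition max_ideal :: "('a, 'm) ring_scheme \<Rightarrow> 'a set"
  where "max_ideal R = (THE M. maximalideal M R)"

definition krull_dim :: "('a, 'm) ring_scheme \<Rightarrow> enat"
  where "krull_dim R = Sup {enat n | n.
    \<exists>P :: nat \<Rightarrow> 'a set. (\<forall>i\<le>n. primeideal (P i) R) \<and> (\<forall>i<n. P i \<subset> P (Suc i))}"


section \<open>Algebras of finite type and localizations\<close>

text \<open>An algebra over \<open>K\<close> is a commutative ring \<open>A\<close> with a structure homomorphism \<open>f\<close>.\<close>

definition finite_type_algebra ::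
    "('k, 'm) ring_scheme \<Rightarrow> ('a, 'n) ring_scheme \<Rightarrow> ('k \<Rightarrow> 'a) \<Rightarrow> bool"
  where "finite_type_algebra K A f \<longleftrightarrow> cring K \<and> cring A \<and> f \<in> ring_hom K A \<and>
    (\<exists>S \<subseteq> carrier A. finite S \<and> generate_ring A (f ` carrier K \<union> S) = carrier A)"

text \<open>\<open>g\<close> exhibits \<open>R\<close> as the ring of fractions of \<open>A\<close> with respect to the multiplicative
  set \<open>W\<close>: the elements of \<open>R\<close> are the fractions \<open>g a / g w\<close>, and \<open>g a\<close> vanishes exactly
  if \<open>a\<close> is killed by an element of \<open>W\<close>. So \<open>R\<close> is a localization up to unique isomorphism;
  zero divisors in \<open>W\<close> are allowed.\<close>

definition is_localization ::
    "('a, 'm) ring_scheme \<Rightarrow> 'a set \<Rightarrow> ('b, 'n) ring_scheme \<Rightarrow> ('a \<Rightarrow> 'b) \<Rightarrow> bool"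
  where "is_localization A W R g \<longleftrightarrow> cring A \<and> cring R \<and> submonoid W A \<and> g \<in> ring_hom A R \<and>
    g ` W \<subseteq> Units R \<and>
    (\<forall>r \<in> carrier R. \<exists>a \<in> carrier A. \<exists>w \<in> W. r = g a \<otimes>\<^bsub>R\<^esub> inv\<^bsub>R\<^esub> (g w)) \<and>
    (\<forall>a \<in> carrier A. g a = \<zero>\<^bsub>R\<^esub> \<longrightarrow> (\<exists>w \<in> W. w \<otimes>\<^bsub>A\<^esub> a = \<zero>\<^bsub>A\<^esub>))"


section \<open>Length\<close>

definition module_length :: "('a, 'm) ring_scheme \<Rightarrow> ('a, 'b, 'n) module_scheme \<Rightarrow> enat"
  where "module_length R M = Sup {enat n | n.
    \<exists>N :: nat \<Rightarrow> 'b set. (\<forall>i\<le>n. submodule (N i) R M) \<and> (\<forall>i<n. N i \<subset> N (Suc i))}"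

text \<open>For ideals \<open>K \<subseteq> J\<close> of \<open>R\<close>, the \<open>R\<close>-module \<open>J/K\<close>, as a submodule of the ring
  \<open>R/K\<close>: it consists of the cosets \<open>K + x\<close> with \<open>x \<in> J\<close>, and \<open>R\<close> acts through \<open>R/K\<close>.
  The fields \<open>mult\<close> and \<open>one\<close>, which the record type requires, play no role.\<close>

definition quot_module :: "('a, 'm) ring_scheme \<Rightarrow> 'a set \<Rightarrow> 'a set \<Rightarrow> ('a, 'a set) module"
  where "quot_module R J K =
    \<lparr>carrier = (\<lambda>x. K +>\<^bsub>R\<^esub> x) ` J,
     monoid.mult = rcoset_mult R K, one = K +>\<^bsub>R\<^esub> \<one>\<^bsub>R\<^esub>,
     ring.zero = K, ring.add = set_add R,
     smult = (\<lambda>r A. rcoset_mult R K (K +>\<^bsub>R\<^esub> r) A)\<rparr>"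

lemma quot_module_simps:
  assumes "ideal K R"
  shows "carrier (quot_module R J K) = (\<lambda>x. K +>\<^bsub>R\<^esub> x) ` J"
    and "\<zero>\<^bsub>quot_module R J K\<^esub> = K +>\<^bsub>R\<^esub> \<zero>\<^bsub>R\<^esub>"
    and "\<lbrakk>x \<in> carrier R; y \<in> carrier R\<rbrakk> \<Longrightarrow>
      (K +>\<^bsub>R\<^esub> x) \<oplus>\<^bsub>quot_module R J K\<^esub> (K +>\<^bsub>R\<^esub> y) = K +>\<^bsub>R\<^esub> (x \<oplus>\<^bsub>R\<^esub> y)"
    and "\<lbrakk>r \<in> carrier R; x \<in> carrier R\<rbrakk> \<Longrightarrow>
      r \<odot>\<^bsub>quot_module R J K\<^esub> (K +>\<^bsub>R\<^esub> x) = K +>\<^bsub>R\<^esub> (r \<otimes>\<^bsub>R\<^esub> x)"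
proof -
  interpret ideal K R by fact
  show "carrier (quot_module R J K) = (\<lambda>x. K +>\<^bsub>R\<^esub> x) ` J"
    by (simp add: quot_module_def)
  show "\<zero>\<^bsub>quot_module R J K\<^esub> = K +>\<^bsub>R\<^esub> \<zero>\<^bsub>R\<^esub>"
    by (simp add: quot_module_def FactRing_def a_coset_add_zero a_subset)
  show "\<lbrakk>x \<in> carrier R; y \<in> carrier R\<rbrakk> \<Longrightarrow>
      (K +>\<^bsub>R\<^esub> x) \<oplus>\<^bsub>quot_module R J K\<^esub> (K +>\<^bsub>R\<^esub> y) = K +>\<^bsub>R\<^esub> (x \<oplus>\<^bsub>R\<^esub> y)"
    by (simp add: quot_module_def FactRing_def a_rcos_sum)
  show "\<lbrakk>r \<in> carrier R; x \<in> carrier R\<rbrakk> \<Longrightarrow>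
      r \<odot>\<^bsub>quot_module R J K\<^esub> (K +>\<^bsub>R\<^esub> x) = K +>\<^bsub>R\<^esub> (r \<otimes>\<^bsub>R\<^esub> x)"
    by (simp add: quot_module_def FactRing_def rcoset_mult_add)
qed

lemma quot_module_module:
  assumes "cring R" "ideal J R" "ideal K R"
  shows "module R (quot_module R J K)"
proof -
  interpret R: cring R by fact
  interpret J: ideal J R by fact
  note s = quot_module_simps[OF assms(3)]
  have c [simp]: "x \<in> J \<Longrightarrow> x \<in> carrier R" for x by (rule J.Icarr)
  show ?thesis
  proof (rule moduleI)
    show "abelian_group (quot_module R J K)"
    proof (rule abelian_groupI)
      fix x assume "x \<in> carrier (quot_module R J K)"
      then obtain a where a: "a \<in> J" "x = K +>\<^bsub>R\<^esub> a" by (auto simp: s)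
      have "K +>\<^bsub>R\<^esub> (\<ominus>\<^bsub>R\<^esub> a) \<in> carrier (quot_module R J K)" using a by (auto simp: s)
      moreover have "(K +>\<^bsub>R\<^esub> (\<ominus>\<^bsub>R\<^esub> a)) \<oplus>\<^bsub>quot_module R J K\<^esub> x = \<zero>\<^bsub>quot_module R J K\<^esub>"
        using a by (simp add: s R.l_neg)
      ultimately show "\<exists>y\<in>carrier (quot_module R J K).
          y \<oplus>\<^bsub>quot_module R J K\<^esub> x = \<zero>\<^bsub>quot_module R J K\<^esub>" by blast
    qed (auto simp: s R.a_ac)
  qed (auto simp: s R.l_distr R.r_distr R.m_assoc J.I_l_closed assms(1))
qed


section \<open>Saturation and Amao multiplicity\<close>

text \<open>Powers of ideals are taken in the multiplicative monoid \<open>ideals_set R\<close>, so that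
  \<open>J\<^sup>0 = R\<close>.\<close>

abbreviation ideal_pow :: "('a, 'm) ring_scheme \<Rightarrow> 'a set \<Rightarrow> nat \<Rightarrow> 'a set"
  where "ideal_pow R J n \<equiv> J [^]\<^bsub>ideals_set R\<^esub> n"

definition ideal_colon :: "('a, 'm) ring_scheme \<Rightarrow> 'a set \<Rightarrow> 'a set \<Rightarrow> 'a set"
  where "ideal_colon R J L = {x \<in> carrier R. \<forall>y \<in> L. x \<otimes>\<^bsub>R\<^esub> y \<in> J}"

definition saturation :: "('a, 'm) ring_scheme \<Rightarrow> 'a set \<Rightarrow> 'a set"
  where "saturation R J = (\<Union>i. ideal_colon R J (ideal_pow R (max_ideal R) i))"

text \<open>Meaningful for ideals \<open>K \<subseteq> J\<close> of a Noetherian local ring \<open>R\<close> such that \<open>J/K\<close> has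
  finite length: then all the lengths below are finite, and the limit exists.\<close>

definition amao_mult :: "('a, 'm) ring_scheme \<Rightarrow> 'a set \<Rightarrow> 'a set \<Rightarrow> real"
  where "amao_mult R K J = (let d = the_enat (krull_dim R) in
    lim (\<lambda>n. real (the_enat (module_length R (quot_module R (ideal_pow R J n) (ideal_pow R K n))))
              / (real n ^ d / fact d)))"

end

theory Submission
  imports Defs
begin

text \<open>Write \<open>J\<^sub>n\<close> for the saturation of \<open>I^n\<close>. The Amao multiplicity of \<open>I^n \<subseteq> J\<^sub>n\<close> is \<open>d! L(n)\<close>,
where \<open>L(n)\<close> is the limit of \<open>\<ell>(J\<^sub>n^m / I^(nm)) / m^d\<close> for \<open>m \<rightarrow> \<infinity>\<close>, and, for \<open>I \<subseteq> \<mm>\<close>, the claim is that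
\<open>F(n) = L(n) / n^d\<close> converges. The function \<open>F\<close> is bounded, and it is almost increasing: for fixed \<open>n\<close>,
\<open>F(n) \<le> F(N) + O(1/N)\<close> as \<open>N \<rightarrow> \<infinity>\<close>. So it converges to its supremum (\<open>almost_monotone_convergent\<close>).

Both properties come from one estimate. Let \<open>u\<^sub>j\<close> be the length of \<open>(I^j \<inter> J\<^bsub>j+1\<^esub>) / I^(j+1)\<close>,
the degree \<open>j\<close> part of the elements of the associated graded ring of \<open>I\<close> that are killed by a power of the
maximal ideal \<open>\<mm>\<close>. Then \<open>u\<^sub>j = O(j^(d-1))\<close> (\<open>satdiff_len_bound\<close>). Filtering by the powers
of \<open>I\<close> bounds the length of \<open>(I^A \<inter> J\<^sub>B) / I^B\<close> by the sum of the \<open>u\<^sub>j\<close> with \<open>A \<le> j < B\<close>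
(\<open>satdiff_filtration\<close>). With \<open>A = 0\<close> and \<open>J\<^sub>n^m \<subseteq> J\<^bsub>nm\<^esub>\<close> this shows that \<open>F\<close> is bounded.
For the comparison, choose \<open>q\<close> with \<open>N \<le> nq \<le> N + n\<close>. Then \<open>J\<^sub>n^q \<subseteq> J\<^bsub>nq\<^esub> \<subseteq> J\<^sub>N\<close>, so
\<open>J\<^sub>n^(qm)\<close> modulo \<open>I^(Nm)\<close> is no longer than \<open>J\<^sub>N^m / I^(Nm)\<close>, and what is lost below \<open>I^(Nm)\<close> is
bounded by the sum of the at most \<open>nm\<close> numbers \<open>u\<^sub>j\<close> with \<open>Nm \<le> j < nqm\<close>
(\<open>saturated_powers_len_compare\<close>). Divided by \<open>(Nm)^d\<close>, that sum is \<open>O(1/N)\<close>.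

The estimate of \<open>u\<^sub>j\<close> rests on the fact that the analytic spread of \<open>I\<close> is at most the dimension. The torsion submodule is
finitely generated, so it is killed by a fixed power of \<open>\<mm>\<close>, and \<open>u\<^sub>j\<close> is bounded by a multiple of the number of
generators of a power of \<open>I\<close>. That number is \<open>O(n^(d-1))\<close> (\<open>few_generators_of_powers\<close>), because the monomials
in generators of \<open>I\<close> that are needed form finitely many boxes, a box with \<open>l\<close> free coordinates yields \<open>l\<close>
analytically independent elements, and \<open>l\<close> such elements force a chain of primes of length \<open>l\<close>
(\<open>independent_imp_prime_chain\<close>). The last step is an induction: modulo a suitable prime, there is a nonzero element
\<open>x\<close> such that all but one of the elements remain independent modulo \<open>x\<close>.

That \<open>L(n)\<close> exists follows from the bound and from a formula, for ideals \<open>K \<subseteq> J\<close> with \<open>\<mm>^s J \<subseteq> K\<close>, for the length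
of \<open>J^m / K^m\<close> as a fixed combination of binomial coefficients in \<open>m\<close> (\<open>pow_quotient_len_eq_sum\<close>).

All finiteness statements rest on one combinatorial fact, \<open>monotone_decomp\<close>: a monotone map from exponent vectors to an
order with the ascending chain condition is constant on the boxes of a finite partition. Applied to ideals
of coefficients of monomials, it gives the finite generation of graded families of ideals and the formula for the lengths.\<close>

section \<open>Exponent vectors and boxes\<close>

abbreviation ple :: "nat list \<Rightarrow> nat list \<Rightarrow> bool"
  where "ple \<equiv> list_all2 (\<le>)"

definition exps :: "nat \<Rightarrow> nat \<Rightarrow> nat list set"
  where "exps r n = {\<alpha>. length \<alpha> = r \<and> sum_list \<alpha> = n}"

abbreviation padd :: "nat list \<Rightarrow> nat list \<Rightarrow> nat list"
  where "padd \<equiv> map2 (+)"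

text \<open>A box is a list of pairs: a coordinate marked free ranges over all values from its entry on, any other coordinate is
fixed to its entry. Vectors in a box are parametrised by their free coordinates, relative to the corner, through \<open>plug\<close>.\<close>

definition fits :: "(nat \<times> bool) list \<Rightarrow> nat list \<Rightarrow> bool"
  where "fits = list_all2 (\<lambda>(a, free) n. if free then a \<le> n else n = a)"

fun plug :: "(nat \<times> bool) list \<Rightarrow> nat list \<Rightarrow> nat list"
  where
    "plug ((a, False) # S) \<beta> = a # plug S \<beta>"
  | "plug ((a, True) # S) (b # \<beta>) = (a + b) # plug S \<beta>"
  | "plug _ _ = []"

definition frees :: "(nat \<times> bool) list \<Rightarrow> nat"
  where "frees S = length (filter snd S)"

lemma finite_exps [simp]: "finite (exps r n)"
proof (rule finite_subset)
  show "exps r n \<subseteq> {\<alpha>. set \<alpha> \<subseteq> {..n} \<and> length \<alpha> = r}"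
    using member_le_sum_list by (fastforce simp: exps_def)
  show "finite {\<alpha>. set \<alpha> \<subseteq> {..n} \<and> length \<alpha> = r}"
    by (rule finite_lists_length_eq) simp
qed

lemma fits_Nil [simp]: "fits [] \<alpha> \<longleftrightarrow> \<alpha> = []"
  by (auto simp: fits_def)

lemma fits_Cons [simp]:
  "fits ((a, free) # S) \<alpha> \<longleftrightarrow>
    (\<exists>b \<beta>. \<alpha> = b # \<beta> \<and> (if free then a \<le> b else b = a) \<and> fits S \<beta>)"
  by (auto simp: fits_def list_all2_Cons1)

lemma fits_length: "fits S \<alpha> \<Longrightarrow> length \<alpha> = length S"
  by (auto simp: fits_def dest: list_all2_lengthD)

lemma fits_corner: "fits S (map fst S)"
  by (induction S) auto

lemma fits_ge_corner: "fits S \<alpha> \<Longrightarrow> ple (map fst S) \<alpha>"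
  by (induction S arbitrary: \<alpha>) (auto split: if_splits)

lemma ple_refl [simp]: "ple \<alpha> \<alpha>"
  by (simp add: list_all2_refl)

lemma sum_list_padd: "length \<alpha> = length \<beta> \<Longrightarrow> sum_list (padd \<alpha> \<beta>) = sum_list \<alpha> + sum_list \<beta>"
  by (induction \<alpha> \<beta> rule: list_induct2) auto

lemma ple_imp_padd: "ple \<alpha> \<beta> \<Longrightarrow> \<exists>\<gamma>. length \<gamma> = length \<alpha> \<and> \<beta> = padd \<alpha> \<gamma>"
proof (induction \<alpha> \<beta> rule: list_all2_induct)
  case (Cons a \<alpha> b \<beta>)
  then obtain \<gamma> where "length \<gamma> = length \<alpha>" "\<beta> = padd \<alpha> \<gamma>" by blast
  then show ?case using Cons.hyps(1) by (intro exI[of _ "(b - a) # \<gamma>"]) auto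
qed auto

lemma fits_plug: "length \<beta> = frees S \<Longrightarrow> fits S (plug S \<beta>)"
  by (induction S \<beta> rule: plug.induct) (auto simp: frees_def)

lemma plug_surj: "fits S \<alpha> \<Longrightarrow> \<exists>\<beta>. length \<beta> = frees S \<and> plug S \<beta> = \<alpha>"
proof (induction S arbitrary: \<alpha>)
  case Nil
  then show ?case by (auto simp: frees_def)
next
  case (Cons p S)
  obtain a free where p: "p = (a, free)" by (cases p)
  obtain b \<alpha>' where b: "\<alpha> = b # \<alpha>'" "if free then a \<le> b else b = a" "fits S \<alpha>'"
    using Cons.prems by (auto simp: p)
  obtain \<beta> where \<beta>: "length \<beta> = frees S" "plug S \<beta> = \<alpha>'" using Cons.IH[OF b(3)] by blast
  show ?case
  proof (cases free)
    case True
    then show ?thesis using b \<beta> by (intro exI[of _ "(b - a) # \<beta>"]) (auto simp: p frees_def)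
  next
    case False
    then show ?thesis using b \<beta> by (intro exI[of _ \<beta>]) (auto simp: p frees_def)
  qed
qed

lemma plug_inj: "length \<beta> = frees S \<Longrightarrow> length \<beta>' = frees S \<Longrightarrow> plug S \<beta> = plug S \<beta>' \<Longrightarrow> \<beta> = \<beta>'"
proof (induction S arbitrary: \<beta> \<beta>')
  case (Cons p S)
  obtain a free where p: "p = (a, free)" by (cases p)
  show ?case
  proof (cases free)
    case True
    with Cons.prems obtain b \<gamma> b' \<gamma>' where "\<beta> = b # \<gamma>" "\<beta>' = b' # \<gamma>'"
      "length \<gamma> = frees S" "length \<gamma>' = frees S"
      by (cases \<beta>; cases \<beta>') (auto simp: p frees_def)
    then show ?thesis using Cons True by (auto simp: p)
  next
    case False
    then show ?thesis using Cons by (auto simp: p frees_def)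
  qed
qed (auto simp: frees_def)

lemma sum_list_plug:
  "length \<beta> = frees S \<Longrightarrow> sum_list (plug S \<beta>) = sum_list (map fst S) + sum_list \<beta>"
  by (induction S \<beta> rule: plug.induct) (auto simp: frees_def)

definition cnt :: "(nat \<times> bool) list \<Rightarrow> nat \<Rightarrow> nat"
  where "cnt S n = card {\<alpha>. fits S \<alpha> \<and> sum_list \<alpha> = n}"

lemma cnt_eq:
  "cnt S n = (let A = sum_list (map fst S) in
    if n < A then 0 else (n - A + frees S - 1) choose (n - A))"
proof -
  define A where "A = sum_list (map fst S)"
  have "{\<alpha>. fits S \<alpha> \<and> sum_list \<alpha> = n} =
      plug S ` {\<beta>. length \<beta> = frees S \<and> A + sum_list \<beta> = n}" (is "?L = ?R")
    using plug_surj[of S] by (force simp: fits_plug sum_list_plug A_def)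
  moreover have "inj_on (plug S) {\<beta>. length \<beta> = frees S \<and> A + sum_list \<beta> = n}"
    by (auto simp: inj_on_def intro: plug_inj)
  ultimately have *: "cnt S n = card {\<beta>. length \<beta> = frees S \<and> A + sum_list \<beta> = n}"
    by (simp add: cnt_def card_image)
  show ?thesis
  proof (cases "n < A")
    case True
    then have "{\<beta>::nat list. length \<beta> = frees S \<and> A + sum_list \<beta> = n} = {}" by auto
    then have "cnt S n = 0" by (simp only: * card.empty)
    then show ?thesis using True by (simp add: A_def Let_def)
  next
    case False
    then have "{\<beta>::nat list. length \<beta> = frees S \<and> A + sum_list \<beta> = n} =
        {\<beta>. length \<beta> = frees S \<and> sum_list \<beta> = n - A}" by auto
    then have "cnt S n = (n - A + frees S - 1) choose (n - A)"
      using * card_length_sum_list[of "frees S" "n - A"] by simp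
    then show ?thesis using False by (simp add: A_def Let_def)
  qed
qed

section \<open>Monotone maps on exponent vectors\<close>

definition acc :: "'v::order set \<Rightarrow> bool"
  where "acc V \<longleftrightarrow> (\<forall>s :: nat \<Rightarrow> 'v. range s \<subseteq> V \<longrightarrow> mono s \<longrightarrow> (\<exists>k. \<forall>n\<ge>k. s n = s k))"

definition partitions :: "nat \<Rightarrow> (nat \<times> bool) list set \<Rightarrow> bool"
  where "partitions r \<S> \<longleftrightarrow> finite \<S> \<and> (\<forall>S\<in>\<S>. length S = r) \<and>
    (\<forall>\<alpha>. length \<alpha> = r \<longrightarrow> (\<exists>!S. S \<in> \<S> \<and> fits S \<alpha>))"

lemma partitions_ex:
  assumes "partitions r \<S>" "length \<alpha> = r"
  obtains S where "S \<in> \<S>" "fits S \<alpha>"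
  using assms unfolding partitions_def by blast

lemma partitions_unique:
  assumes "partitions r \<S>" "S \<in> \<S>" "S' \<in> \<S>" "fits S \<alpha>" "fits S' \<alpha>"
  shows "S = S'"
proof -
  have "length \<alpha> = r" using assms fits_length unfolding partitions_def by metis
  then show ?thesis using assms unfolding partitions_def by blast
qed

text \<open>Induction on the number of coordinates. For a fixed tail \<open>\<beta>\<close>, the values \<open>c (i # \<beta>)\<close> increase with \<open>i\<close> to a
final value \<open>c' \<beta>\<close>, and \<open>c'\<close> is again monotone. On each of the finitely many boxes for \<open>c'\<close>, the final
value is reached at the corner from some \<open>i\<close> on, hence on the whole box by monotonicity. So one \<open>i0\<close> serves all tails: beyond
it the first coordinate is free, and each of the smaller values of the first coordinate is a slice of lower dimension.\<close>

lemma monotone_decomp: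
  fixes c :: "nat list \<Rightarrow> 'v::order"
  assumes "acc V" "\<And>\<alpha>. length \<alpha> = r \<Longrightarrow> c \<alpha> \<in> V"
    and "\<And>\<alpha> \<beta>. length \<alpha> = r \<Longrightarrow> ple \<alpha> \<beta> \<Longrightarrow> c \<alpha> \<le> c \<beta>"
  shows "\<exists>\<S>. partitions r \<S> \<and> (\<forall>S\<in>\<S>. \<forall>\<alpha>. fits S \<alpha> \<longrightarrow> c \<alpha> = c (map fst S))"
  using assms(2,3)
proof (induction r arbitrary: c)
  case 0
  then show ?case by (intro exI[of _ "{[]}"]) (auto simp: partitions_def)
next
  case (Suc r)
  define P where "P c \<S> \<longleftrightarrow> partitions r \<S> \<and> (\<forall>S\<in>\<S>. \<forall>\<alpha>. fits S \<alpha> \<longrightarrow> c \<alpha> = c (map fst S))"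
    for c :: "nat list \<Rightarrow> 'v" and \<S>
  have IH: "\<exists>\<S>. P c \<S>" if "\<And>\<alpha>. length \<alpha> = r \<Longrightarrow> c \<alpha> \<in> V"
    "\<And>\<alpha> \<beta>. length \<alpha> = r \<Longrightarrow> ple \<alpha> \<beta> \<Longrightarrow> c \<alpha> \<le> c \<beta>" for c
    using Suc.IH[of c] that by (simp add: P_def)
  have mono1: "c (i # \<beta>) \<le> c (j # \<beta>)" if "i \<le> j" "length \<beta> = r" for i j \<beta>
    using Suc.prems(2)[of "i # \<beta>" "j # \<beta>"] that by simp
  have "\<exists>k. \<forall>n\<ge>k. c (n # \<beta>) = c (k # \<beta>)" if "length \<beta> = r" for \<beta>
  proof -
    have "range (\<lambda>i. c (i # \<beta>)) \<subseteq> V" "mono (\<lambda>i. c (i # \<beta>))"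
      using that Suc.prems(1) by (auto intro!: monoI mono1)
    then show ?thesis using assms(1) unfolding acc_def by blast
  qed
  then obtain k where k: "\<And>\<beta> n. length \<beta> = r \<Longrightarrow> n \<ge> k \<beta> \<Longrightarrow> c (n # \<beta>) = c (k \<beta> # \<beta>)" by metis
  define c' where "c' \<beta> = c (k \<beta> # \<beta>)" for \<beta>
  have c'_ge: "c (n # \<beta>) \<le> c' \<beta>" if "length \<beta> = r" for n \<beta>
    using mono1[OF _ that, of n "max n (k \<beta>)"] k[OF that, of "max n (k \<beta>)"] by (simp add: c'_def)
  have "\<exists>\<S>. P c' \<S>"
  proof (rule IH)
    show "c' \<alpha> \<in> V" if "length \<alpha> = r" for \<alpha> using that Suc.prems(1) by (simp add: c'_def)
    fix \<alpha> \<beta> :: "nat list" assume \<alpha>: "length \<alpha> = r" "ple \<alpha> \<beta>"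
    then have \<beta>: "length \<beta> = r" by (auto dest: list_all2_lengthD)
    define n where "n = max (k \<alpha>) (k \<beta>)"
    have "c' \<alpha> = c (n # \<alpha>)" using k[OF \<alpha>(1), of n] by (simp add: c'_def n_def)
    also have "\<dots> \<le> c (n # \<beta>)" using \<alpha> by (intro Suc.prems(2)) auto
    also have "\<dots> \<le> c' \<beta>" by (rule c'_ge[OF \<beta>])
    finally show "c' \<alpha> \<le> c' \<beta>" .
  qed
  then obtain \<T> where \<T>: "P c' \<T>" by blast
  have finT: "finite \<T>" and lenT: "\<And>S. S \<in> \<T> \<Longrightarrow> length S = r" using \<T> by (auto simp: P_def partitions_def)
  define i0 where "i0 = (\<Sum>S\<in>\<T>. k (map fst S))"
  have stable: "c (i # \<beta>) = c' \<beta>" if \<beta>: "S \<in> \<T>" "fits S \<beta>" and i: "i \<ge> i0" for i S \<beta>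
  proof (rule antisym)
    have len: "length \<beta> = r" "length (map fst S) = r" using \<beta> lenT fits_length by auto
    show "c (i # \<beta>) \<le> c' \<beta>" using c'_ge len by simp
    have "k (map fst S) \<le> i0" unfolding i0_def using \<beta>(1) finT by (intro member_le_sum) auto
    then have "c' (map fst S) = c (i # map fst S)" using k[OF len(2), of i] i by (simp add: c'_def)
    moreover have "c' \<beta> = c' (map fst S)" using \<T> \<beta> unfolding P_def by blast
    moreover have "c (i # map fst S) \<le> c (i # \<beta>)"
      using fits_ge_corner[OF \<beta>(2)] len by (intro Suc.prems(2)) auto
    ultimately show "c' \<beta> \<le> c (i # \<beta>)" by simp
  qed
  have "\<forall>i. \<exists>\<S>. P (\<lambda>\<beta>. c (i # \<beta>)) \<S>"
    using Suc.prems by (intro allI IH) auto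
  then obtain \<S> where \<S>: "\<And>i. P (\<lambda>\<beta>. c (i # \<beta>)) (\<S> i)" by metis
  have partS: "partitions r (\<S> i)" for i using \<S> by (simp add: P_def)
  have partT: "partitions r \<T>" using \<T> by (simp add: P_def)
  define \<U> where "\<U> = (\<Union>i<i0. (#) (i, False) ` \<S> i) \<union> (#) (i0, True) ` \<T>"
  have "partitions (Suc r) \<U>"
    unfolding partitions_def
  proof (intro conjI ballI allI impI)
    show "finite \<U>" unfolding \<U>_def using \<S> \<T> by (auto simp: P_def partitions_def)
    show "length S = Suc r" if "S \<in> \<U>" for S
      using that \<S> \<T> by (auto simp: \<U>_def P_def partitions_def)
    fix \<alpha> :: "nat list" assume "length \<alpha> = Suc r"
    then obtain i \<beta> where \<alpha>: "\<alpha> = i # \<beta>" "length \<beta> = r" by (cases \<alpha>) auto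
    show "\<exists>!S. S \<in> \<U> \<and> fits S \<alpha>"
    proof (cases "i < i0")
      case True
      obtain S where S: "S \<in> \<S> i" "fits S \<beta>" by (rule partitions_ex[OF partS \<alpha>(2)])
      show ?thesis
      proof (rule ex1I[of _ "(i, False) # S"])
        show "(i, False) # S \<in> \<U> \<and> fits ((i, False) # S) \<alpha>" using S True \<alpha> by (auto simp: \<U>_def)
        show "S' = (i, False) # S" if "S' \<in> \<U> \<and> fits S' \<alpha>" for S'
        proof -
          have "S' \<in> \<U>" "fits S' (i # \<beta>)" using that \<alpha> by auto
          then obtain S'' where "S' = (i, False) # S''" "S'' \<in> \<S> i" "fits S'' \<beta>"
            using True unfolding \<U>_def by auto
          then show ?thesis using partitions_unique[OF partS _ S(1) _ S(2)] by blast
        qed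
      qed
    next
      case False
      obtain S where S: "S \<in> \<T>" "fits S \<beta>" by (rule partitions_ex[OF partT \<alpha>(2)])
      show ?thesis
      proof (rule ex1I[of _ "(i0, True) # S"])
        show "(i0, True) # S \<in> \<U> \<and> fits ((i0, True) # S) \<alpha>" using S False \<alpha> by (auto simp: \<U>_def)
        show "S' = (i0, True) # S" if "S' \<in> \<U> \<and> fits S' \<alpha>" for S'
        proof -
          have "S' \<in> \<U>" "fits S' (i # \<beta>)" using that \<alpha> by auto
          then obtain S'' where "S' = (i0, True) # S''" "S'' \<in> \<T>" "fits S'' \<beta>"
            using False unfolding \<U>_def by auto
          then show ?thesis using partitions_unique[OF partT _ S(1) _ S(2)] by blast
        qed
      qed
    qed
  qed
  moreover have "c \<alpha> = c (map fst S)" if S: "S \<in> \<U>" "fits S \<alpha>" for S \<alpha>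
  proof -
    consider i S' where "i < i0" "S' \<in> \<S> i" "S = (i, False) # S'"
      | S' where "S' \<in> \<T>" "S = (i0, True) # S'"
      using S(1) unfolding \<U>_def by blast
    then show ?thesis
    proof cases
      case 1
      then obtain \<beta> where \<beta>: "\<alpha> = i # \<beta>" "fits S' \<beta>" using S(2) by auto
      then have "c (i # \<beta>) = c (i # map fst S')" using \<S>[of i] 1 unfolding P_def by blast
      then show ?thesis using 1 \<beta> by simp
    next
      case 2
      then obtain i \<beta> where \<beta>: "\<alpha> = i # \<beta>" "i \<ge> i0" "fits S' \<beta>" using S(2) by auto
      have "c (i # \<beta>) = c' \<beta>" "c (i0 # map fst S') = c' (map fst S')"
        using stable[OF 2(1)] \<beta> fits_corner by auto
      moreover have "c' \<beta> = c' (map fst S')" using \<T> 2(1) \<beta>(3) unfolding P_def by blast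
      ultimately show ?thesis using 2 \<beta> by simp
    qed
  qed
  ultimately show ?case by (intro exI[of _ \<U>]) auto
qed

lemma sum_partitions:
  fixes g :: "nat list \<Rightarrow> 'b::comm_monoid_add"
  assumes "partitions r \<S>"
  shows "(\<Sum>\<alpha>\<in>exps r n. g \<alpha>) = (\<Sum>S\<in>\<S>. \<Sum>\<alpha> | fits S \<alpha> \<and> sum_list \<alpha> = n. g \<alpha>)"
proof -
  let ?B = "\<lambda>S. {\<alpha>. fits S \<alpha> \<and> sum_list \<alpha> = n}"
  have len: "length S = r" if "S \<in> \<S>" for S using that assms by (simp add: partitions_def)
  have sub: "?B S \<subseteq> exps r n" if "S \<in> \<S>" for S
    using len[OF that] fits_length[of S] by (auto simp: exps_def)
  have "exps r n = (\<Union>S\<in>\<S>. ?B S)"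
  proof (intro equalityI subsetI)
    fix \<alpha> assume \<alpha>: "\<alpha> \<in> exps r n"
    then obtain S where "S \<in> \<S>" "fits S \<alpha>"
      using partitions_ex[OF assms, of \<alpha>] by (auto simp: exps_def)
    then show "\<alpha> \<in> (\<Union>S\<in>\<S>. ?B S)" using \<alpha> by (auto simp: exps_def)
  qed (use sub in blast)
  also have "sum g \<dots> = (\<Sum>S\<in>\<S>. sum g (?B S))"
  proof (rule sum.UNION_disjoint)
    show "finite \<S>" using assms by (simp add: partitions_def)
    show "\<forall>S\<in>\<S>. finite (?B S)" using finite_subset[OF sub finite_exps] by blast
    show "\<forall>S\<in>\<S>. \<forall>S'\<in>\<S>. S \<noteq> S' \<longrightarrow> ?B S \<inter> ?B S' = {}"
      using partitions_unique[OF assms] by blast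
  qed
  finally show ?thesis .
qed

text \<open>A vector of larger degree than the corner of its box exceeds the corner in some free coordinate. So in large degree every
vector has a predecessor in its own box, which is how a statement about a box is propagated from one degree to the next.\<close>

lemma fits_above_corner:
  assumes "fits S \<alpha>" "sum_list \<alpha> > sum_list (map fst S)"
  shows "\<exists>i<length \<alpha>. \<alpha> ! i > 0 \<and> fits S (\<alpha>[i := \<alpha> ! i - 1])"
  using assms
proof (induction S arbitrary: \<alpha>)
  case (Cons p S)
  obtain a free where p: "p = (a, free)" by (cases p)
  obtain b \<beta> where b: "\<alpha> = b # \<beta>" "if free then a \<le> b else b = a" "fits S \<beta>"
    using Cons.prems by (auto simp: p)
  show ?case
  proof (cases "b > a")
    case True
    then show ?thesis using b by (intro exI[of _ 0]) (auto simp: p split: if_splits)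
  next
    case False
    then have "b = a" using b by (auto split: if_splits)
    then have "sum_list \<beta> > sum_list (map fst S)" using Cons.prems b p by simp
    then obtain i where "i < length \<beta>" "\<beta> ! i > 0" "fits S (\<beta>[i := \<beta> ! i - 1])"
      using Cons.IH[OF b(3)] by blast
    then show ?thesis using b by (intro exI[of _ "Suc i"]) (auto simp: p)
  qed
qed auto

(* From here on, <+> is the sum of ideals only. *)
no_notation Sum_Type.Plus (infixr \<open><+>\<close> 65)

section \<open>Ideals\<close>

context ring
begin

lemma ideal_zero: "ideal I R \<Longrightarrow> \<zero> \<in> I"
  by (rule additive_subgroup.zero_closed[OF ideal.axioms(1)])

lemma ideal_add: "ideal I R \<Longrightarrow> x \<in> I \<Longrightarrow> y \<in> I \<Longrightarrow> x \<oplus> y \<in> I"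
  by (rule additive_subgroup.a_closed[OF ideal.axioms(1)])

lemma ideal_neg: "ideal I R \<Longrightarrow> x \<in> I \<Longrightarrow> \<ominus> x \<in> I"
  by (rule additive_subgroup.a_inv_closed[OF ideal.axioms(1)])

lemma ideal_minus: "ideal I R \<Longrightarrow> x \<in> I \<Longrightarrow> y \<in> I \<Longrightarrow> x \<ominus> y \<in> I"
  by (simp add: ideal_add ideal_neg minus_eq)

lemma ideal_mult: "ideal I R \<Longrightarrow> x \<in> I \<Longrightarrow> r \<in> carrier R \<Longrightarrow> r \<otimes> x \<in> I"
  by (rule ideal.I_l_closed)

lemma ideal_mult_right: "ideal I R \<Longrightarrow> x \<in> I \<Longrightarrow> r \<in> carrier R \<Longrightarrow> x \<otimes> r \<in> I"
  by (rule ideal.I_r_closed)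

lemma ideal_carr: "ideal I R \<Longrightarrow> x \<in> I \<Longrightarrow> x \<in> carrier R"
  by (rule ideal.Icarr)

lemma ideal_sub: "ideal I R \<Longrightarrow> I \<subseteq> carrier R"
  using ideal_carr by blast

lemma mem_sum: "x \<in> I <+> J \<longleftrightarrow> (\<exists>i\<in>I. \<exists>j\<in>J. x = i \<oplus> j)"
  by (auto simp: set_add_def')

lemma sum_memI: "i \<in> I \<Longrightarrow> j \<in> J \<Longrightarrow> i \<oplus> j \<in> I <+> J"
  by (auto simp: mem_sum)

lemma sum_le: "ideal K R \<Longrightarrow> I \<subseteq> K \<Longrightarrow> J \<subseteq> K \<Longrightarrow> I <+> J \<subseteq> K"
  by (auto simp: mem_sum intro!: ideal_add)

lemma add_ideals_mono: "I \<subseteq> I' \<Longrightarrow> J \<subseteq> J' \<Longrightarrow> I <+> J \<subseteq> I' <+> J'"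
  unfolding subset_iff mem_sum by blast

lemma sum_upper1: assumes "ideal I R" "ideal J R" shows "I \<subseteq> I <+> J"
proof
  fix x assume "x \<in> I"
  then have "x \<oplus> \<zero> \<in> I <+> J" using assms(2) by (intro sum_memI ideal_zero)
  moreover have "x \<in> carrier R" using \<open>x \<in> I\<close> assms(1) ideal_carr by auto
  ultimately show "x \<in> I <+> J" by simp
qed

lemma sum_upper2: assumes "ideal I R" "ideal J R" shows "J \<subseteq> I <+> J"
proof
  fix x assume "x \<in> J"
  then have "\<zero> \<oplus> x \<in> I <+> J" using assms(1) by (intro sum_memI ideal_zero)
  moreover have "x \<in> carrier R" using \<open>x \<in> J\<close> assms(2) ideal_carr by auto
  ultimately show "x \<in> I <+> J" by simp
qed

lemma zero_add_ideal: "ideal B R \<Longrightarrow> {\<zero>} <+> B = B"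
  using sum_upper2[OF zeroideal, of B] sum_le[of B "{\<zero>}" B] ideal_zero[of B] by auto

lemma genideal_le: "ideal K R \<Longrightarrow> G \<subseteq> K \<Longrightarrow> Idl G \<subseteq> K"
  by (rule genideal_minimal)

lemma genideal_mem: "G \<subseteq> carrier R \<Longrightarrow> x \<in> G \<Longrightarrow> x \<in> Idl G"
  using genideal_self by blast

lemma genideal_sub_mono: "G \<subseteq> H \<Longrightarrow> H \<subseteq> carrier R \<Longrightarrow> Idl G \<subseteq> Idl H"
  by (meson genideal_ideal genideal_le genideal_self order_trans)

lemma genideal_empty: "Idl {} = {\<zero>}"
  by (metis empty_subsetI genideal_le genideal_ideal ideal_zero singletonD subsetI subset_antisym
      subset_singletonD zeroideal empty_iff)

end

context cring
begin

lemma ideal_colon_ideal: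
  assumes "ideal I R" "G \<subseteq> carrier R"
  shows "ideal (ideal_colon R I G) R"
proof (rule idealI)
  show "ring R" by (rule ring_axioms)
  show "subgroup (ideal_colon R I G) (add_monoid R)"
  proof (rule add.subgroupI)
    show "ideal_colon R I G \<subseteq> carrier R" by (auto simp: ideal_colon_def)
    have "\<zero> \<in> ideal_colon R I G" using assms ideal_zero by (auto simp: ideal_colon_def subset_iff)
    then show "ideal_colon R I G \<noteq> {}" by blast
    show "\<ominus> a \<in> ideal_colon R I G" if "a \<in> ideal_colon R I G" for a
      using that assms ideal_neg[OF assms(1)] by (auto simp: ideal_colon_def subset_iff l_minus)
    show "a \<oplus> b \<in> ideal_colon R I G" if "a \<in> ideal_colon R I G" "b \<in> ideal_colon R I G" for a b
      using that assms ideal_add[OF assms(1)] by (auto simp: ideal_colon_def subset_iff l_distr)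
  qed
  fix a x assume *: "a \<in> ideal_colon R I G" "x \<in> carrier R"
  show "x \<otimes> a \<in> ideal_colon R I G"
    using * assms ideal_mult[OF assms(1)] by (auto simp: ideal_colon_def subset_iff m_assoc)
  then show "a \<otimes> x \<in> ideal_colon R I G"
    using * m_comm by (auto simp: ideal_colon_def)
qed

lemma mem_PIdl_sum: "x \<in> PIdl a <+> I \<longleftrightarrow> (\<exists>r\<in>carrier R. \<exists>i\<in>I. x = r \<otimes> a \<oplus> i)"
  by (auto simp: mem_sum cgenideal_def)

lemma genideal_insert:
  assumes "x \<in> carrier R" "G \<subseteq> carrier R"
  shows "Idl (insert x G) = PIdl x <+> Idl G"
proof
  have ids: "ideal (PIdl x) R" "ideal (Idl G) R" "ideal (PIdl x <+> Idl G) R"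
    using assms by (auto intro: cgenideal_ideal genideal_ideal add_ideals)
  show "Idl (insert x G) \<subseteq> PIdl x <+> Idl G"
    using ids sum_upper1[OF ids(1,2)] sum_upper2[OF ids(1,2)] cgenideal_self[OF assms(1)]
      genideal_self[OF assms(2)] by (intro genideal_le) auto
  have i: "ideal (Idl (insert x G)) R" using assms by (intro genideal_ideal) auto
  show "PIdl x <+> Idl G \<subseteq> Idl (insert x G)"
    using assms by (intro sum_le i cgenideal_minimal genideal_sub_mono genideal_mem) auto
qed

lemma prod_le: "ideal K R \<Longrightarrow> (\<And>i j. i \<in> I \<Longrightarrow> j \<in> J \<Longrightarrow> i \<otimes> j \<in> K) \<Longrightarrow> I \<cdot> J \<subseteq> K"
proof
  fix x assume K: "ideal K R" "\<And>i j. i \<in> I \<Longrightarrow> j \<in> J \<Longrightarrow> i \<otimes> j \<in> K" and x: "x \<in> I \<cdot> J"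
  show "x \<in> K" using x by induction (auto intro: K ideal_add)
qed

lemma mem_PIdl_prod:
  assumes "r \<in> carrier R" "ideal T R"
  shows "y \<in> (PIdl r) \<cdot> T \<longleftrightarrow> (\<exists>t\<in>T. y = r \<otimes> t)"
proof
  assume "y \<in> (PIdl r) \<cdot> T"
  then show "\<exists>t\<in>T. y = r \<otimes> t"
  proof induction
    case (prod i j)
    then obtain s where s: "s \<in> carrier R" "i = s \<otimes> r" by (auto simp: cgenideal_def)
    then have "i \<otimes> j = r \<otimes> (s \<otimes> j)" using assms prod ideal_carr by (simp add: m_ac)
    then show ?case using s prod assms ideal_mult by auto
  next
    case (sum s1 s2)
    then show ?case using assms ideal_carr[OF assms(2)] ideal_add[OF assms(2)] by (metis r_distr)
  qed
next
  assume "\<exists>t\<in>T. y = r \<otimes> t"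
  then show "y \<in> (PIdl r) \<cdot> T" using cgenideal_self[OF assms(1)] by (auto intro: ideal_prod.prod)
qed

lemma prod_mono: "I \<subseteq> I' \<Longrightarrow> J \<subseteq> J' \<Longrightarrow> ideal I' R \<Longrightarrow> ideal J' R \<Longrightarrow> I \<cdot> J \<subseteq> I' \<cdot> J'"
  by (rule prod_le) (auto intro: ideal_prod_is_ideal ideal_prod.prod)

lemma mult_genideal_le:
  assumes "ideal K R" "a \<in> carrier R" "G \<subseteq> carrier R" "\<And>x. x \<in> G \<Longrightarrow> a \<otimes> x \<in> K" "b \<in> Idl G"
  shows "a \<otimes> b \<in> K"
proof -
  have "Idl G \<subseteq> ideal_colon R K {a}"
    using assms by (intro genideal_le ideal_colon_ideal) (auto simp: ideal_colon_def subset_iff m_comm)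
  then show ?thesis using assms by (auto simp: ideal_colon_def m_comm)
qed

lemma genideal_mult_genideal_le:
  assumes "ideal K R" "G \<subseteq> carrier R" "H \<subseteq> carrier R"
    and "\<And>x y. x \<in> G \<Longrightarrow> y \<in> H \<Longrightarrow> x \<otimes> y \<in> K" "a \<in> Idl G" "b \<in> Idl H"
  shows "a \<otimes> b \<in> K"
proof (rule mult_genideal_le[OF assms(1) _ assms(3) _ assms(6)])
  show a: "a \<in> carrier R" using assms(2,5) genideal_ideal ideal_carr by blast
  fix y assume y: "y \<in> H"
  then have "y \<otimes> a \<in> K"
    using assms by (intro mult_genideal_le[OF assms(1) _ assms(2) _ assms(5)]) (auto simp: subset_iff m_comm)
  then show "a \<otimes> y \<in> K" using y a assms(3) m_comm by (auto simp: subset_iff)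
qed

lemma ideals_set_simps [simp]:
  "\<one>\<^bsub>ideals_set R\<^esub> = carrier R" "I \<otimes>\<^bsub>ideals_set R\<^esub> J = I \<cdot> J"
  by (simp_all add: ideals_set_def)

lemma pow_ideal: "ideal J R \<Longrightarrow> ideal (ideal_pow R J n) R"
  by (induction n) (simp_all add: ideal_prod_is_ideal oneideal)

lemma pow_1: "ideal J R \<Longrightarrow> ideal_pow R J (Suc 0) = J"
  using ideal_prod_commute[OF _ oneideal] by (simp add: ideal_prod_one)

lemma pow_add: "ideal J R \<Longrightarrow> ideal_pow R J m \<cdot> ideal_pow R J n = ideal_pow R J (m + n)"
  using monoid.nat_pow_mult[OF comm_monoid.axioms(1)[OF ideals_set_is_comm_monoid], of J m n]
  by (simp add: ideals_set_def[symmetric]) (simp add: ideals_set_def)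

lemma pow_pow: "ideal J R \<Longrightarrow> ideal_pow R (ideal_pow R J m) n = ideal_pow R J (m * n)"
  using monoid.nat_pow_pow[OF comm_monoid.axioms(1)[OF ideals_set_is_comm_monoid], of J m n]
  by (simp add: ideals_set_def)

lemma pow_mult_mem:
  "ideal J R \<Longrightarrow> x \<in> ideal_pow R J m \<Longrightarrow> y \<in> ideal_pow R J n \<Longrightarrow> x \<otimes> y \<in> ideal_pow R J (m + n)"
  using ideal_prod.prod[of x "ideal_pow R J m" y "ideal_pow R J n" R] by (simp add: pow_add)

lemma pow_mono: "J \<subseteq> K \<Longrightarrow> ideal J R \<Longrightarrow> ideal K R \<Longrightarrow> ideal_pow R J n \<subseteq> ideal_pow R K n"
  by (induction n) (simp_all add: prod_mono pow_ideal)

lemma pow_anti: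
  assumes "ideal J R" "m \<le> n" shows "ideal_pow R J n \<subseteq> ideal_pow R J m"
proof -
  have "ideal_pow R J m \<cdot> ideal_pow R J (n - m) \<subseteq> ideal_pow R J m"
    using ideal_prod_inter[OF pow_ideal[OF assms(1)] pow_ideal[OF assms(1)]] by blast
  then show ?thesis using assms by (simp add: pow_add)
qed

lemma pow_elem: "ideal J R \<Longrightarrow> x \<in> J \<Longrightarrow> x [^] n \<in> ideal_pow R J n"
proof (induction n)
  case (Suc n)
  then show ?case using ideal_prod.prod[of "x [^] n" "ideal_pow R J n" x J R]
    by simp
qed simp

end

section \<open>Length\<close>

text \<open>Chains of \<open>n\<close> proper inclusions that end at \<open>B\<close> and start at some ideal contained in \<open>A\<close>. Lengths of the modules \<open>A/B\<close> for
ideals \<open>B \<subseteq> A\<close> are measured by such chains, which avoids passing to quotient modules.\<close>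

inductive ideal_chain :: "('a, 'm) ring_scheme \<Rightarrow> nat \<Rightarrow> 'a set \<Rightarrow> 'a set \<Rightarrow> bool" for R
  where
    base: "ideal A R \<Longrightarrow> ideal B R \<Longrightarrow> B \<subseteq> A \<Longrightarrow> ideal_chain R 0 A B"
  | step: "ideal_chain R n A B' \<Longrightarrow> ideal B R \<Longrightarrow> B \<subset> B' \<Longrightarrow> ideal_chain R (Suc n) A B"

definition len :: "('a, 'm) ring_scheme \<Rightarrow> 'a set \<Rightarrow> 'a set \<Rightarrow> enat"
  where "len R A B = Sup (enat ` {n. ideal_chain R n A B})"

lemma ideal_chainD: "ideal_chain R n A B \<Longrightarrow> ideal A R \<and> ideal B R \<and> B \<subseteq> A"
  by (induction rule: ideal_chain.induct) auto

lemma ideal_chain_bottom: "ideal_chain R n A B' \<Longrightarrow> ideal B R \<Longrightarrow> B \<subseteq> B' \<Longrightarrow> ideal_chain R n A B"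
  by (erule ideal_chain.cases)
    (auto intro: ideal_chain.base ideal_chain.step[OF _ _ subset_psubset_trans])

lemma ideal_chain_append: "ideal_chain R n B C \<Longrightarrow> ideal_chain R m A B \<Longrightarrow> ideal_chain R (n + m) A C"
  by (induction rule: ideal_chain.induct) (auto intro: ideal_chain.intros ideal_chain_bottom)

lemma ideal_chain_Suc: "ideal_chain R (Suc n) A B \<Longrightarrow> ideal_chain R n A B"
  by (erule ideal_chain.cases) (auto intro: ideal_chain_bottom)

lemma ideal_chain_le: "ideal_chain R n A B \<Longrightarrow> k \<le> n \<Longrightarrow> ideal_chain R k A B"
proof (induction n)
  case (Suc n)
  then show ?case using ideal_chain_Suc[of R n A B] by (cases "k = Suc n") auto
qed simp

lemma ideal_chain_map:
  assumes "ideal_chain R n A B"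
    and f: "\<And>N. ideal N R \<Longrightarrow> B \<subseteq> N \<Longrightarrow> N \<subseteq> A \<Longrightarrow> ideal (f N) R \<and> B' \<subseteq> f N \<and> f N \<subseteq> A'"
    and strict: "\<And>N N'. ideal N R \<Longrightarrow> ideal N' R \<Longrightarrow> B \<subseteq> N \<Longrightarrow> N \<subset> N' \<Longrightarrow> N' \<subseteq> A \<Longrightarrow> f N \<subset> f N'"
    and "ideal A' R" "ideal B' R"
  shows "ideal_chain R n A' B'"
proof -
  have "ideal_chain R n A' (f B0)" if "ideal_chain R n A B0" "B \<subseteq> B0" for B0
    using that f strict
  proof (induction rule: ideal_chain.induct)
    case (base A B0)
    then show ?case using assms(4) by (intro ideal_chain.base) auto
  next
    case (step n A B0' B0)
    have "ideal_chain R n A' (f B0')" using step by (intro step.IH) auto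
    moreover have "ideal B0' R" "B0' \<subseteq> A" using ideal_chainD[OF step.hyps(1)] by auto
    ultimately show ?case using step by (intro ideal_chain.step[of R n A' "f B0'"]) auto
  qed
  from this[OF assms(1)] show ?thesis
    using assms(5) f ideal_chainD[OF assms(1)] by (auto intro: ideal_chain_bottom)
qed

context cring
begin

text \<open>The two modular laws make \<open>N \<mapsto> N \<inter> B\<close> and \<open>N \<mapsto> N + C\<close> strictly monotone between the ideals
from \<open>C\<close> to \<open>B + C\<close> and those from \<open>B \<inter> C\<close> to \<open>B\<close>.\<close>

lemma modular:
  assumes "ideal B R" "ideal C R" "ideal N R" "C \<subseteq> N" "N \<subseteq> B <+> C"
  shows "N = (N \<inter> B) <+> C"
proof
  show "N \<subseteq> (N \<inter> B) <+> C"
  proof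
    fix x assume x: "x \<in> N"
    then obtain b c where bc: "b \<in> B" "c \<in> C" "x = b \<oplus> c"
      using assms(5) unfolding subset_iff mem_sum by blast
    have carr: "b \<in> carrier R" "c \<in> carrier R" using bc assms ideal_carr by auto
    have "x \<ominus> c = b" unfolding bc(3) using carr by algebra
    moreover have "x \<ominus> c \<in> N" using x bc(2) assms(3,4) by (intro ideal_minus) auto
    ultimately have "b \<in> N" by simp
    then show "x \<in> (N \<inter> B) <+> C" using bc by (auto simp: mem_sum)
  qed
  show "(N \<inter> B) <+> C \<subseteq> N" using assms by (intro sum_le) auto
qed

lemma modular':
  assumes "ideal B R" "ideal C R" "ideal N R" "N \<subseteq> B" "B \<inter> C \<subseteq> N"
  shows "N = (N <+> C) \<inter> B"
proof
  show "(N <+> C) \<inter> B \<subseteq> N"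
  proof
    fix x assume "x \<in> (N <+> C) \<inter> B"
    then obtain n c where nc: "x \<in> B" "n \<in> N" "c \<in> C" "x = n \<oplus> c" by (auto simp: mem_sum)
    have carr: "n \<in> carrier R" "c \<in> carrier R" using nc assms ideal_carr by auto
    have "x \<ominus> n = c" unfolding nc(4) using carr by algebra
    moreover have "x \<ominus> n \<in> B" using nc(1,2) assms(1,4) by (intro ideal_minus) auto
    ultimately have "c \<in> B" by simp
    then show "x \<in> N" using nc assms ideal_add by auto
  qed
  show "N \<subseteq> (N <+> C) \<inter> B" using assms sum_upper1 by blast
qed

lemma ideal_chain_second_iso:
  assumes "ideal B R" "ideal C R"
  shows "ideal_chain R n (B <+> C) C \<longleftrightarrow> ideal_chain R n B (B \<inter> C)"
proof
  note ids = assms add_ideals[OF assms] i_intersect[OF assms]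
  assume "ideal_chain R n (B <+> C) C"
  then show "ideal_chain R n B (B \<inter> C)"
  proof (rule ideal_chain_map[where f = "\<lambda>N. N \<inter> B"])
    fix N N' assume N: "ideal N R" "ideal N' R" "C \<subseteq> N" "N \<subset> N'" "N' \<subseteq> B <+> C"
    then have "N = (N \<inter> B) <+> C" "N' = (N' \<inter> B) <+> C" using assms
      by (intro modular; blast)+
    then show "N \<inter> B \<subset> N' \<inter> B" using N(4) by auto
  qed (use ids i_intersect in auto)
next
  note ids = assms add_ideals[OF assms] i_intersect[OF assms]
  assume "ideal_chain R n B (B \<inter> C)"
  then show "ideal_chain R n (B <+> C) C"
  proof (rule ideal_chain_map[where f = "\<lambda>N. N <+> C"])
    fix N assume N: "ideal N R" "B \<inter> C \<subseteq> N" "N \<subseteq> B"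
    then show "ideal (N <+> C) R \<and> C \<subseteq> N <+> C \<and> N <+> C \<subseteq> B <+> C"
      using assms add_ideals sum_upper2 add_ideals_mono by auto
  next
    fix N N' assume N: "ideal N R" "ideal N' R" "B \<inter> C \<subseteq> N" "N \<subset> N'" "N' \<subseteq> B"
    then have "N = (N <+> C) \<inter> B" "N' = (N' <+> C) \<inter> B" using assms
      by (intro modular'; blast)+
    then show "N <+> C \<subset> N' <+> C" using N(4) add_ideals_mono[of N N' C C] by auto
  qed (use ids in auto)
qed

text \<open>The counting half of the additivity of length. Suppose that the chain descends from \<open>C'\<close> to \<open>C\<close>. If
\<open>C' \<subseteq> B\<close>, then this step extends the lower chain. Otherwise, \<open>B\<close> is properly contained in \<open>B + C'\<close>, which extends the
upper chain, and the lower one is carried over by the second isomorphism theorem.\<close>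

lemma ideal_chain_split:
  assumes "ideal_chain R n A C" "ideal B R" "C \<subseteq> B" "B \<subseteq> A"
  shows "\<exists>i j. ideal_chain R i A B \<and> ideal_chain R j B C \<and> n \<le> i + j"
  using assms
proof (induction arbitrary: B rule: ideal_chain.induct)
  case (base A C)
  then show ?case by (intro exI[of _ 0]) (auto intro: ideal_chain.base)
next
  case (step n A C' C)
  have C': "ideal C' R" "C' \<subseteq> A" "ideal A R" using ideal_chainD[OF step.hyps(1)] by auto
  let ?D = "B <+> C'"
  have D: "ideal ?D R" "C' \<subseteq> ?D" "?D \<subseteq> A" "B \<subseteq> ?D"
    using C' step.prems add_ideals sum_le sum_upper1 sum_upper2 by auto
  have int: "ideal (B \<inter> C') R" using step.prems C' i_intersect by auto
  show ?case
  proof (cases "?D = B")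
    case True
    then have "C' \<subseteq> B" using D by auto
    then obtain i j where "ideal_chain R i A B" "ideal_chain R j B C'" "n \<le> i + j"
      using step.IH[OF step.prems(1)] step.prems by blast
    moreover have "ideal_chain R (Suc j) B C" using calculation(2) step.hyps by (auto intro: ideal_chain.step)
    ultimately show ?thesis by (intro exI[of _ i] exI[of _ "Suc j"]) auto
  next
    case False
    obtain i j where ij: "ideal_chain R i A ?D" "ideal_chain R j ?D C'" "n \<le> i + j"
      using step.IH[OF D(1)] D by blast
    have "ideal_chain R (Suc i) A B" using ij(1) False D step.prems by (auto intro: ideal_chain.step)
    moreover have "ideal_chain R j B (B \<inter> C')"
      using ij(2) ideal_chain_second_iso[OF step.prems(1) C'(1)] by blast
    then have "ideal_chain R j B C"
      by (rule ideal_chain_bottom[OF _ step.hyps(2)]) (use step.hyps(3) step.prems(2) in blast)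
    ultimately show ?thesis using ij(3) by (intro exI[of _ "Suc i"] exI[of _ j]) auto
  qed
qed

lemma enat_le_len:
  assumes "ideal A R" "ideal B R" "B \<subseteq> A"
  shows "enat n \<le> len R A B \<longleftrightarrow> ideal_chain R n A B"
proof
  assume n: "enat n \<le> len R A B"
  show "ideal_chain R n A B"
  proof (rule ccontr)
    assume neg: "\<not> ideal_chain R n A B"
    then have *: "k < n" if "ideal_chain R k A B" for k
      using that ideal_chain_le[of R k A B n] by (meson not_le)
    have "ideal_chain R 0 A B" using assms by (rule ideal_chain.base)
    then obtain m where m: "n = Suc m" using * by (cases n) auto
    have "k \<le> m" if "ideal_chain R k A B" for k using *[OF that] m by simp
    then have "len R A B \<le> enat m" unfolding len_def by (intro Sup_least) auto
    then show False using n m by (metis enat_ord_simps(1) Suc_n_not_le_n order_trans)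
  qed
next
  assume "ideal_chain R n A B"
  then show "enat n \<le> len R A B" unfolding len_def by (intro Sup_upper) auto
qed

lemma len_self [simp]: "ideal A R \<Longrightarrow> len R A A = 0"
proof -
  assume A: "ideal A R"
  have "\<not> ideal_chain R (Suc n) A A" for n
  proof
    assume "ideal_chain R (Suc n) A A"
    then show False
    proof cases
      case (step B')
      then show False using ideal_chainD[of R n A B'] by blast
    qed
  qed
  then have "{n. ideal_chain R n A A} \<subseteq> {0}" by (auto, metis not0_implies_Suc)
  then have "len R A A \<le> 0" unfolding len_def by (intro Sup_least) (auto simp: zero_enat_def)
  then show ?thesis by simp
qed

lemma len_add:
  assumes ids: "ideal A R" "ideal B R" "ideal C R" and sub: "C \<subseteq> B" "B \<subseteq> A"
  shows "len R A C = len R A B + len R B C"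
proof (rule antisym)
  have AC: "C \<subseteq> A" using sub by auto
  show "len R A C \<le> len R A B + len R B C"
    unfolding len_def[of R A C]
  proof (intro Sup_least; clarsimp)
    fix n assume "ideal_chain R n A C"
    then obtain i j where "ideal_chain R i A B" "ideal_chain R j B C" "n \<le> i + j"
      using ideal_chain_split ids sub by blast
    then have "enat i \<le> len R A B" "enat j \<le> len R B C" using enat_le_len ids sub by auto
    then have "enat (i + j) \<le> len R A B + len R B C" by (metis add_mono plus_enat_simps(1))
    then show "enat n \<le> len R A B + len R B C" using \<open>n \<le> i + j\<close> by (meson enat_ord_simps(1) order_trans)
  qed
  have app: "enat (i + j) \<le> len R A C" if "enat i \<le> len R A B" "enat j \<le> len R B C" for i j
    using that ids sub AC ideal_chain_append[of R j B C i A] enat_le_len by (auto simp: add.commute)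
  show "len R A B + len R B C \<le> len R A C"
  proof -
    consider i j where "len R A B = enat i" "len R B C = enat j"
      | "len R A B = \<infinity>" | "len R B C = \<infinity>"
      by (metis enat.exhaust)
    then show ?thesis
  proof cases
    case (1 i j)
    then show ?thesis using app[of i j] by simp
  next
    case *: 2
    have "enat i \<le> len R A C" for i using app[of i 0] * by (simp add: zero_enat_def[symmetric])
    then have "len R A C = \<infinity>" by (metis enat_ord_simps(1) not_infinity_eq Suc_n_not_le_n)
    then show ?thesis by simp
  next
    case *: 3
    have "enat i \<le> len R A C" for i using app[of 0 i] * by (simp add: zero_enat_def[symmetric])
    then have "len R A C = \<infinity>" by (metis enat_ord_simps(1) not_infinity_eq Suc_n_not_le_n)
    then show ?thesis by simp
  qed
  qed
qed

lemma len_second_iso: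
  assumes "ideal B R" "ideal C R"
  shows "len R (B <+> C) C = len R B (B \<inter> C)"
  by (simp add: len_def ideal_chain_second_iso[OF assms])

lemma len_mono:
  assumes "ideal A R" "ideal A' R" "ideal B R" "ideal B' R" "B' \<subseteq> B" "B \<subseteq> A" "A \<subseteq> A'"
  shows "len R A B \<le> len R A' B'"
proof -
  have "len R A' B' = len R A' A + len R A B'" using assms by (intro len_add; blast)
  moreover have "len R A B' = len R A B + len R B B'" using assms by (intro len_add; blast)
  ultimately have "len R A' B' = len R A' A + (len R A B + len R B B')" by simp
  moreover have "len R A B \<le> len R A' A + (len R A B + len R B B')"
    by (intro add_increasing add_increasing2) auto
  ultimately show ?thesis by simp
qed

text \<open>The module \<open>(rR + B)/B\<close> is generated by the class of \<open>r\<close>, whose annihilator is \<open>B : r\<close>.\<close>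

lemma len_cyclic:
  assumes B: "ideal B R" and r: "r \<in> carrier R"
  shows "len R (PIdl r <+> B) B = len R (carrier R) (ideal_colon R B {r})"
proof -
  let ?A = "PIdl r <+> B" and ?C = "\<lambda>N. ideal_colon R N {r}"
  have P: "ideal (PIdl r) R" using r by (rule cgenideal_ideal)
  have A: "ideal ?A R" using P B by (rule add_ideals)
  have col: "ideal (?C N) R" if "ideal N R" for N using that r ideal_colon_ideal by auto
  have memC: "x \<in> ?C N \<longleftrightarrow> x \<in> carrier R \<and> x \<otimes> r \<in> N" for x N by (auto simp: ideal_colon_def)
  have "ideal_chain R n ?A B \<longleftrightarrow> ideal_chain R n (carrier R) (?C B)" for n
  proof
    assume "ideal_chain R n ?A B"
    then show "ideal_chain R n (carrier R) (?C B)"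
    proof (rule ideal_chain_map[where f = ?C])
      fix N assume "ideal N R" "B \<subseteq> N" "N \<subseteq> ?A"
      then show "ideal (?C N) R \<and> ?C B \<subseteq> ?C N \<and> ?C N \<subseteq> carrier R" using col by (auto simp: memC)
    next
      fix N N' assume N: "ideal N R" "ideal N' R" "B \<subseteq> N" "N \<subset> N'" "N' \<subseteq> ?A"
      then obtain x where x: "x \<in> N'" "x \<notin> N" by auto
      then obtain a b where ab: "a \<in> carrier R" "b \<in> B" "x = a \<otimes> r \<oplus> b"
        using N(5) unfolding subset_iff mem_PIdl_sum by blast
      have carr: "b \<in> carrier R" "x \<in> carrier R" using B ab x N ideal_carr by auto
      have "a \<otimes> r = x \<ominus> b" unfolding ab(3) using ab(1) carr(1) r by algebra
      then have "a \<in> ?C N'" using ab x N B ideal_minus[of N' x b] by (auto simp: memC)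
      moreover have "a \<notin> ?C N" using ab x N ideal_add[of N "a \<otimes> r" b] by (auto simp: memC)
      ultimately show "?C N \<subset> ?C N'" using N(4) by (auto simp: memC)
    qed (use col B oneideal in auto)
  next
    assume "ideal_chain R n (carrier R) (?C B)"
    then show "ideal_chain R n ?A B"
    proof (rule ideal_chain_map[where f = "\<lambda>T. (PIdl r) \<cdot> T <+> B"])
      fix T assume T: "ideal T R" "?C B \<subseteq> T" "T \<subseteq> carrier R"
      have "(PIdl r) \<cdot> T \<subseteq> PIdl r" using ideal_prod_inter[OF P T(1)] by auto
      then show "ideal ((PIdl r) \<cdot> T <+> B) R \<and> B \<subseteq> (PIdl r) \<cdot> T <+> B \<and> (PIdl r) \<cdot> T <+> B \<subseteq> ?A"
        using T B P ideal_prod_is_ideal add_ideals sum_upper2 add_ideals_mono[of _ "PIdl r" B B] by auto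
    next
      fix T T' assume T: "ideal T R" "ideal T' R" "?C B \<subseteq> T" "T \<subset> T'" "T' \<subseteq> carrier R"
      obtain a where a: "a \<in> T'" "a \<notin> T" using T(4) by auto
      have ac: "a \<in> carrier R" using a T by auto
      have "r \<otimes> a \<in> (PIdl r) \<cdot> T'" using a cgenideal_self[OF r] by (intro ideal_prod.prod)
      then have "r \<otimes> a \<in> (PIdl r) \<cdot> T' <+> B"
        using sum_upper1[OF ideal_prod_is_ideal[OF P T(2)] B] by auto
      moreover have "r \<otimes> a \<notin> (PIdl r) \<cdot> T <+> B"
      proof
        assume "r \<otimes> a \<in> (PIdl r) \<cdot> T <+> B"
        then obtain y b where yb: "y \<in> (PIdl r) \<cdot> T" "b \<in> B" "r \<otimes> a = y \<oplus> b" by (auto simp: mem_sum)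
        obtain t where t: "t \<in> T" "y = r \<otimes> t" using yb(1) mem_PIdl_prod[OF r T(1)] by blast
        have carr: "t \<in> carrier R" "b \<in> carrier R" using t T yb B ideal_carr by auto
        have "(a \<ominus> t) \<otimes> r = r \<otimes> a \<ominus> r \<otimes> t" using ac carr r by algebra
        also have "\<dots> = b" unfolding yb(3) t(2) using carr r by algebra
        finally have "a \<ominus> t \<in> ?C B" using yb ac carr by (auto simp: memC)
        then have "(a \<ominus> t) \<oplus> t \<in> T" using T t ideal_add by auto
        moreover have "(a \<ominus> t) \<oplus> t = a" using ac carr by algebra
        ultimately show False using a by simp
      qed
      moreover have "(PIdl r) \<cdot> T <+> B \<subseteq> (PIdl r) \<cdot> T' <+> B"
        using T P by (intro add_ideals_mono prod_mono) auto
      ultimately show "(PIdl r) \<cdot> T <+> B \<subset> (PIdl r) \<cdot> T' <+> B" by blast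
    qed (use A B in auto)
  qed
  then show ?thesis by (simp add: len_def)
qed

text \<open>A module with \<open>g\<close> generators that is annihilated by \<open>C\<close> is a quotient of \<open>g\<close> copies of \<open>R/C\<close>.\<close>

lemma len_le_generators:
  assumes "finite G" "G \<subseteq> carrier R" "ideal B R" "ideal C R" "\<And>x c. x \<in> G \<Longrightarrow> c \<in> C \<Longrightarrow> c \<otimes> x \<in> B"
  shows "len R (Idl G <+> B) B \<le> of_nat (card G) * len R (carrier R) C"
  using assms(1,2,5)
proof (induction G rule: finite_induct)
  case empty
  show ?case using assms zero_add_ideal[OF assms(3)] by (simp add: genideal_empty)
next
  case (insert x G)
  have xX: "x \<in> carrier R" "G \<subseteq> carrier R" using insert.prems by auto
  let ?D = "Idl G <+> B"
  have D: "ideal ?D R" "B \<subseteq> ?D" using xX assms genideal_ideal add_ideals sum_upper2 by auto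
  have E: "ideal (PIdl x) R" "ideal (PIdl x <+> ?D) R" "?D \<subseteq> PIdl x <+> ?D"
    using cgenideal_ideal xX D add_ideals sum_upper2 by auto
  have eq: "Idl (insert x G) <+> B = PIdl x <+> ?D"
    using xX assms(3) E(1) genideal_ideal[OF xX(2)] ideal_sub
    by (simp add: genideal_insert set_add_def add.set_mult_assoc)
  have "len R (PIdl x <+> ?D) B = len R (PIdl x <+> ?D) ?D + len R ?D B"
    using D E assms(3) by (intro len_add) auto
  moreover have "len R (PIdl x <+> ?D) ?D \<le> len R (carrier R) C"
  proof -
    have "C \<subseteq> ideal_colon R ?D {x}"
      using insert.prems(2) D(2) ideal_carr[OF assms(4)] by (auto simp: ideal_colon_def)
    then have "len R (carrier R) (ideal_colon R ?D {x}) \<le> len R (carrier R) C"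
      using ideal_colon_ideal[OF D(1), of "{x}"] assms(4) xX oneideal ideal_sub
      by (intro len_mono) (auto simp: ideal_colon_def)
    then show ?thesis using len_cyclic[OF D(1) xX(1)] by simp
  qed
  moreover have "len R ?D B \<le> of_nat (card G) * len R (carrier R) C" using insert by auto
  ultimately show ?case using insert.hyps eq add_mono by (fastforce simp: distrib_right)
qed

end

section \<open>Noetherian and local rings\<close>

locale noetherian_cring = cring + noetherian_ring

locale noetherian_local = noetherian_cring + local_ring

lemma (in noetherian_cring) acc_ideals: "acc {I. ideal I R}"
  unfolding acc_def
proof (intro allI impI)
  fix s :: "nat \<Rightarrow> 'a set" assume s: "range s \<subseteq> {I. ideal I R}" "mono s"
  have "s i \<subseteq> s j \<or> s j \<subseteq> s i" for i j using s(2) by (meson linear monoD)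
  then have "subset.chain {I. ideal I R} (range s)"
    using s(1) unfolding subset.chain_def by auto
  then have "\<Union>(range s) \<in> range s" by (intro ideal_chain_is_trivial) auto
  then obtain k where k: "\<Union>(range s) = s k" by auto
  have "s n = s k" if "n \<ge> k" for n using k that s(2) by (auto dest: monoD)
  then show "\<exists>k. \<forall>n\<ge>k. s n = s k" by blast
qed

lemma (in noetherian_cring) ex_maximal_ideal_in:
  assumes "ideal K R" "P K"
  shows "\<exists>M. ideal M R \<and> K \<subseteq> M \<and> P M \<and> (\<forall>N. ideal N R \<longrightarrow> P N \<longrightarrow> M \<subseteq> N \<longrightarrow> N = M)"
proof -
  let ?S = "{I. ideal I R \<and> K \<subseteq> I \<and> P I}"
  have "\<exists>M\<in>?S. \<forall>N\<in>?S. M \<subseteq> N \<longrightarrow> N = M"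
  proof (rule subset_Zorn_nonempty)
    show "?S \<noteq> {}" using assms by auto
    fix C assume C: "C \<noteq> {}" "subset.chain ?S C"
    then have "subset.chain {I. ideal I R} C" unfolding subset.chain_def by auto
    then have "\<Union>C \<in> C" using C(1) by (intro ideal_chain_is_trivial)
    then show "\<Union>C \<in> ?S" using C(2) unfolding subset.chain_def by auto
  qed
  then obtain M where M: "M \<in> ?S" "\<forall>N\<in>?S. M \<subseteq> N \<longrightarrow> N = M" by (rule bexE)
  have "N = M" if "ideal N R" "P N" "M \<subseteq> N" for N
  proof -
    have "N \<in> ?S" using M(1) that by blast
    then show ?thesis using M(2) that(3) by blast
  qed
  then show ?thesis using M(1) by blast
qed

context local_ring
begin

abbreviation max_ideal_of_ring ("\<mm>") where "\<mm> \<equiv> max_ideal R"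

lemma maximalideal_max: "maximalideal \<mm> R"
  unfolding max_ideal_def using unique_maximal by (rule theI')

lemma max_ideal: "ideal \<mm> R"
  using maximalideal_max by (rule maximalideal.axioms(1))

lemma max_prime: "primeideal \<mm> R"
  using maximalideal_max by (rule maximalideal_prime)

lemma one_notin_max: "\<one> \<notin> \<mm>"
  using maximalideal.I_notcarr[OF maximalideal_max] ideal.one_imp_carrier[OF max_ideal] by auto

end

context noetherian_local
begin

lemma proper_ideal_le_max:
  assumes "ideal I R" "\<one> \<notin> I"
  shows "I \<subseteq> \<mm>"
proof -
  obtain M where M: "ideal M R" "I \<subseteq> M" "\<one> \<notin> M"
    "\<And>N. ideal N R \<Longrightarrow> \<one> \<notin> N \<Longrightarrow> M \<subseteq> N \<Longrightarrow> N = M"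
    using ex_maximal_ideal_in[of I "\<lambda>N. \<one> \<notin> N"] assms by blast
  have "maximalideal M R"
  proof (rule maximalidealI[OF M(1)])
    show "carrier R \<noteq> M" using M(3) by auto
    show "J = M \<or> J = carrier R" if "ideal J R" "M \<subseteq> J" "J \<subseteq> carrier R" for J
      using M(4)[OF that(1) _ that(2)] ideal.one_imp_carrier[OF that(1)] by blast
  qed
  then have "M = \<mm>" using unique_maximal maximalideal_max by blast
  then show ?thesis using M(2) by simp
qed

lemma unit_if_notin_max:
  assumes "r \<in> carrier R" "r \<notin> \<mm>"
  obtains s where "s \<in> carrier R" "s \<otimes> r = \<one>"
proof -
  have "\<one> \<in> PIdl r"
    using proper_ideal_le_max[OF cgenideal_ideal[OF assms(1)]] cgenideal_self[OF assms(1)] assms(2) by blast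
  then obtain s where "s \<in> carrier R" "\<one> = s \<otimes> r" unfolding cgenideal_def by auto
  then show ?thesis using that[of s] by simp
qed

lemma len_residue_field: "len R (carrier R) \<mm> \<le> 1"
proof -
  have "\<not> ideal_chain R (Suc (Suc n)) (carrier R) \<mm>" for n
  proof
    assume "ideal_chain R (Suc (Suc n)) (carrier R) \<mm>"
    then show False
    proof cases
      case (step B')
      then have B': "ideal B' R" "B' \<noteq> carrier R" "\<mm> \<subset> B'"
        using ideal_chainD[OF step(1)] ideal_chain.cases[OF step(1)] by (auto dest: ideal_chainD)
      then have "\<one> \<notin> B'" using ideal.one_imp_carrier by blast
      then show False using proper_ideal_le_max B' by blast
    qed
  qed
  then have "n \<le> 1" if "ideal_chain R n (carrier R) \<mm>" for n
    using that by (cases n) (auto, metis not0_implies_Suc)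
  then show ?thesis unfolding len_def by (intro Sup_least) (auto simp: one_enat_def)
qed

lemma ideal_finite_gens:
  assumes "ideal I R" obtains xs where "set xs \<subseteq> carrier R" "I = Idl (set xs)"
  using finetely_gen[OF assms] finite_list by metis

lemma len_max_pow_finite: "len R (carrier R) (ideal_pow R \<mm> n) < \<infinity>"
proof (induction n)
  case (Suc n)
  let ?P = "ideal_pow R \<mm>"
  have ids: "ideal (?P k) R" for k using max_ideal by (rule pow_ideal)
  obtain xs where xs: "set xs \<subseteq> carrier R" "?P n = Idl (set xs)" using ideal_finite_gens[OF ids] .
  have sub: "?P (Suc n) \<subseteq> ?P n" using max_ideal by (intro pow_anti) auto
  have mem: "c \<otimes> x \<in> ?P (Suc n)" if "x \<in> set xs" "c \<in> \<mm>" for x c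
  proof -
    have "x \<in> ?P n" using genideal_mem[OF xs(1) that(1)] xs(2) by simp
    then have "x \<otimes> c \<in> ?P (Suc n)" using that(2) by (auto intro: ideal_prod.prod)
    then show ?thesis using that xs(1) ideal_carr[OF max_ideal] m_comm by (metis subsetD)
  qed
  have "len R (Idl (set xs) <+> ?P (Suc n)) (?P (Suc n)) \<le> of_nat (card (set xs)) * len R (carrier R) \<mm>"
    using mem by (intro len_le_generators xs ids max_ideal) auto
  also have "\<dots> < \<infinity>"
    using len_residue_field by (cases "len R (carrier R) \<mm>") (auto simp: of_nat_eq_enat)
  finally have 1: "len R (Idl (set xs) <+> ?P (Suc n)) (?P (Suc n)) < \<infinity>" .
  have "Idl (set xs) <+> ?P (Suc n) = ?P n"
    using sum_le[OF ids order_refl sub] sum_upper1[OF ids ids, of n "Suc n"] xs(2) by auto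
  then have "len R (?P n) (?P (Suc n)) < \<infinity>" using 1 by simp
  moreover have "len R (carrier R) (?P (Suc n)) = len R (carrier R) (?P n) + len R (?P n) (?P (Suc n))"
    by (rule len_add[OF oneideal ids ids sub ideal_sub[OF ids]])
  ultimately show ?case using Suc by auto
qed (simp add: oneideal)

end

section \<open>Monomials\<close>

fun pprod :: "('a, 'm) ring_scheme \<Rightarrow> 'a list \<Rightarrow> nat list \<Rightarrow> 'a"
  where
    "pprod R (x # xs) (a # \<alpha>) = x [^]\<^bsub>R\<^esub> a \<otimes>\<^bsub>R\<^esub> pprod R xs \<alpha>"
  | "pprod R _ _ = \<one>\<^bsub>R\<^esub>"

context cring
begin

lemma pprod_closed [simp]: "set xs \<subseteq> carrier R \<Longrightarrow> pprod R xs \<alpha> \<in> carrier R"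
proof (induction xs arbitrary: \<alpha>)
  case (Cons x xs)
  then show ?case by (cases \<alpha>) auto
qed simp

lemma pprod_padd:
  assumes "set xs \<subseteq> carrier R" "length \<alpha> = length xs" "length \<beta> = length xs"
  shows "pprod R xs (padd \<alpha> \<beta>) = pprod R xs \<alpha> \<otimes> pprod R xs \<beta>"
  using assms
proof (induction xs arbitrary: \<alpha> \<beta>)
  case (Cons x xs)
  obtain a \<alpha>' b \<beta>' where ab: "\<alpha> = a # \<alpha>'" "\<beta> = b # \<beta>'" "length \<alpha>' = length xs" "length \<beta>' = length xs"
    using Cons.prems by (cases \<alpha>; cases \<beta>) auto
  then show ?case using Cons by (simp add: nat_pow_mult[symmetric] m_ac)
qed simp

lemma pprod_incr:
  assumes "set xs \<subseteq> carrier R" "length \<alpha> = length xs" "i < length xs"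
  shows "pprod R xs (\<alpha>[i := Suc (\<alpha> ! i)]) = xs ! i \<otimes> pprod R xs \<alpha>"
  using assms
proof (induction xs arbitrary: \<alpha> i)
  case (Cons x xs)
  obtain a \<alpha>' where ab: "\<alpha> = a # \<alpha>'" "length \<alpha>' = length xs" using Cons.prems by (cases \<alpha>) auto
  show ?case
  proof (cases i)
    case 0
    then show ?thesis using Cons.prems ab by (simp add: m_ac)
  next
    case (Suc j)
    then show ?thesis using Cons ab by (simp add: m_lcomm subset_iff)
  qed
qed simp

lemma pprod_decr:
  assumes "set xs \<subseteq> carrier R" "length \<alpha> = length xs" "i < length xs" "\<alpha> ! i > 0"
  shows "pprod R xs \<alpha> = xs ! i \<otimes> pprod R xs (\<alpha>[i := \<alpha> ! i - 1])"
  using pprod_incr[of xs "\<alpha>[i := \<alpha> ! i - 1]" i] assms by simp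

lemma exps_incr: "\<alpha> \<in> exps r n \<Longrightarrow> i < r \<Longrightarrow> \<alpha>[i := Suc (\<alpha> ! i)] \<in> exps r (Suc n)"
  using elem_le_sum_list[of i \<alpha>] by (auto simp: exps_def sum_list_update)

lemma exps_decr: "\<alpha> \<in> exps r (Suc n) \<Longrightarrow> i < r \<Longrightarrow> \<alpha> ! i > 0 \<Longrightarrow> \<alpha>[i := \<alpha> ! i - 1] \<in> exps r n"
  using elem_le_sum_list[of i \<alpha>] by (auto simp: exps_def sum_list_update)

lemma pprod_zero: "pprod R xs (replicate r 0) = \<one>"
  if "set xs \<subseteq> carrier R" using that
proof (induction xs arbitrary: r)
  case (Cons x xs)
  then show ?case by (cases r) auto
qed simp

lemma pprod_in_pow:
  assumes "ideal Q R" "set xs \<subseteq> Q" "length \<alpha> = length xs"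
  shows "pprod R xs \<alpha> \<in> ideal_pow R Q (sum_list \<alpha>)"
  using assms(2,3)
proof (induction xs arbitrary: \<alpha>)
  case (Cons x xs)
  obtain a \<alpha>' where ab: "\<alpha> = a # \<alpha>'" "length \<alpha>' = length xs" using Cons.prems by (cases \<alpha>) auto
  then show ?case using Cons pow_elem[OF assms(1), of x a] pow_mult_mem[OF assms(1)] by simp
qed simp

lemma pprod_in_carr_sub: "set xs \<subseteq> carrier R \<Longrightarrow> pprod R xs ` T \<subseteq> carrier R"
  by auto

lemma pow_eq_monomials:
  assumes "set xs \<subseteq> carrier R"
  shows "ideal_pow R (Idl (set xs)) n = Idl (pprod R xs ` exps (length xs) n)"
proof
  have Q: "ideal (Idl (set xs)) R" using assms by (rule genideal_ideal)
  have I: "ideal (Idl (pprod R xs ` exps (length xs) n)) R" for n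
    using pprod_in_carr_sub[OF assms] by (rule genideal_ideal)
  have "pprod R xs ` exps (length xs) n \<subseteq> ideal_pow R (Idl (set xs)) n"
    using pprod_in_pow[OF Q genideal_self[OF assms]] by (auto simp: exps_def)
  then show "Idl (pprod R xs ` exps (length xs) n) \<subseteq> ideal_pow R (Idl (set xs)) n"
    using pow_ideal[OF Q] by (intro genideal_le)
  show "ideal_pow R (Idl (set xs)) n \<subseteq> Idl (pprod R xs ` exps (length xs) n)"
  proof (induction n)
    case 0
    have "\<one> \<in> pprod R xs ` exps (length xs) 0"
      using pprod_zero[OF assms] by (intro image_eqI[of _ _ "replicate (length xs) 0"]) (auto simp: exps_def)
    then have "\<one> \<in> Idl (pprod R xs ` exps (length xs) 0)"
      using pprod_in_carr_sub[OF assms] by (intro genideal_mem)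
    then show ?case using ideal.one_imp_carrier[OF I] by simp
  next
    case (Suc n)
    have "a \<otimes> b \<in> Idl (pprod R xs ` exps (length xs) (Suc n))"
      if "a \<in> Idl (pprod R xs ` exps (length xs) n)" "b \<in> Idl (set xs)" for a b
    proof (rule genideal_mult_genideal_le[OF I pprod_in_carr_sub[OF assms] assms _ that])
      fix y x assume "y \<in> pprod R xs ` exps (length xs) n" "x \<in> set xs"
      then obtain \<alpha> i where *: "\<alpha> \<in> exps (length xs) n" "y = pprod R xs \<alpha>" "i < length xs" "x = xs ! i"
        by (auto simp: in_set_conv_nth)
      then have "y \<otimes> x = pprod R xs (\<alpha>[i := Suc (\<alpha> ! i)])"
        using pprod_incr[OF assms] assms by (simp add: exps_def m_comm subset_iff)
      then show "y \<otimes> x \<in> Idl (pprod R xs ` exps (length xs) (Suc n))"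
        using exps_incr[OF *(1,3)] pprod_in_carr_sub[OF assms] by (auto intro: genideal_mem)
    qed
    then show ?case using Suc I by (simp, intro prod_le) auto
  qed
qed

end

section \<open>Monomial orders\<close>

text \<open>Two orders on the exponent vectors of a fixed degree: the lexicographic one, and the one that reverses the comparison of the
first exponent. For the second order, the leading monomial of a form has the least exponent in the first variable, so this
exponent is the largest power of the first variable that divides the form.\<close>

fun llt :: "nat list \<Rightarrow> nat list \<Rightarrow> bool"
  where
    "llt (a # \<alpha>) (b # \<beta>) \<longleftrightarrow> a < b \<or> (a = b \<and> llt \<alpha> \<beta>)"
  | "llt _ _ \<longleftrightarrow> False"

fun rlt :: "nat list \<Rightarrow> nat list \<Rightarrow> bool"
  where
    "rlt (a # \<alpha>) (b # \<beta>) \<longleftrightarrow> b < a \<or> (a = b \<and> llt \<alpha> \<beta>)"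
  | "rlt _ _ \<longleftrightarrow> False"

definition mon_order :: "(nat list \<Rightarrow> nat list \<Rightarrow> bool) \<Rightarrow> bool"
  where "mon_order lt \<longleftrightarrow> (\<forall>\<alpha>. \<not> lt \<alpha> \<alpha>) \<and> (\<forall>\<alpha> \<beta> \<gamma>. lt \<alpha> \<beta> \<longrightarrow> lt \<beta> \<gamma> \<longrightarrow> lt \<alpha> \<gamma>) \<and>
    (\<forall>\<alpha> \<beta>. length \<alpha> = length \<beta> \<longrightarrow> \<alpha> \<noteq> \<beta> \<longrightarrow> lt \<alpha> \<beta> \<or> lt \<beta> \<alpha>) \<and>
    (\<forall>\<alpha> \<beta> \<gamma>. length \<alpha> = length \<gamma> \<longrightarrow> length \<beta> = length \<gamma> \<longrightarrow> lt \<alpha> \<beta> \<longrightarrow> lt (padd \<alpha> \<gamma>) (padd \<beta> \<gamma>))"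

lemma mon_order_irrefl: "mon_order lt \<Longrightarrow> \<not> lt \<alpha> \<alpha>"
  and mon_order_trans: "mon_order lt \<Longrightarrow> lt \<alpha> \<beta> \<Longrightarrow> lt \<beta> \<gamma> \<Longrightarrow> lt \<alpha> \<gamma>"
  and mon_order_total: "mon_order lt \<Longrightarrow> length \<alpha> = length \<beta> \<Longrightarrow> \<alpha> \<noteq> \<beta> \<Longrightarrow> lt \<alpha> \<beta> \<or> lt \<beta> \<alpha>"
  and mon_order_padd: "mon_order lt \<Longrightarrow> length \<alpha> = length \<gamma> \<Longrightarrow> length \<beta> = length \<gamma> \<Longrightarrow> lt \<alpha> \<beta> \<Longrightarrow>
    lt (padd \<alpha> \<gamma>) (padd \<beta> \<gamma>)"
  unfolding mon_order_def by blast+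

lemma llt_irrefl: "\<not> llt \<alpha> \<alpha>"
  by (induction \<alpha>) auto

lemma llt_trans: "llt \<alpha> \<beta> \<Longrightarrow> llt \<beta> \<gamma> \<Longrightarrow> llt \<alpha> \<gamma>"
proof (induction \<alpha> \<beta> arbitrary: \<gamma> rule: llt.induct)
  case (1 a \<alpha> b \<beta>)
  then show ?case by (cases \<gamma>) auto
qed auto

lemma llt_total: "length \<alpha> = length \<beta> \<Longrightarrow> \<alpha> \<noteq> \<beta> \<Longrightarrow> llt \<alpha> \<beta> \<or> llt \<beta> \<alpha>"
  by (induction \<alpha> \<beta> rule: list_induct2) auto

lemma llt_padd:
  "length \<alpha> = length \<gamma> \<Longrightarrow> length \<beta> = length \<gamma> \<Longrightarrow> llt \<alpha> \<beta> \<Longrightarrow> llt (padd \<alpha> \<gamma>) (padd \<beta> \<gamma>)"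
proof (induction \<alpha> \<beta> arbitrary: \<gamma> rule: llt.induct)
  case (1 a \<alpha> b \<beta>)
  then show ?case by (cases \<gamma>) auto
qed auto

lemma mon_order_llt: "mon_order llt"
  unfolding mon_order_def using llt_irrefl llt_trans llt_total llt_padd by blast

lemma mon_order_rlt: "mon_order rlt"
  unfolding mon_order_def
proof (intro conjI allI impI)
  fix \<alpha> \<beta> \<gamma> :: "nat list"
  show "\<not> rlt \<alpha> \<alpha>" by (cases \<alpha>) (auto simp: llt_irrefl)
  show "rlt \<alpha> \<gamma>" if "rlt \<alpha> \<beta>" "rlt \<beta> \<gamma>"
    using that by (cases \<alpha>; cases \<beta>; cases \<gamma>) (auto intro: llt_trans)
  show "rlt \<alpha> \<beta> \<or> rlt \<beta> \<alpha>" if "length \<alpha> = length \<beta>" "\<alpha> \<noteq> \<beta>"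
    using that by (cases \<alpha>; cases \<beta>) (auto dest: llt_total)
  show "rlt (padd \<alpha> \<gamma>) (padd \<beta> \<gamma>)" if "length \<alpha> = length \<gamma>" "length \<beta> = length \<gamma>" "rlt \<alpha> \<beta>"
    using that by (cases \<alpha>; cases \<beta>; cases \<gamma>) (auto intro: llt_padd)
qed

definition lower :: "(nat list \<Rightarrow> nat list \<Rightarrow> bool) \<Rightarrow> nat list \<Rightarrow> nat list set"
  where "lower lt \<alpha> = {\<beta>. length \<beta> = length \<alpha> \<and> sum_list \<beta> = sum_list \<alpha> \<and> lt \<beta> \<alpha>}"

lemma lower_exps: "\<alpha> \<in> exps r n \<Longrightarrow> lower lt \<alpha> \<subseteq> exps r n"
  by (auto simp: lower_def exps_def)

lemma finite_lower: "finite (lower lt \<alpha>)"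
  by (rule finite_subset[OF lower_exps[of \<alpha> "length \<alpha>" "sum_list \<alpha>"] finite_exps]) (simp add: exps_def)

lemma padd_lower:
  assumes "mon_order lt" "\<beta> \<in> lower lt \<alpha>" "length \<gamma> = length \<alpha>"
  shows "padd \<beta> \<gamma> \<in> lower lt (padd \<alpha> \<gamma>)"
  using assms mon_order_padd[OF assms(1)] by (auto simp: lower_def sum_list_padd)

lemma ex_max_exponent:
  assumes "mon_order lt" "finite T" "T \<noteq> {}" "T \<subseteq> exps r n"
  shows "\<exists>\<alpha>\<in>T. T - {\<alpha>} \<subseteq> lower lt \<alpha>"
  using assms(2-4)
proof (induction T rule: finite_ne_induct)
  case (insert \<beta> T)
  then obtain \<alpha> where \<alpha>: "\<alpha> \<in> T" "T - {\<alpha>} \<subseteq> lower lt \<alpha>" by auto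
  have E: "\<alpha> \<in> exps r n" "\<beta> \<in> exps r n" "T \<subseteq> exps r n" using insert \<alpha> by auto
  have "\<alpha> \<noteq> \<beta>" using \<alpha>(1) insert.hyps by auto
  then consider "lt \<alpha> \<beta>" | "lt \<beta> \<alpha>"
    using mon_order_total[OF assms(1), of \<alpha> \<beta>] E by (auto simp: exps_def)
  then show ?case
  proof cases
    case 1
    have "\<gamma> \<in> lower lt \<beta>" if "\<gamma> \<in> T" for \<gamma>
      using that \<alpha> 1 E mon_order_trans[OF assms(1), of \<gamma> \<alpha> \<beta>] by (cases "\<gamma> = \<alpha>") (auto simp: lower_def exps_def)
    then show ?thesis by auto
  next
    case 2
    then have "\<beta> \<in> lower lt \<alpha>" using E by (auto simp: lower_def exps_def)
    then show ?thesis using \<alpha> by auto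
  qed
qed auto

text \<open>Adding the monomials of one degree in increasing order filters the ideal that they generate, with cyclic quotients.\<close>

lemma lower_induct:
  assumes lt: "mon_order lt" and empty: "P {}"
    and insert: "\<And>\<alpha>. \<alpha> \<in> exps r n \<Longrightarrow> P (lower lt \<alpha>) \<Longrightarrow> P (insert \<alpha> (lower lt \<alpha>))"
  shows "P (exps r n)"
proof -
  have "P T" if "finite T" "T \<subseteq> exps r n" "\<And>\<alpha>. \<alpha> \<in> T \<Longrightarrow> lower lt \<alpha> \<subseteq> T" for T
    using that
  proof (induction "card T" arbitrary: T rule: less_induct)
    case less
    show ?case
    proof (cases "T = {}")
      case False
      then obtain \<alpha> where \<alpha>: "\<alpha> \<in> T" "T - {\<alpha>} \<subseteq> lower lt \<alpha>"
        using ex_max_exponent[OF lt less.prems(1) _ less.prems(2)] by blast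
      have \<alpha>n: "\<alpha> \<notin> lower lt \<alpha>" using mon_order_irrefl[OF lt] by (auto simp: lower_def)
      have T: "T = insert \<alpha> (lower lt \<alpha>)" using \<alpha> less.prems(3)[OF \<alpha>(1)] by auto
      have "P (lower lt \<alpha>)"
      proof (rule less.hyps)
        show "card (lower lt \<alpha>) < card T" using T \<alpha>n less.prems(1) by (auto simp: finite_lower)
        show "lower lt \<alpha> \<subseteq> exps r n" using T less.prems(2) by auto
        show "lower lt \<beta> \<subseteq> lower lt \<alpha>" if "\<beta> \<in> lower lt \<alpha>" for \<beta>
          using that mon_order_trans[OF lt] by (auto simp: lower_def)
      qed (rule finite_lower)
      then show ?thesis using insert \<alpha>(1) less.prems(2) T by auto
    qed (simp add: empty)
  qed
  then show ?thesis using lower_exps by (metis finite_exps subset_refl)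
qed

section \<open>Graded families of ideals\<close>

context cring
begin

lemma low_mult:
  assumes "mon_order lt" "set xs \<subseteq> carrier R" "length \<alpha> = length xs" "length \<gamma> = length xs"
    and "l \<in> Idl (pprod R xs ` lower lt \<alpha>)"
  shows "pprod R xs \<gamma> \<otimes> l \<in> Idl (pprod R xs ` lower lt (padd \<alpha> \<gamma>))"
proof (rule mult_genideal_le[OF _ _ _ _ assms(5)])
  show "ideal (Idl (pprod R xs ` lower lt (padd \<alpha> \<gamma>))) R"
    using assms(2) by (intro genideal_ideal pprod_in_carr_sub)
  fix x assume "x \<in> pprod R xs ` lower lt \<alpha>"
  then obtain \<beta> where \<beta>: "\<beta> \<in> lower lt \<alpha>" "x = pprod R xs \<beta>" by auto
  then have "pprod R xs \<gamma> \<otimes> x = pprod R xs (padd \<beta> \<gamma>)"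
    using pprod_padd[OF assms(2)] assms(2-4) by (simp add: lower_def m_comm)
  moreover have "padd \<beta> \<gamma> \<in> lower lt (padd \<alpha> \<gamma>)" using padd_lower[OF assms(1) \<beta>(1)] assms(3,4) by simp
  ultimately show "pprod R xs \<gamma> \<otimes> x \<in> Idl (pprod R xs ` lower lt (padd \<alpha> \<gamma>))"
    using assms(2) by (auto intro!: genideal_mem)
qed (use assms(2) in \<open>auto intro: pprod_closed\<close>)

lemma graded_pow_mult:
  assumes Q: "ideal Q R" and G: "\<And>n. ideal (G n) R"
    and QG: "\<And>n q g. q \<in> Q \<Longrightarrow> g \<in> G n \<Longrightarrow> q \<otimes> g \<in> G (Suc n)"
    and "y \<in> ideal_pow R Q k" "g \<in> G n"
  shows "y \<otimes> g \<in> G (n + k)"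
proof -
  have "ideal_pow R Q k \<subseteq> ideal_colon R (G (n + k)) (G n)"
  proof (induction k)
    case 0
    then show ?case using G ideal_mult by (auto simp: ideal_colon_def)
  next
    case (Suc k)
    have c: "ideal (ideal_colon R (G (n + Suc k)) (G n)) R"
      using G ideal_sub by (intro ideal_colon_ideal) auto
    have "ideal_pow R Q k \<cdot> Q \<subseteq> ideal_colon R (G (n + Suc k)) (G n)"
    proof (rule prod_le[OF c])
      fix i j assume ij: "i \<in> ideal_pow R Q k" "j \<in> Q"
      have ic: "i \<in> carrier R" "j \<in> carrier R" using ij pow_ideal[OF Q] Q ideal_carr by auto
      have "i \<otimes> j \<otimes> g \<in> G (n + Suc k)" if "g \<in> G n" for g
      proof -
        have gc: "g \<in> carrier R" using that G ideal_carr by auto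
        have "i \<otimes> g \<in> G (n + k)" using Suc ij(1) that by (auto simp: ideal_colon_def)
        then have "j \<otimes> (i \<otimes> g) \<in> G (n + Suc k)" using QG[OF ij(2)] by simp
        then show ?thesis using ic gc by (simp add: m_ac)
      qed
      then show "i \<otimes> j \<in> ideal_colon R (G (n + Suc k)) (G n)" using ic by (auto simp: ideal_colon_def)
    qed
    then show ?case by simp
  qed
  then show ?thesis using assms(4,5) by (auto simp: ideal_colon_def)
qed

end

text \<open>The Hilbert basis theorem for the Rees algebra of \<open>Q\<close>, and thereby the Artin-Rees lemma. Let \<open>c \<alpha>\<close> be
the ideal of coefficients of the monomial \<open>\<alpha>\<close> in elements of \<open>G\<close> whose other monomials are smaller. Multiplication by monomials makes
\<open>c\<close> monotone, so it is constant on finitely many boxes. In degrees beyond all corners, a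
leading monomial \<open>\<alpha>\<close> has a predecessor \<open>\<alpha>'\<close> in its box, which differs by one generator of \<open>Q\<close>. As \<open>c \<alpha> = c \<alpha>'\<close>,
the leading term of an element of \<open>G (Suc n)\<close> is that of a product of this generator with an element of \<open>G n\<close>.\<close>

theorem (in noetherian_cring) graded_ideals_finitely_generated:
  assumes xs: "set xs \<subseteq> carrier R" and Q: "Q = Idl (set xs)"
    and G: "\<And>n. ideal (G n) R" "\<And>n. G n \<subseteq> ideal_pow R Q n"
    and QG: "\<And>n q g. q \<in> Q \<Longrightarrow> g \<in> G n \<Longrightarrow> q \<otimes> g \<in> G (Suc n)"
  shows "\<exists>n0. \<forall>n\<ge>n0. G (Suc n) \<subseteq> Q \<cdot> G n"
proof -
  let ?r = "length xs" and ?m = "pprod R xs"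
  have Qi: "ideal Q R" unfolding Q using xs by (rule genideal_ideal)
  define low where "low \<alpha> = Idl (?m ` lower llt \<alpha>)" for \<alpha>
  have low: "ideal (low \<alpha>) R" for \<alpha> unfolding low_def using xs by (intro genideal_ideal pprod_in_carr_sub)
  define c where "c \<alpha> = ideal_colon R (G (sum_list \<alpha>) <+> low \<alpha>) {?m \<alpha>}" for \<alpha>
  have cmem: "r \<in> c \<alpha> \<longleftrightarrow> r \<in> carrier R \<and> (\<exists>g\<in>G (sum_list \<alpha>). \<exists>l\<in>low \<alpha>. r \<otimes> ?m \<alpha> = g \<oplus> l)" for r \<alpha>
    by (auto simp: c_def ideal_colon_def mem_sum)
  have "\<exists>\<B>. partitions ?r \<B> \<and> (\<forall>S\<in>\<B>. \<forall>\<alpha>. fits S \<alpha> \<longrightarrow> c \<alpha> = c (map fst S))"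
  proof (rule monotone_decomp[OF acc_ideals])
    show "c \<alpha> \<in> {I. ideal I R}" for \<alpha>
      unfolding c_def using xs G(1) low by (auto intro!: ideal_colon_ideal add_ideals pprod_closed)
    fix \<alpha> \<beta> assume \<alpha>: "length \<alpha> = ?r" "ple \<alpha> \<beta>"
    then obtain \<gamma> where \<gamma>: "length \<gamma> = ?r" "\<beta> = padd \<alpha> \<gamma>" using ple_imp_padd by metis
    show "c \<alpha> \<subseteq> c \<beta>"
    proof
      fix r assume "r \<in> c \<alpha>"
      then obtain g l where r: "r \<in> carrier R" "g \<in> G (sum_list \<alpha>)" "l \<in> low \<alpha>" "r \<otimes> ?m \<alpha> = g \<oplus> l"
        by (auto simp: cmem)
      have carr: "g \<in> carrier R" "l \<in> carrier R" "?m \<gamma> \<in> carrier R" "?m \<alpha> \<in> carrier R"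
        using r G(1) low ideal_carr xs by auto
      have "r \<otimes> ?m \<beta> = ?m \<gamma> \<otimes> (r \<otimes> ?m \<alpha>)"
        using pprod_padd[OF xs \<alpha>(1) \<gamma>(1)] \<gamma>(2) carr r(1) by (simp add: m_ac)
      also have "\<dots> = ?m \<gamma> \<otimes> g \<oplus> ?m \<gamma> \<otimes> l" unfolding r(4) using carr by (simp add: r_distr)
      finally have eq: "r \<otimes> ?m \<beta> = ?m \<gamma> \<otimes> g \<oplus> ?m \<gamma> \<otimes> l" .
      have "?m \<gamma> \<in> ideal_pow R Q (sum_list \<gamma>)"
        using pprod_in_pow[OF Qi _ \<gamma>(1)] genideal_self[OF xs] Q by simp
      then have "?m \<gamma> \<otimes> g \<in> G (sum_list \<beta>)"
        using graded_pow_mult[of Q G, OF Qi G(1) QG _ r(2)] \<gamma> \<alpha> by (simp add: sum_list_padd)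
      moreover have "?m \<gamma> \<otimes> l \<in> low \<beta>"
        using low_mult[OF mon_order_llt xs \<alpha>(1) \<gamma>(1)] r(3) \<gamma>(2) by (simp add: low_def)
      ultimately show "r \<in> c \<beta>" using r(1) eq by (auto simp: cmem)
    qed
  qed
  then obtain \<B> where \<B>: "partitions ?r \<B>" "\<And>S \<alpha>. S \<in> \<B> \<Longrightarrow> fits S \<alpha> \<Longrightarrow> c \<alpha> = c (map fst S)" by blast
  define n0 where "n0 = (\<Sum>S\<in>\<B>. sum_list (map fst S))"
  have "G (Suc n) \<subseteq> Q \<cdot> G n" if n: "n \<ge> n0" for n
  proof -
    let ?E = "exps ?r (Suc n)"
    have QGi: "ideal (Q \<cdot> G n) R" using Qi G(1) by (rule ideal_prod_is_ideal)
    have "G (Suc n) \<inter> Idl (?m ` ?E) \<subseteq> Q \<cdot> G n"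
    proof (rule lower_induct[where P = "\<lambda>T. G (Suc n) \<inter> Idl (?m ` T) \<subseteq> Q \<cdot> G n", OF mon_order_llt])
      show "G (Suc n) \<inter> Idl (?m ` {}) \<subseteq> Q \<cdot> G n" using ideal_zero[OF QGi] by (auto simp: genideal_empty)
      fix \<alpha> assume \<alpha>: "\<alpha> \<in> ?E" and IH: "G (Suc n) \<inter> Idl (?m ` lower llt \<alpha>) \<subseteq> Q \<cdot> G n"
      have len\<alpha>: "length \<alpha> = ?r" "sum_list \<alpha> = Suc n" using \<alpha> by (auto simp: exps_def)
      obtain S where S: "S \<in> \<B>" "fits S \<alpha>" using partitions_ex[OF \<B>(1) len\<alpha>(1)] .
      have "sum_list (map fst S) \<le> n0"
        unfolding n0_def using \<B>(1) S(1) by (intro member_le_sum) (auto simp: partitions_def)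
      then obtain i where i: "i < ?r" "\<alpha> ! i > 0" "fits S (\<alpha>[i := \<alpha> ! i - 1])"
        using fits_above_corner[OF S(2)] n len\<alpha> by auto
      let ?\<alpha>' = "\<alpha>[i := \<alpha> ! i - 1]"
      have \<alpha>': "?\<alpha>' \<in> exps ?r n" using exps_decr[OF \<alpha> i(1,2)] .
      have c_eq: "c \<alpha> = c ?\<alpha>'" using \<B>(2)[OF S] \<B>(2)[OF S(1) i(3)] by simp
      have xi: "xs ! i \<in> carrier R" "xs ! i \<in> Q" using i(1) xs genideal_self[OF xs] Q by auto
      have m\<alpha>: "?m \<alpha> = xs ! i \<otimes> ?m ?\<alpha>'" using pprod_decr[OF xs len\<alpha>(1) i(1,2)] .
      show "G (Suc n) \<inter> Idl (?m ` insert \<alpha> (lower llt \<alpha>)) \<subseteq> Q \<cdot> G n"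
      proof
        fix g assume "g \<in> G (Suc n) \<inter> Idl (?m ` insert \<alpha> (lower llt \<alpha>))"
        then have g: "g \<in> G (Suc n)" "g \<in> PIdl (?m \<alpha>) <+> low \<alpha>"
          using xs by (auto simp: low_def genideal_insert pprod_in_carr_sub)
        then obtain r l where r: "r \<in> carrier R" "l \<in> low \<alpha>" "g = r \<otimes> ?m \<alpha> \<oplus> l"
          by (auto simp: mem_PIdl_sum)
        have carr: "?m \<alpha> \<in> carrier R" "l \<in> carrier R" "?m ?\<alpha>' \<in> carrier R" "g \<in> carrier R"
          using ideal_carr[OF low r(2)] ideal_carr[OF G(1) g(1)] xs by auto
        have "r \<otimes> ?m \<alpha> = g \<oplus> (\<ominus> l)" unfolding r(3) using carr r(1) by algebra
        then have "r \<in> c \<alpha>" using g(1) r(1,2) len\<alpha> ideal_neg[OF low] by (auto simp: cmem)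
        then obtain g' l' where g': "g' \<in> G n" "l' \<in> low ?\<alpha>'" "r \<otimes> ?m ?\<alpha>' = g' \<oplus> l'"
          using c_eq \<alpha>' by (auto simp: cmem exps_def)
        have carr': "g' \<in> carrier R" "l' \<in> carrier R" using g' G(1) low ideal_carr by auto
        have xg: "xs ! i \<otimes> g' \<in> Q \<cdot> G n" using xi(2) g'(1) by (rule ideal_prod.prod)
        have xgG: "xs ! i \<otimes> g' \<in> G (Suc n)" using QG[OF xi(2) g'(1)] .
        have xl: "xs ! i \<otimes> l' \<in> low \<alpha>"
        proof -
          let ?e = "(replicate ?r 0)[i := Suc 0]"
          have "?m ?e = xs ! i" using pprod_incr[OF xs, of "replicate ?r 0" i] i(1) pprod_zero[OF xs] xi by simp
          moreover have "padd ?\<alpha>' ?e = \<alpha>"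
            using len\<alpha> i(1,2) by (intro nth_equalityI) (auto simp: nth_list_update)
          ultimately show ?thesis
            using low_mult[OF mon_order_llt xs, of ?\<alpha>' ?e l'] g'(2) len\<alpha> by (simp add: low_def)
        qed
        have "r \<otimes> ?m \<alpha> = xs ! i \<otimes> (r \<otimes> ?m ?\<alpha>')" unfolding m\<alpha> using xi(1) r(1) carr(3) by (simp add: m_ac)
        also have "\<dots> = xs ! i \<otimes> g' \<oplus> xs ! i \<otimes> l'" unfolding g'(3) using xi(1) carr' by (simp add: r_distr)
        finally have rm: "r \<otimes> ?m \<alpha> = xs ! i \<otimes> g' \<oplus> xs ! i \<otimes> l'" .
        have "g \<ominus> xs ! i \<otimes> g' = xs ! i \<otimes> l' \<oplus> l"
          unfolding r(3) rm using xi(1) carr carr' by algebra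
        then have "g \<ominus> xs ! i \<otimes> g' \<in> low \<alpha>" using ideal_add[OF low xl r(2)] by simp
        moreover have "g \<ominus> xs ! i \<otimes> g' \<in> G (Suc n)" using g(1) xgG G(1) ideal_minus by auto
        ultimately have "g \<ominus> xs ! i \<otimes> g' \<in> Q \<cdot> G n" using IH by (auto simp: low_def)
        then have "(g \<ominus> xs ! i \<otimes> g') \<oplus> xs ! i \<otimes> g' \<in> Q \<cdot> G n" using xg QGi ideal_add by auto
        moreover have "(g \<ominus> xs ! i \<otimes> g') \<oplus> xs ! i \<otimes> g' = g" using carr carr' xi(1) by algebra
        ultimately show "g \<in> Q \<cdot> G n" by simp
      qed
    qed
    then show ?thesis using G(2)[of "Suc n"] pow_eq_monomials[OF xs, of "Suc n"] Q by blast
  qed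
  then show ?thesis by blast
qed

section \<open>Analytic independence\<close>

text \<open>Let \<open>Q\<close> be the ideal generated by \<open>xs\<close>. In the fibre ring of \<open>Q\<close> modulo \<open>\<aa>\<close>, the forms of degree \<open>n\<close> are the
elements of \<open>Q^n + \<aa>\<close>, and \<open>nul\<close> collects those that represent zero. The
family \<open>xs\<close> is analytically independent if the fibre ring is a polynomial ring in \<open>xs\<close> over the residue field.\<close>

definition (in local_ring) nul :: "'a set \<Rightarrow> 'a list \<Rightarrow> nat \<Rightarrow> 'a set"
  where "nul \<aa> xs n = \<mm> \<cdot> ideal_pow R (Idl (set xs)) n <+> \<aa>"

definition (in local_ring) indep :: "'a set \<Rightarrow> 'a list \<Rightarrow> bool"
  where "indep \<aa> xs \<longleftrightarrow> (\<forall>\<alpha>. length \<alpha> = length xs \<longrightarrow>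
    pprod R xs \<alpha> \<notin> Idl (pprod R xs ` (exps (length xs) (sum_list \<alpha>) - {\<alpha>})) <+> nul \<aa> xs (sum_list \<alpha>))"

locale independent_family = noetherian_local +
  fixes \<aa> :: "'a set" and xs :: "'a list"
  assumes aa: "ideal \<aa> R" and xs: "set xs \<subseteq> carrier R" and indep: "indep \<aa> xs"
begin

abbreviation Q :: "'a set" where "Q \<equiv> Idl (set xs)"
abbreviation QP :: "nat \<Rightarrow> 'a set" where "QP n \<equiv> ideal_pow R Q n"
abbreviation N :: "nat \<Rightarrow> 'a set" where "N n \<equiv> nul \<aa> xs n"
definition E :: "nat \<Rightarrow> 'a set" where "E n = QP n <+> \<aa>"
abbreviation pp :: "nat list \<Rightarrow> 'a" where "pp \<equiv> pprod R xs"

lemma Q_ideal: "ideal Q R" using xs by (rule genideal_ideal)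
lemma QP_ideal: "ideal (QP n) R" using Q_ideal by (rule pow_ideal)
lemma mQP_ideal: "ideal (\<mm> \<cdot> QP n) R" using max_ideal QP_ideal by (rule ideal_prod_is_ideal)
lemma N_ideal: "ideal (N n) R" unfolding nul_def using mQP_ideal aa by (rule add_ideals)
lemma E_ideal: "ideal (E n) R" unfolding E_def using QP_ideal aa by (rule add_ideals)
lemma QP_carr: "x \<in> QP n \<Longrightarrow> x \<in> carrier R" using QP_ideal ideal_carr by blast
lemma N_carr: "x \<in> N n \<Longrightarrow> x \<in> carrier R" using N_ideal ideal_carr by blast
lemma E_carr: "x \<in> E n \<Longrightarrow> x \<in> carrier R" using E_ideal ideal_carr by blast
lemma QP_le_E: "QP n \<subseteq> E n" unfolding E_def using QP_ideal aa by (rule sum_upper1)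
lemma aa_le_E: "\<aa> \<subseteq> E n" unfolding E_def using QP_ideal aa by (rule sum_upper2)
lemma aa_le_N: "\<aa> \<subseteq> N n" unfolding nul_def using mQP_ideal aa by (rule sum_upper2)
lemma mQP_le_N: "\<mm> \<cdot> QP n \<subseteq> N n" unfolding nul_def using mQP_ideal aa by (rule sum_upper1)

lemma N_le_E: "N n \<subseteq> E n"
  unfolding nul_def E_def using ideal_prod_inter[OF max_ideal QP_ideal] by (intro add_ideals_mono) auto

lemma E_anti: "m \<le> n \<Longrightarrow> E n \<subseteq> E m"
  unfolding E_def using pow_anti[OF Q_ideal] by (intro add_ideals_mono) auto

lemma pp_closed: "pp \<alpha> \<in> carrier R" using xs by simp

lemma pp_QP: "length \<alpha> = length xs \<Longrightarrow> pp \<alpha> \<in> QP (sum_list \<alpha>)"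
  using pprod_in_pow[OF Q_ideal genideal_self[OF xs]] .

lemma span_ideal: "ideal (Idl (pp ` T)) R"
  using xs by (intro genideal_ideal) auto

lemma span_mono: "S \<subseteq> T \<Longrightarrow> Idl (pp ` S) \<subseteq> Idl (pp ` T)"
  using xs by (intro genideal_sub_mono) auto

lemma span_mem: "\<alpha> \<in> T \<Longrightarrow> pp \<alpha> \<in> Idl (pp ` T)"
  using xs by (intro genideal_mem) auto

lemma QP_span: "QP n = Idl (pp ` exps (length xs) n)"
  using pow_eq_monomials[OF xs] .

lemma QP_mult_E:
  assumes "y \<in> E k" "x \<in> E n" shows "y \<otimes> x \<in> E (n + k)"
proof -
  obtain q p q' p' where *: "q \<in> QP k" "p \<in> \<aa>" "y = q \<oplus> p" "q' \<in> QP n" "p' \<in> \<aa>" "x = q' \<oplus> p'"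
    using assms by (auto simp: E_def mem_sum)
  have c: "q \<in> carrier R" "p \<in> carrier R" "q' \<in> carrier R" "p' \<in> carrier R"
    using * QP_carr ideal_carr[OF aa] by auto
  have "q \<otimes> q' \<in> QP (n + k)" using pow_mult_mem[OF Q_ideal *(4,1)] c by (simp add: m_comm)
  moreover have "q \<otimes> p' \<oplus> p \<otimes> (q' \<oplus> p') \<in> \<aa>"
    using ideal_add[OF aa ideal_mult[OF aa *(5) c(1)] ideal_mult_right[OF aa *(2), of "q' \<oplus> p'"]] c by simp
  moreover have "y \<otimes> x = q \<otimes> q' \<oplus> (q \<otimes> p' \<oplus> p \<otimes> (q' \<oplus> p'))" unfolding *(3,6) using c by algebra
  ultimately show ?thesis unfolding E_def by (simp add: sum_memI)
qed

lemma E_mult_N: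
  assumes "y \<in> E k" "x \<in> N n" shows "y \<otimes> x \<in> N (k + n)"
proof -
  obtain q p m p' where *: "q \<in> QP k" "p \<in> \<aa>" "y = q \<oplus> p" "m \<in> \<mm> \<cdot> QP n" "p' \<in> \<aa>" "x = m \<oplus> p'"
    using assms by (auto simp: E_def nul_def mem_sum)
  have c: "q \<in> carrier R" "p \<in> carrier R" "m \<in> carrier R" "p' \<in> carrier R"
    using * QP_carr ideal_carr[OF aa] ideal_carr[OF mQP_ideal] by auto
  have "q \<otimes> m \<in> QP k \<cdot> (\<mm> \<cdot> QP n)" using * by (intro ideal_prod.prod)
  also have "\<dots> = \<mm> \<cdot> (QP k \<cdot> QP n)"
    using max_ideal QP_ideal ideal_prod_commute ideal_prod_assoc by metis
  also have "\<dots> = \<mm> \<cdot> QP (k + n)" using pow_add[OF Q_ideal] by simp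
  finally have "q \<otimes> m \<in> \<mm> \<cdot> QP (k + n)" .
  moreover have "q \<otimes> p' \<oplus> p \<otimes> (m \<oplus> p') \<in> \<aa>"
    using ideal_add[OF aa ideal_mult[OF aa *(5) c(1)] ideal_mult_right[OF aa *(2), of "m \<oplus> p'"]] c by simp
  moreover have "y \<otimes> x = q \<otimes> m \<oplus> (q \<otimes> p' \<oplus> p \<otimes> (m \<oplus> p'))" unfolding *(3,6) using c by algebra
  ultimately show ?thesis unfolding nul_def by (simp add: sum_memI)
qed

lemma N_mult_E:
  assumes "x \<in> N n" "y \<in> E k" shows "x \<otimes> y \<in> N (n + k)"
  using E_mult_N[OF assms(2,1)] N_carr[OF assms(1)] E_carr[OF assms(2)] by (simp add: m_comm add.commute)

text \<open>\<open>LM lt \<alpha> q\<close> says that \<open>\<alpha>\<close> is the leading monomial of the form \<open>q\<close> in the fibre ring: modulo \<open>B\<close>, the forms with smaller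
monomials, \<open>q\<close> is a multiple of the monomial by a unit.\<close>

definition B :: "(nat list \<Rightarrow> nat list \<Rightarrow> bool) \<Rightarrow> nat list \<Rightarrow> 'a set"
  where "B lt \<alpha> = Idl (pp ` lower lt \<alpha>) <+> N (sum_list \<alpha>)"

definition LM :: "(nat list \<Rightarrow> nat list \<Rightarrow> bool) \<Rightarrow> nat list \<Rightarrow> 'a \<Rightarrow> bool"
  where "LM lt \<alpha> q \<longleftrightarrow> length \<alpha> = length xs \<and>
    (\<exists>u\<in>carrier R - \<mm>. \<exists>b\<in>B lt \<alpha>. q = u \<otimes> pp \<alpha> \<oplus> b)"

lemma B_ideal: "ideal (B lt \<alpha>) R" unfolding B_def using span_ideal N_ideal by (rule add_ideals)
lemma B_carr: "b \<in> B lt \<alpha> \<Longrightarrow> b \<in> carrier R" using B_ideal ideal_carr by blast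
lemma N_le_B: "N (sum_list \<alpha>) \<subseteq> B lt \<alpha>" unfolding B_def using span_ideal N_ideal by (rule sum_upper2)
lemma span_le_B: "Idl (pp ` lower lt \<alpha>) \<subseteq> B lt \<alpha>" unfolding B_def using span_ideal N_ideal by (rule sum_upper1)

lemma LM_carr: "LM lt \<alpha> q \<Longrightarrow> q \<in> carrier R"
  using B_carr pp_closed by (auto simp: LM_def)

lemma LM_add: "LM lt \<alpha> q \<Longrightarrow> b \<in> B lt \<alpha> \<Longrightarrow> LM lt \<alpha> (q \<oplus> b)"
  unfolding LM_def
proof (elim conjE bexE, intro conjI)
  fix u b' assume *: "b \<in> B lt \<alpha>" "u \<in> carrier R - \<mm>" "b' \<in> B lt \<alpha>" "q = u \<otimes> pp \<alpha> \<oplus> b'"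
  have "q \<oplus> b = u \<otimes> pp \<alpha> \<oplus> (b' \<oplus> b)"
    using * B_carr pp_closed by (simp add: a_assoc)
  then show "\<exists>u\<in>carrier R - \<mm>. \<exists>b'\<in>B lt \<alpha>. q \<oplus> b = u \<otimes> pp \<alpha> \<oplus> b'"
    using * ideal_add[OF B_ideal] by blast
qed

lemma LM_cong:
  assumes "LM lt \<alpha> q" "q' \<in> carrier R" "q' \<ominus> q \<in> N (sum_list \<alpha>)" shows "LM lt \<alpha> q'"
proof -
  have "LM lt \<alpha> (q \<oplus> (q' \<ominus> q))" using assms N_le_B by (intro LM_add) auto
  moreover have "q \<oplus> (q' \<ominus> q) = q'" using assms(2) LM_carr[OF assms(1)] by algebra
  ultimately show ?thesis by simp
qed

lemma LM_pp: "length \<alpha> = length xs \<Longrightarrow> LM lt \<alpha> (pp \<alpha>)"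
proof -
  assume "length \<alpha> = length xs"
  moreover have "pp \<alpha> = \<one> \<otimes> pp \<alpha> \<oplus> \<zero>" using pp_closed by simp
  ultimately show ?thesis unfolding LM_def using one_notin_max ideal_zero[OF B_ideal] by blast
qed

text \<open>Take the largest monomial of \<open>q\<close>. If its coefficient lies in \<open>\<mm>\<close>, then this term vanishes in the fibre ring and can be dropped.\<close>

lemma LM_ex:
  assumes lt: "mon_order lt" and "T \<subseteq> exps (length xs) n" "q \<in> Idl (pp ` T) <+> N n" "q \<notin> N n"
  shows "\<exists>\<alpha>\<in>T. LM lt \<alpha> q"
proof -
  have "finite T" using assms(2) finite_exps finite_subset by blast
  then show ?thesis using assms(2-4)
  proof (induction "card T" arbitrary: T rule: less_induct)
    case less
    show ?case
    proof (cases "T = {}")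
      case True
      then show ?thesis using less.prems by (simp add: genideal_empty zero_add_ideal N_ideal)
    next
      case False
      then obtain \<alpha> where \<alpha>: "\<alpha> \<in> T" "T - {\<alpha>} \<subseteq> lower lt \<alpha>"
        using ex_max_exponent[OF lt less.prems(1) _ less.prems(2)] by blast
      let ?T = "T - {\<alpha>}"
      have len: "length \<alpha> = length xs" "sum_list \<alpha> = n" using \<alpha>(1) less.prems(2) by (auto simp: exps_def)
      have "pp ` T = insert (pp \<alpha>) (pp ` ?T)" using \<alpha>(1) by auto
      then have "Idl (pp ` T) = PIdl (pp \<alpha>) <+> Idl (pp ` ?T)"
        using xs by (simp add: genideal_insert image_subset_iff)
      then obtain r l \<nu> where *: "r \<in> carrier R" "l \<in> Idl (pp ` ?T)" "\<nu> \<in> N n" "q = (r \<otimes> pp \<alpha> \<oplus> l) \<oplus> \<nu>"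
        using less.prems(3) by (auto simp: mem_sum[of q] mem_PIdl_sum)
      have c: "l \<in> carrier R" "\<nu> \<in> carrier R" using * ideal_carr[OF span_ideal] N_carr by auto
      show ?thesis
      proof (cases "r \<in> \<mm>")
        case True
        have "r \<otimes> pp \<alpha> \<in> \<mm> \<cdot> QP n" using True pp_QP[OF len(1)] len(2) by (auto intro: ideal_prod.prod)
        then have "r \<otimes> pp \<alpha> \<in> N n" using mQP_le_N by auto
        then have "r \<otimes> pp \<alpha> \<oplus> \<nu> \<in> N n" using *(3) ideal_add[OF N_ideal] by auto
        moreover have "q = l \<oplus> (r \<otimes> pp \<alpha> \<oplus> \<nu>)" unfolding *(4) using c *(1) pp_closed[of \<alpha>] by algebra
        ultimately have "q \<in> Idl (pp ` ?T) <+> N n" using *(2) by (simp add: sum_memI)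
        moreover have "card ?T < card T" using \<alpha>(1) less.prems(1) by (meson card_Diff1_less)
        ultimately have "\<exists>\<beta>\<in>?T. LM lt \<beta> q" using less.prems by (intro less.hyps) auto
        then show ?thesis by auto
      next
        case False
        have "l \<in> Idl (pp ` lower lt \<alpha>)" using *(2) span_mono[OF \<alpha>(2)] by auto
        then have "l \<oplus> \<nu> \<in> B lt \<alpha>" using *(3) len(2) by (auto simp: B_def intro: sum_memI)
        moreover have "q = r \<otimes> pp \<alpha> \<oplus> (l \<oplus> \<nu>)" unfolding *(4) using c *(1) pp_closed[of \<alpha>] by algebra
        ultimately have "LM lt \<alpha> q" using len(1) *(1) False by (auto simp: LM_def)
        then show ?thesis using \<alpha>(1) by auto
      qed
    qed
  qed
qed

lemma E_le_span: "E n \<subseteq> Idl (pp ` exps (length xs) n) <+> N n"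
  unfolding E_def QP_span using aa_le_N by (intro add_ideals_mono) auto

lemma LM_ex_E:
  assumes "mon_order lt" "q \<in> E n" "q \<notin> N n"
  shows "\<exists>\<alpha>\<in>exps (length xs) n. LM lt \<alpha> q"
  using LM_ex[OF assms(1) order_refl _ assms(3)] assms(2) E_le_span by blast

lemma LM_notin_B:
  assumes lt: "mon_order lt" and "LM lt \<alpha> q" shows "q \<notin> B lt \<alpha>"
proof
  assume q: "q \<in> B lt \<alpha>"
  obtain u b where ub: "length \<alpha> = length xs" "u \<in> carrier R" "u \<notin> \<mm>" "b \<in> B lt \<alpha>" "q = u \<otimes> pp \<alpha> \<oplus> b"
    using assms(2) by (auto simp: LM_def)
  obtain v where v: "v \<in> carrier R" "v \<otimes> u = \<one>" using unit_if_notin_max[OF ub(2,3)] .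
  have "v \<otimes> (q \<ominus> b) \<in> B lt \<alpha>" using q ub(4) v(1) ideal_mult[OF B_ideal] ideal_minus[OF B_ideal] by auto
  moreover have "v \<otimes> (q \<ominus> b) = (v \<otimes> u) \<otimes> pp \<alpha>"
    unfolding ub(5) using ub(2) v(1) B_carr[OF ub(4)] pp_closed[of \<alpha>] by algebra
  ultimately have "pp \<alpha> \<in> B lt \<alpha>" using v(2) pp_closed by simp
  moreover have "lower lt \<alpha> \<subseteq> exps (length xs) (sum_list \<alpha>) - {\<alpha>}"
    using ub(1) mon_order_irrefl[OF lt] by (auto simp: lower_def exps_def)
  then have "B lt \<alpha> \<subseteq> Idl (pp ` (exps (length xs) (sum_list \<alpha>) - {\<alpha>})) <+> N (sum_list \<alpha>)"
    unfolding B_def by (intro add_ideals_mono span_mono) auto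
  ultimately show False using indep ub(1) unfolding indep_def by blast
qed

lemma LM_notin_N: "mon_order lt \<Longrightarrow> LM lt \<alpha> q \<Longrightarrow> q \<notin> N (sum_list \<alpha>)"
  using LM_notin_B N_le_B by blast

lemma LM_unique:
  assumes lt: "mon_order lt" and "LM lt \<alpha> q" "LM lt \<beta> q" "sum_list \<alpha> = sum_list \<beta>"
  shows "\<alpha> = \<beta>"
proof -
  have False if *: "LM lt \<alpha> q" "LM lt \<beta> q" "sum_list \<alpha> = sum_list \<beta>" "lt \<alpha> \<beta>" for \<alpha> \<beta>
  proof -
    have len: "length \<alpha> = length xs" "length \<beta> = length xs" using * by (auto simp: LM_def)
    obtain u b where ub: "u \<in> carrier R" "b \<in> B lt \<alpha>" "q = u \<otimes> pp \<alpha> \<oplus> b"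
      using *(1) by (auto simp: LM_def)
    have \<alpha>: "\<alpha> \<in> lower lt \<beta>" using * len by (auto simp: lower_def)
    then have 1: "u \<otimes> pp \<alpha> \<in> B lt \<beta>" using span_mem[OF \<alpha>] span_le_B ideal_mult[OF B_ideal] ub(1) by blast
    have "lower lt \<alpha> \<subseteq> lower lt \<beta>" using \<alpha> mon_order_trans[OF lt] by (auto simp: lower_def)
    then have "B lt \<alpha> \<subseteq> B lt \<beta>" unfolding B_def *(3) by (intro add_ideals_mono span_mono) auto
    then have "q \<in> B lt \<beta>" using 1 ub ideal_add[OF B_ideal] by auto
    then show False using LM_notin_B[OF lt *(2)] by simp
  qed
  then show ?thesis using assms mon_order_total[OF lt, of \<alpha> \<beta>] unfolding LM_def by metis
qed

lemma B_le_E: "length \<alpha> = length xs \<Longrightarrow> B lt \<alpha> \<subseteq> E (sum_list \<alpha>)"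
proof -
  assume len: "length \<alpha> = length xs"
  have "Idl (pp ` lower lt \<alpha>) \<subseteq> QP (sum_list \<alpha>)"
    unfolding QP_span using lower_exps[of \<alpha> "length xs" "sum_list \<alpha>" lt] len
    by (intro span_mono) (auto simp: exps_def)
  then show ?thesis unfolding B_def using QP_le_E N_le_E by (intro sum_le E_ideal) auto
qed

lemma pp_mult: "length \<alpha> = length xs \<Longrightarrow> length \<beta> = length xs \<Longrightarrow> pp \<alpha> \<otimes> pp \<beta> = pp (padd \<alpha> \<beta>)"
  using pprod_padd[OF xs] by simp

lemma padd_commute: "padd \<alpha> \<beta> = padd \<beta> \<alpha>"
  by (induction \<alpha> \<beta> rule: list_induct2') auto

lemma pp_mult_B:
  assumes lt: "mon_order lt" and len: "length \<alpha> = length xs" "length \<beta> = length xs" and b: "b \<in> B lt \<beta>"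
  shows "pp \<alpha> \<otimes> b \<in> B lt (padd \<alpha> \<beta>)"
proof -
  obtain l \<nu> where l: "l \<in> Idl (pp ` lower lt \<beta>)" "\<nu> \<in> N (sum_list \<beta>)" "b = l \<oplus> \<nu>"
    using b by (auto simp: B_def mem_sum)
  have c: "l \<in> carrier R" "\<nu> \<in> carrier R" using l ideal_carr[OF span_ideal] N_carr by auto
  have "pp \<alpha> \<otimes> l \<in> Idl (pp ` lower lt (padd \<alpha> \<beta>))"
    using low_mult[OF lt xs len(2,1) l(1)] by (simp add: padd_commute)
  moreover have "pp \<alpha> \<otimes> \<nu> \<in> N (sum_list (padd \<alpha> \<beta>))"
    using E_mult_N[OF _ l(2), of "pp \<alpha>" "sum_list \<alpha>"] pp_QP[OF len(1)] QP_le_E len by (auto simp: sum_list_padd)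
  ultimately show ?thesis unfolding B_def l(3) using c pp_closed by (simp add: r_distr sum_memI)
qed

lemma B_mult_B:
  assumes lt: "mon_order lt" and len: "length \<alpha> = length xs" "length \<beta> = length xs"
    and b: "b \<in> B lt \<alpha>" "b' \<in> B lt \<beta>"
  shows "b \<otimes> b' \<in> B lt (padd \<alpha> \<beta>)"
proof -
  obtain l \<nu> where l: "l \<in> Idl (pp ` lower lt \<alpha>)" "\<nu> \<in> N (sum_list \<alpha>)" "b = l \<oplus> \<nu>"
    using b by (auto simp: B_def mem_sum)
  obtain l' \<nu>' where l': "l' \<in> Idl (pp ` lower lt \<beta>)" "\<nu>' \<in> N (sum_list \<beta>)" "b' = l' \<oplus> \<nu>'"
    using b by (auto simp: B_def mem_sum)
  have c: "l \<in> carrier R" "\<nu> \<in> carrier R" "l' \<in> carrier R" "\<nu>' \<in> carrier R"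
    using l l' ideal_carr[OF span_ideal] N_carr by auto
  have s: "sum_list (padd \<alpha> \<beta>) = sum_list \<alpha> + sum_list \<beta>" using len by (simp add: sum_list_padd)
  have "l \<otimes> l' \<in> Idl (pp ` lower lt (padd \<alpha> \<beta>))"
  proof (rule genideal_mult_genideal_le[OF span_ideal _ _ _ l(1) l'(1)])
    fix x y assume "x \<in> pp ` lower lt \<alpha>" "y \<in> pp ` lower lt \<beta>"
    then obtain \<gamma> \<delta> where g: "\<gamma> \<in> lower lt \<alpha>" "x = pp \<gamma>" "\<delta> \<in> lower lt \<beta>" "y = pp \<delta>" by auto
    have gl: "length \<gamma> = length xs" "length \<delta> = length xs" using g len by (auto simp: lower_def)
    have "padd \<gamma> \<delta> \<in> lower lt (padd \<alpha> \<delta>)" "padd \<delta> \<alpha> \<in> lower lt (padd \<beta> \<alpha>)"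
      using padd_lower[OF lt g(1), of \<delta>] padd_lower[OF lt g(3), of \<alpha>] gl len by auto
    then have "padd \<gamma> \<delta> \<in> lower lt (padd \<alpha> \<beta>)"
      unfolding padd_commute[of \<delta> \<alpha>] padd_commute[of \<beta> \<alpha>]
      using mon_order_trans[OF lt] by (auto simp: lower_def)
    then show "x \<otimes> y \<in> Idl (pp ` lower lt (padd \<alpha> \<beta>))" using pp_mult[OF gl] g span_mem by metis
  qed (use xs in auto)
  moreover have "\<nu> \<otimes> b' \<in> N (sum_list (padd \<alpha> \<beta>))"
    unfolding s using l(2) b(2) B_le_E[OF len(2)] by (intro N_mult_E) auto
  moreover have "l \<in> E (sum_list \<alpha>)" using l(1) span_le_B B_le_E[OF len(1)] by blast
  then have "l \<otimes> \<nu>' \<in> N (sum_list (padd \<alpha> \<beta>))" unfolding s using l'(2) by (intro E_mult_N)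
  moreover have "b \<otimes> b' = l \<otimes> l' \<oplus> (\<nu> \<otimes> b' \<oplus> l \<otimes> \<nu>')" unfolding l(3) l'(3) using c by algebra
  ultimately show ?thesis unfolding B_def using ideal_add[OF N_ideal] by (metis sum_memI)
qed

lemma LM_mult:
  assumes lt: "mon_order lt" and "LM lt \<alpha> q" "LM lt \<beta> q'"
  shows "LM lt (padd \<alpha> \<beta>) (q \<otimes> q')"
proof -
  obtain u b where ub: "length \<alpha> = length xs" "u \<in> carrier R" "u \<notin> \<mm>" "b \<in> B lt \<alpha>" "q = u \<otimes> pp \<alpha> \<oplus> b"
    using assms(2) by (auto simp: LM_def)
  obtain u' b' where ub': "length \<beta> = length xs" "u' \<in> carrier R" "u' \<notin> \<mm>" "b' \<in> B lt \<beta>" "q' = u' \<otimes> pp \<beta> \<oplus> b'"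
    using assms(3) by (auto simp: LM_def)
  have c: "b \<in> carrier R" "b' \<in> carrier R" "pp \<alpha> \<in> carrier R" "pp \<beta> \<in> carrier R"
    using ub ub' B_carr pp_closed by auto
  have "u \<otimes> u' \<notin> \<mm>" using primeideal.I_prime[OF max_prime] ub ub' by blast
  moreover have "u \<otimes> (pp \<alpha> \<otimes> b') \<oplus> (u' \<otimes> (pp \<beta> \<otimes> b) \<oplus> b \<otimes> b') \<in> B lt (padd \<alpha> \<beta>)"
    using pp_mult_B[OF lt ub(1) ub'(1,4)] pp_mult_B[OF lt ub'(1) ub(1,4)] B_mult_B[OF lt ub(1) ub'(1) ub(4) ub'(4)]
      ub ub' by (auto intro!: ideal_add[OF B_ideal] ideal_mult[OF B_ideal] simp: padd_commute[of \<beta>])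
  moreover have "q \<otimes> q' = (u \<otimes> u') \<otimes> (pp \<alpha> \<otimes> pp \<beta>) \<oplus> (u \<otimes> (pp \<alpha> \<otimes> b') \<oplus> (u' \<otimes> (pp \<beta> \<otimes> b) \<oplus> b \<otimes> b'))"
    unfolding ub(5) ub'(5) using c ub(2) ub'(2) by algebra
  ultimately show ?thesis
    unfolding LM_def using ub ub' pp_mult by auto
qed

text \<open>The fibre ring is a domain, as leading monomials multiply.\<close>

lemma nonnull_mult:
  assumes "q \<in> E m" "q \<notin> N m" "q' \<in> E n" "q' \<notin> N n"
  shows "q \<otimes> q' \<notin> N (m + n)"
proof -
  obtain \<alpha> \<beta> where *: "\<alpha> \<in> exps (length xs) m" "LM llt \<alpha> q" "\<beta> \<in> exps (length xs) n" "LM llt \<beta> q'"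
    using LM_ex_E[OF mon_order_llt] assms by meson
  then show ?thesis
    using LM_notin_N[OF mon_order_llt LM_mult[OF mon_order_llt *(2,4)]] by (simp add: exps_def sum_list_padd)
qed

lemma one_nonnull: "\<one> \<notin> N 0"
proof -
  have "\<one> = pp (replicate (length xs) 0)" using pprod_zero[OF xs] by simp
  then show ?thesis using LM_notin_N[OF mon_order_llt LM_pp[of "replicate (length xs) 0"]]
    by (simp add: sum_list_replicate)
qed

lemma nonnull_pow:
  assumes "q \<in> QP m" "q \<notin> N m" shows "q [^] k \<notin> N (m * k)"
proof (induction k)
  case (Suc k)
  have "q [^] k \<in> QP (m * k)" using pow_elem[OF QP_ideal assms(1), of k] pow_pow[OF Q_ideal] by simp
  then show ?case using nonnull_mult[of "q [^] k" "m * k" q m] Suc assms QP_le_E by (auto simp: add.commute)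
qed (simp add: one_nonnull)

lemma aa_proper: "\<one> \<notin> \<aa>"
  using one_nonnull aa_le_N by blast

text \<open>If adding \<open>a\<close> to \<open>\<aa>\<close> destroys independence, then \<open>a\<close> has a multiple that is a nonzero form in the fibre ring.\<close>

lemma dependent_relation:
  assumes "a \<in> carrier R" "\<not> indep (PIdl a <+> \<aa>) xs"
  shows "\<exists>n. \<exists>q\<in>QP n. q \<notin> N n \<and> (\<exists>r\<in>carrier R. q \<ominus> a \<otimes> r \<in> N n)"
proof -
  let ?X = "\<lambda>\<alpha>. pp ` (exps (length xs) (sum_list \<alpha>) - {\<alpha>})"
  have bb: "ideal (PIdl a) R" using assms(1) by (rule cgenideal_ideal)
  obtain \<alpha> where \<alpha>: "length \<alpha> = length xs"
    "pp \<alpha> \<in> Idl (?X \<alpha>) <+> nul (PIdl a <+> \<aa>) xs (sum_list \<alpha>)"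
    using assms(2) unfolding indep_def by blast
  define n where "n = sum_list \<alpha>"
  obtain l m r p where *: "l \<in> Idl (?X \<alpha>)" "m \<in> \<mm> \<cdot> QP n" "r \<in> carrier R" "p \<in> \<aa>"
    "pp \<alpha> = l \<oplus> (m \<oplus> (r \<otimes> a \<oplus> p))"
    using \<alpha>(2) unfolding nul_def n_def[symmetric] mem_sum[of "pp \<alpha>"]
    by (auto simp: mem_sum[of _ "\<mm> \<cdot> QP n"] mem_PIdl_sum)
  have c: "l \<in> carrier R" "m \<in> carrier R" "p \<in> carrier R"
    using * ideal_carr[OF span_ideal] ideal_carr[OF mQP_ideal] ideal_carr[OF aa] by auto
  have "l \<in> QP n" using *(1) span_mono[of "exps (length xs) (sum_list \<alpha>) - {\<alpha>}" "exps (length xs) n"] QP_span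
    by (auto simp: n_def)
  then have q: "pp \<alpha> \<ominus> l \<in> QP n" using pp_QP[OF \<alpha>(1)] ideal_minus[OF QP_ideal] by (auto simp: n_def)
  have "pp \<alpha> \<ominus> l \<notin> N n"
  proof
    assume "pp \<alpha> \<ominus> l \<in> N n"
    then have "l \<oplus> (pp \<alpha> \<ominus> l) \<in> Idl (?X \<alpha>) <+> N n" using *(1) by (intro sum_memI)
    moreover have "l \<oplus> (pp \<alpha> \<ominus> l) = pp \<alpha>" using c(1) pp_closed[of \<alpha>] by algebra
    ultimately show False using indep \<alpha>(1) unfolding indep_def n_def by auto
  qed
  moreover have "(pp \<alpha> \<ominus> l) \<ominus> a \<otimes> r = m \<oplus> p" unfolding *(5) using c *(3) assms(1) by algebra
  then have "(pp \<alpha> \<ominus> l) \<ominus> a \<otimes> r \<in> N n" using *(2,4) by (auto simp: nul_def intro: sum_memI)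
  ultimately show ?thesis using q *(3) by blast
qed

text \<open>If neither \<open>a\<close> nor \<open>b\<close> lies in \<open>\<aa>\<close>, then both have multiples that are nonzero forms. Their product is a nonzero form
and a multiple of \<open>a \<otimes> b\<close>, so \<open>a \<otimes> b \<notin> \<aa>\<close>.\<close>

lemma maximal_independent_prime:
  assumes max: "\<And>\<bb>. ideal \<bb> R \<Longrightarrow> indep \<bb> xs \<Longrightarrow> \<aa> \<subseteq> \<bb> \<Longrightarrow> \<bb> = \<aa>"
  shows "primeideal \<aa> R"
proof (rule primeidealI[OF aa is_cring])
  show "carrier R \<noteq> \<aa>" using aa_proper by auto
  fix a b assume ab: "a \<in> carrier R" "b \<in> carrier R" "a \<otimes> b \<in> \<aa>"
  have rel: "\<exists>n. \<exists>q\<in>QP n. q \<notin> N n \<and> (\<exists>r\<in>carrier R. q \<ominus> a \<otimes> r \<in> N n)"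
    if "a \<in> carrier R" "a \<notin> \<aa>" for a
  proof (rule dependent_relation[OF that(1)])
    show "\<not> indep (PIdl a <+> \<aa>) xs"
    proof
      assume i: "indep (PIdl a <+> \<aa>) xs"
      have P: "ideal (PIdl a) R" using that(1) by (rule cgenideal_ideal)
      have "PIdl a <+> \<aa> = \<aa>" using max[OF add_ideals[OF P aa] i sum_upper2[OF P aa]] .
      then show False using sum_upper1[OF P aa] cgenideal_self[OF that(1)] that(2) by auto
    qed
  qed
  show "a \<in> \<aa> \<or> b \<in> \<aa>"
  proof (rule ccontr)
    assume "\<not> (a \<in> \<aa> \<or> b \<in> \<aa>)"
    then obtain m q r n q' r' where *: "q \<in> QP m" "q \<notin> N m" "r \<in> carrier R" "q \<ominus> a \<otimes> r \<in> N m"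
      "q' \<in> QP n" "q' \<notin> N n" "r' \<in> carrier R" "q' \<ominus> b \<otimes> r' \<in> N n"
      using rel[OF ab(1)] rel[OF ab(2)] by blast
    have c: "q \<in> carrier R" "q' \<in> carrier R" using * QP_carr by auto
    have qE: "q \<in> E m" "q' \<in> E n" using * QP_le_E by auto
    have "(q \<ominus> a \<otimes> r) \<otimes> q' \<in> N (m + n)" using *(4) qE by (intro N_mult_E)
    moreover have "q \<otimes> (q' \<ominus> b \<otimes> r') \<in> N (m + n)" using *(8) qE by (intro E_mult_N)
    moreover have "(q \<ominus> a \<otimes> r) \<otimes> (q' \<ominus> b \<otimes> r') \<in> N (m + n)"
      using *(4,8) N_le_E by (intro N_mult_E) auto
    moreover have "(a \<otimes> b) \<otimes> (r \<otimes> r') \<in> N (m + n)"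
      using ideal_mult_right[OF aa ab(3), of "r \<otimes> r'"] *(3,7) aa_le_N by blast
    ultimately have "((q \<ominus> a \<otimes> r) \<otimes> q' \<oplus> q \<otimes> (q' \<ominus> b \<otimes> r') \<ominus> (q \<ominus> a \<otimes> r) \<otimes> (q' \<ominus> b \<otimes> r'))
        \<oplus> (a \<otimes> b) \<otimes> (r \<otimes> r') \<in> N (m + n)"
      by (intro ideal_add[OF N_ideal] ideal_minus[OF N_ideal])
    moreover have "((q \<ominus> a \<otimes> r) \<otimes> q' \<oplus> q \<otimes> (q' \<ominus> b \<otimes> r') \<ominus> (q \<ominus> a \<otimes> r) \<otimes> (q' \<ominus> b \<otimes> r'))
        \<oplus> (a \<otimes> b) \<otimes> (r \<otimes> r') = q \<otimes> q'"
      using c ab * by algebra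
    ultimately show False using nonnull_mult[OF qE(1) *(2) qE(2) *(6)] by simp
  qed
qed

end

section \<open>Generic torsion of the associated graded ring\<close>

context independent_family
begin

lemma E_shift: "h \<in> E n \<Longrightarrow> w \<in> QP j \<Longrightarrow> m = n + j \<Longrightarrow> w \<otimes> h \<in> E m"
  using QP_mult_E[of w j h n] QP_le_E by blast

lemma QP_mult: "w \<in> QP i \<Longrightarrow> w' \<in> QP j \<Longrightarrow> w \<otimes> w' \<in> QP (i + j)"
  by (rule pow_mult_mem[OF Q_ideal])

lemma Q_QP1: "q \<in> Q \<Longrightarrow> q \<in> QP 1"
  using pow_1[OF Q_ideal] unfolding One_nat_def by (simp only:)

lemma nonnull_mult_QP:
  "w \<in> QP i \<Longrightarrow> w \<notin> N i \<Longrightarrow> w' \<in> QP j \<Longrightarrow> w' \<notin> N j \<Longrightarrow> w \<otimes> w' \<notin> N (i + j)"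
  using nonnull_mult[of w i w' j] QP_le_E by blast

text \<open>
Elements of degree \<open>n\<close> whose class in the associated graded ring of \<open>Q\<close> modulo \<open>\<aa>\<close> is killed by some form that is
nonzero in the fibre ring. They form ideals since products of nonzero forms are nonzero, and by finite
generation a single nonzero form kills all of them.
\<close>

definition tors :: "nat \<Rightarrow> 'a set"
  where "tors n = {h \<in> QP n. \<exists>j. \<exists>w\<in>QP j. w \<notin> N j \<and> w \<otimes> h \<in> E (n + j + 1)}"

lemma tors_ideal: "ideal (tors n) R"
proof (rule idealI[OF ring_axioms])
  have mulE: "r \<otimes> h \<in> E k" if "h \<in> E k" "r \<in> carrier R" for r h k using that ideal_mult[OF E_ideal] by blast
  have mul: "r \<otimes> h \<in> tors n" if h: "h \<in> tors n" and r: "r \<in> carrier R" for r h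
  proof -
    obtain j w where w: "h \<in> QP n" "w \<in> QP j" "w \<notin> N j" "w \<otimes> h \<in> E (n + j + 1)"
      using h by (auto simp: tors_def)
    have c: "h \<in> carrier R" "w \<in> carrier R" using w QP_carr by auto
    have "w \<otimes> (r \<otimes> h) = r \<otimes> (w \<otimes> h)" using c r by (simp add: m_lcomm)
    then have "w \<otimes> (r \<otimes> h) \<in> E (n + j + 1)" using mulE[OF w(4) r] by simp
    moreover have "r \<otimes> h \<in> QP n" using w(1) r ideal_mult[OF QP_ideal] by blast
    ultimately show ?thesis using w(2,3) unfolding tors_def by blast
  qed
  show "r \<otimes> h \<in> tors n" if "h \<in> tors n" "r \<in> carrier R" for r h using mul that .
  then show "h \<otimes> r \<in> tors n" if "h \<in> tors n" "r \<in> carrier R" for r h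
  proof -
    have "h \<in> carrier R" using that(1) QP_carr by (auto simp: tors_def)
    then show ?thesis using mul[OF that] that(2) by (simp add: m_comm)
  qed
  show "subgroup (tors n) (add_monoid R)"
  proof (rule add.subgroupI)
    show "tors n \<subseteq> carrier R" using QP_carr by (auto simp: tors_def)
    have "\<zero> \<in> tors n"
      unfolding tors_def using ideal_zero[OF QP_ideal] ideal_zero[OF E_ideal] one_nonnull
      by (auto intro!: exI[of _ 0] bexI[of _ \<one>])
    then show "tors n \<noteq> {}" by blast
    show "\<ominus> h \<in> tors n" if "h \<in> tors n" for h
    proof -
      have "h \<in> carrier R" using that QP_carr by (auto simp: tors_def)
      then have "(\<ominus> \<one>) \<otimes> h = \<ominus> h" by algebra
      then show ?thesis using mul[OF that, of "\<ominus> \<one>"] by simp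
    qed
    show "h \<oplus> h' \<in> tors n" if hh: "h \<in> tors n" "h' \<in> tors n" for h h'
    proof -
      obtain j w where w: "h \<in> QP n" "w \<in> QP j" "w \<notin> N j" "w \<otimes> h \<in> E (n + j + 1)"
        using hh by (auto simp: tors_def)
      obtain j' w' where w': "h' \<in> QP n" "w' \<in> QP j'" "w' \<notin> N j'" "w' \<otimes> h' \<in> E (n + j' + 1)"
        using hh by (auto simp: tors_def)
      have c: "h \<in> carrier R" "w \<in> carrier R" "h' \<in> carrier R" "w' \<in> carrier R" using w w' QP_carr by auto
      have "w' \<otimes> (w \<otimes> h) \<in> E (n + (j + j') + 1)" by (rule E_shift[OF w(4) w'(2)]) simp
      moreover have "w \<otimes> (w' \<otimes> h') \<in> E (n + (j + j') + 1)" by (rule E_shift[OF w'(4) w(2)]) simp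
      ultimately have "w' \<otimes> (w \<otimes> h) \<oplus> w \<otimes> (w' \<otimes> h') \<in> E (n + (j + j') + 1)"
        by (rule ideal_add[OF E_ideal])
      moreover have "(w \<otimes> w') \<otimes> (h \<oplus> h') = w' \<otimes> (w \<otimes> h) \<oplus> w \<otimes> (w' \<otimes> h')" using c by algebra
      ultimately have "(w \<otimes> w') \<otimes> (h \<oplus> h') \<in> E (n + (j + j') + 1)" by (simp only:)
      moreover have "h \<oplus> h' \<in> QP n" using w w' ideal_add[OF QP_ideal] by blast
      ultimately show ?thesis
        unfolding tors_def using QP_mult[OF w(2) w'(2)] nonnull_mult_QP[OF w(2,3) w'(2,3)] by blast
    qed
  qed
qed

lemma tors_killer_degree:
  "\<exists>j. \<exists>w\<in>QP j. w \<notin> N j \<and> (\<forall>h\<in>tors n. w \<otimes> h \<in> E (n + j + 1))"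
proof -
  obtain hs where hs: "set hs \<subseteq> carrier R" "tors n = Idl (set hs)" using ideal_finite_gens[OF tors_ideal] .
  have "set hs \<subseteq> tors n" using hs genideal_self by simp
  then have "\<exists>j. \<exists>w\<in>QP j. w \<notin> N j \<and> (\<forall>h\<in>set hs. w \<otimes> h \<in> E (n + j + 1))"
  proof (induction hs)
    case Nil
    then show ?case using one_nonnull by (auto intro!: exI[of _ 0] bexI[of _ \<one>])
  next
    case (Cons h hs)
    then obtain j w where w: "w \<in> QP j" "w \<notin> N j" "\<forall>h\<in>set hs. w \<otimes> h \<in> E (n + j + 1)" by auto
    obtain j' w' where w': "w' \<in> QP j'" "w' \<notin> N j'" "w' \<otimes> h \<in> E (n + j' + 1)"
      using Cons.prems by (auto simp: tors_def)
    have c: "w \<in> carrier R" "w' \<in> carrier R" using w w' QP_carr by auto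
    have hc: "x \<in> carrier R" if "x \<in> set (h # hs)" for x using that Cons.prems QP_carr by (auto simp: tors_def)
    have "(w \<otimes> w') \<otimes> x \<in> E (n + (j + j') + 1)" if "x \<in> set (h # hs)" for x
    proof (cases "x = h")
      case True
      have "w \<otimes> (w' \<otimes> h) \<in> E (n + (j + j') + 1)" by (rule E_shift[OF w'(3) w(1)]) simp
      then show ?thesis using True hc[OF that] c by (simp add: m_assoc)
    next
      case False
      then have "w \<otimes> x \<in> E (n + j + 1)" using w(3) that by simp
      then have "w' \<otimes> (w \<otimes> x) \<in> E (n + (j + j') + 1)" by (rule E_shift[OF _ w'(1)]) simp
      moreover have "w' \<otimes> (w \<otimes> x) = (w \<otimes> w') \<otimes> x" using hc[OF that] c by (simp add: m_ac)
      ultimately show ?thesis by simp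
    qed
    then show ?case using QP_mult[OF w(1) w'(1)] nonnull_mult_QP[OF w(1,2) w'(1,2)] by blast
  qed
  then obtain j w where w: "w \<in> QP j" "w \<notin> N j" "\<And>h. h \<in> set hs \<Longrightarrow> w \<otimes> h \<in> E (n + j + 1)" by blast
  have "w \<otimes> h \<in> E (n + j + 1)" if "h \<in> tors n" for h
    using mult_genideal_le[OF E_ideal QP_carr[OF w(1)] hs(1) w(3)] that hs(2) by simp
  then show ?thesis using w by blast
qed

text \<open>The family \<open>tors\<close> is stable under \<open>Q\<close>. So a form that works in all degrees up to a generating degree works in all degrees.\<close>

lemma tors_killer_QP:
  "\<exists>e. \<exists>w\<in>QP e. w \<notin> N e \<and> (\<forall>n. \<forall>h\<in>tors n. w \<otimes> h \<in> E (n + e + 1))"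
proof -
  have sub: "tors n \<subseteq> QP n" for n by (auto simp: tors_def)
  have QG: "q \<otimes> h \<in> tors (Suc n)" if q: "q \<in> Q" and h: "h \<in> tors n" for q h n
  proof -
    obtain j w where w: "h \<in> QP n" "w \<in> QP j" "w \<notin> N j" "w \<otimes> h \<in> E (n + j + 1)"
      using h by (auto simp: tors_def)
    note q1 = Q_QP1[OF q]
    have c: "h \<in> carrier R" "w \<in> carrier R" "q \<in> carrier R" using w ideal_carr[OF Q_ideal q] QP_carr by auto
    have "q \<otimes> (w \<otimes> h) \<in> E (Suc n + j + 1)" by (rule E_shift[OF w(4) q1]) simp
    moreover have "q \<otimes> (w \<otimes> h) = w \<otimes> (q \<otimes> h)" using c by (simp add: m_lcomm)
    ultimately have "w \<otimes> (q \<otimes> h) \<in> E (Suc n + j + 1)" by (simp only:)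
    moreover have "q \<otimes> h \<in> QP (Suc n)" using QP_mult[OF q1 w(1)] by (simp only: plus_1_eq_Suc)
    ultimately show ?thesis using w(2,3) unfolding tors_def by blast
  qed
  obtain n0 where n0: "\<And>n. n \<ge> n0 \<Longrightarrow> tors (Suc n) \<subseteq> Q \<cdot> tors n"
    using graded_ideals_finitely_generated[OF xs refl tors_ideal sub QG] by blast
  have "\<exists>e. \<exists>w\<in>QP e. w \<notin> N e \<and> (\<forall>n\<le>k. \<forall>h\<in>tors n. w \<otimes> h \<in> E (n + e + 1))" for k
  proof (induction k)
    case 0
    show ?case using tors_killer_degree[of 0] by auto
  next
    case (Suc k)
    then obtain e w where w: "w \<in> QP e" "w \<notin> N e" "\<And>n h. n \<le> k \<Longrightarrow> h \<in> tors n \<Longrightarrow> w \<otimes> h \<in> E (n + e + 1)"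
      by blast
    obtain e' w' where w': "w' \<in> QP e'" "w' \<notin> N e'" "\<And>h. h \<in> tors (Suc k) \<Longrightarrow> w' \<otimes> h \<in> E (Suc k + e' + 1)"
      using tors_killer_degree[of "Suc k"] by blast
    have c: "w \<in> carrier R" "w' \<in> carrier R" using w w' QP_carr by auto
    have "(w \<otimes> w') \<otimes> h \<in> E (n + (e + e') + 1)" if n: "n \<le> Suc k" and h: "h \<in> tors n" for n h
    proof -
      have hc: "h \<in> carrier R" using h QP_carr by (auto simp: tors_def)
      show ?thesis
      proof (cases "n = Suc k")
        case True
        then have "w' \<otimes> h \<in> E (Suc k + e' + 1)" using w'(3) h by simp
        then have "w \<otimes> (w' \<otimes> h) \<in> E (n + (e + e') + 1)" by (rule E_shift[OF _ w(1)]) (simp add: True)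
        then show ?thesis using hc c by (simp add: m_assoc)
      next
        case False
        then have "w \<otimes> h \<in> E (n + e + 1)" using w(3) h n by simp
        then have "w' \<otimes> (w \<otimes> h) \<in> E (n + (e + e') + 1)" by (rule E_shift[OF _ w'(1)]) simp
        moreover have "w' \<otimes> (w \<otimes> h) = (w \<otimes> w') \<otimes> h" using hc c by (simp add: m_ac)
        ultimately show ?thesis by simp
      qed
    qed
    then show ?case using QP_mult[OF w(1) w'(1)] nonnull_mult_QP[OF w(1,2) w'(1,2)] by blast
  qed
  then obtain e w where w: "w \<in> QP e" "w \<notin> N e" "\<And>n h. n \<le> n0 \<Longrightarrow> h \<in> tors n \<Longrightarrow> w \<otimes> h \<in> E (n + e + 1)"
    by blast
  have wc: "w \<in> carrier R" using w QP_carr by auto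
  have up: "w \<otimes> h \<in> E (n0 + k + e + 1)" if "h \<in> tors (n0 + k)" for h k
    using that
  proof (induction k arbitrary: h)
    case 0
    then show ?case using w(3)[of n0 h] by simp
  next
    case (Suc k)
    have col: "ideal (ideal_colon R (E (n0 + Suc k + e + 1)) {w}) R"
      using wc E_ideal by (intro ideal_colon_ideal) auto
    have "Q \<cdot> tors (n0 + k) \<subseteq> ideal_colon R (E (n0 + Suc k + e + 1)) {w}"
    proof (rule prod_le[OF col])
      fix q g assume qg: "q \<in> Q" "g \<in> tors (n0 + k)"
      have c: "q \<in> carrier R" "g \<in> carrier R" using ideal_carr[OF Q_ideal qg(1)] qg(2) QP_carr by (auto simp: tors_def)
      have "q \<otimes> (w \<otimes> g) \<in> E (n0 + Suc k + e + 1)" by (rule E_shift[OF Suc.IH[OF qg(2)] Q_QP1[OF qg(1)]]) simp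
      moreover have "q \<otimes> (w \<otimes> g) = q \<otimes> g \<otimes> w" using c wc by (simp add: m_ac)
      ultimately show "q \<otimes> g \<in> ideal_colon R (E (n0 + Suc k + e + 1)) {w}"
        using c by (simp add: ideal_colon_def)
    qed
    then have "h \<in> ideal_colon R (E (n0 + Suc k + e + 1)) {w}" using n0[of "n0 + k"] Suc.prems by auto
    then show ?case using wc by (simp add: ideal_colon_def m_comm)
  qed
  have "w \<otimes> h \<in> E (n + e + 1)" if "h \<in> tors n" for n h
  proof (cases "n \<le> n0")
    case False
    then have n: "n0 + (n - n0) = n" by simp
    then show ?thesis using up[of h "n - n0"] that by (simp only:)
  qed (use w(3) that in blast)
  then show ?thesis using w by blast
qed

lemma tors_killer:
  obtains e \<omega> where "\<omega> \<in> QP e" "\<omega> \<notin> N e"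
    "\<And>n j w h. h \<in> E n \<Longrightarrow> w \<in> QP j \<Longrightarrow> w \<notin> N j \<Longrightarrow> w \<otimes> h \<in> E (n + j + 1) \<Longrightarrow> \<omega> \<otimes> h \<in> E (n + e + 1)"
proof -
  obtain e \<omega> where \<omega>: "\<omega> \<in> QP e" "\<omega> \<notin> N e" "\<And>n h. h \<in> tors n \<Longrightarrow> \<omega> \<otimes> h \<in> E (n + e + 1)"
    using tors_killer_QP by blast
  have "\<omega> \<otimes> h \<in> E (n + e + 1)"
    if h: "h \<in> E n" "w \<in> QP j" "w \<notin> N j" "w \<otimes> h \<in> E (n + j + 1)" for n j w h
  proof -
    obtain g p where g: "g \<in> QP n" "p \<in> \<aa>" "h = g \<oplus> p" using h(1) by (auto simp: E_def mem_sum)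
    have c: "g \<in> carrier R" "p \<in> carrier R" "w \<in> carrier R" "\<omega> \<in> carrier R"
      using g h \<omega> QP_carr ideal_carr[OF aa] by auto
    have "w \<otimes> p \<in> E (n + j + 1)" "\<omega> \<otimes> p \<in> E (n + e + 1)"
      using ideal_mult[OF aa g(2)] c aa_le_E by blast+
    note wp = this
    have "w \<otimes> h \<ominus> w \<otimes> p = w \<otimes> g" unfolding g(3) using c by algebra
    then have "w \<otimes> g \<in> E (n + j + 1)" using ideal_minus[OF E_ideal h(4) wp(1)] by simp
    then have "g \<in> tors n" using g h by (auto simp: tors_def)
    then have "\<omega> \<otimes> g \<oplus> \<omega> \<otimes> p \<in> E (n + e + 1)" using \<omega>(3) wp(2) ideal_add[OF E_ideal] by blast
    then show ?thesis unfolding g(3) using c by (simp add: r_distr)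
  qed
  then show ?thesis using that \<omega> by blast
qed

text \<open>The Artin-Rees lemma for the ideal generated by \<open>x\<close> gives \<open>x \<otimes> r = x \<otimes> y\<close> modulo \<open>\<aa>\<close> with
\<open>y\<close> in a high power of \<open>Q\<close>, and \<open>x\<close> cancels because \<open>\<aa>\<close> is a prime without \<open>x\<close>.\<close>

lemma artin_rees_principal:
  assumes prime: "primeideal \<aa> R" and x: "x \<in> carrier R" "x \<notin> \<aa>"
  obtains c where "\<And>n r. n \<ge> c \<Longrightarrow> r \<in> carrier R \<Longrightarrow> x \<otimes> r \<in> E n \<Longrightarrow> r \<in> E (n - c)"
proof -
  have P: "ideal (PIdl x) R" "ideal (PIdl x <+> \<aa>) R" using x(1) aa by (auto intro: cgenideal_ideal add_ideals)
  define G where "G n = (PIdl x <+> \<aa>) \<inter> QP n" for n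
  have G: "ideal (G n) R" "G n \<subseteq> QP n" for n using P QP_ideal i_intersect by (auto simp: G_def)
  have QG: "q \<otimes> g \<in> G (Suc n)" if "q \<in> Q" "g \<in> G n" for q g n
    using that QP_mult[OF Q_QP1[OF that(1)], of g n] ideal_mult[OF P(2)] ideal_carr[OF Q_ideal]
    by (simp add: G_def del: nat_pow_Suc)
  obtain c where c: "\<And>n. n \<ge> c \<Longrightarrow> G (Suc n) \<subseteq> Q \<cdot> G n"
    using graded_ideals_finitely_generated[OF xs refl G QG] by blast
  define D where "D k = (PIdl x) \<cdot> QP k <+> \<aa>" for k
  have D: "ideal (D k) R" for k
    unfolding D_def using P QP_ideal aa by (intro add_ideals ideal_prod_is_ideal) auto
  have "G (c + k) \<subseteq> D k" for k
  proof (induction k)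
    case 0
    then show ?case unfolding D_def G_def using ideal_prod_one[OF P(1)] by simp
  next
    case (Suc k)
    have "Q \<cdot> G (c + k) \<subseteq> D (Suc k)"
    proof (rule prod_le[OF D])
      fix q g assume qg: "q \<in> Q" "g \<in> G (c + k)"
      then obtain z p where z: "z \<in> (PIdl x) \<cdot> QP k" "p \<in> \<aa>" "g = z \<oplus> p"
        using Suc unfolding D_def subset_iff mem_sum by blast
      have "q \<otimes> z \<in> Q \<cdot> ((PIdl x) \<cdot> QP k)" using qg z by (intro ideal_prod.prod)
      also have "\<dots> = (PIdl x) \<cdot> QP (Suc k)"
        using P(1) QP_ideal[of k] Q_ideal by (simp add: ideal_prod_assoc ideal_prod_commute[of Q] ideal_prod_is_ideal)
      finally have "q \<otimes> z \<in> (PIdl x) \<cdot> QP (Suc k)" .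
      moreover have cc: "q \<in> carrier R" "z \<in> carrier R" "p \<in> carrier R"
        using qg z ideal_carr[OF Q_ideal] ideal_carr[OF aa] ideal_carr[OF ideal_prod_is_ideal[OF P(1) QP_ideal]] by auto
      moreover have "q \<otimes> p \<in> \<aa>" using ideal_mult[OF aa z(2)] cc by auto
      ultimately show "q \<otimes> g \<in> D (Suc k)" unfolding D_def z(3) by (simp add: r_distr sum_memI del: nat_pow_Suc)
    qed
    then show ?case using c[of "c + k"] by auto
  qed
  note GD = this
  have "r \<in> E (n - c)" if n: "n \<ge> c" and r: "r \<in> carrier R" "x \<otimes> r \<in> E n" for n r
  proof -
    obtain q p where q: "q \<in> QP n" "p \<in> \<aa>" "x \<otimes> r = q \<oplus> p" using r(2) by (auto simp: E_def mem_sum)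
    have cc: "q \<in> carrier R" "p \<in> carrier R" using q QP_carr ideal_carr[OF aa] by auto
    have "q = r \<otimes> x \<oplus> (\<ominus> p)" using q(3) cc r(1) x(1) by (metis a_assoc a_inv_closed m_comm r_neg r_zero)
    then have "q \<in> G n" unfolding G_def using q r(1) ideal_neg[OF aa] by (auto simp: mem_PIdl_sum)
    then have "q \<in> D (n - c)" using GD[of "n - c"] n by auto
    then obtain z p' where z: "z \<in> (PIdl x) \<cdot> QP (n - c)" "p' \<in> \<aa>" "q = z \<oplus> p'"
      unfolding D_def mem_sum by blast
    obtain y where "y \<in> QP (n - c)" "z = x \<otimes> y" using z(1) mem_PIdl_prod[OF x(1) QP_ideal] by blast
    then have y: "y \<in> QP (n - c)" "p' \<in> \<aa>" "q = x \<otimes> y \<oplus> p'" using z by auto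
    have cy: "y \<in> carrier R" "p' \<in> carrier R" using y QP_carr ideal_carr[OF aa] by auto
    have "x \<otimes> (r \<ominus> y) = x \<otimes> r \<ominus> x \<otimes> y" using x r cy by algebra
    also have "\<dots> = p \<oplus> p'" unfolding q(3) y(3) using x(1) cy cc by algebra
    finally have "x \<otimes> (r \<ominus> y) \<in> \<aa>" using q y ideal_add[OF aa] by simp
    then have "r \<ominus> y \<in> \<aa>" using primeideal.I_prime[OF prime] x r cy by blast
    then have "y \<oplus> (r \<ominus> y) \<in> E (n - c)" unfolding E_def using y by (intro sum_memI)
    moreover have "y \<oplus> (r \<ominus> y) = r" using r cy by algebra
    ultimately show ?thesis by simp
  qed
  then show ?thesis using that by blast
qed

text \<open>If \<open>x \<otimes> r\<close> has a higher order than expected from the orders of \<open>x\<close> and \<open>r\<close>, then \<open>r\<close> is torsion, and multiplication by \<open>\<omega>\<close>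
raises its order by more than the degree \<open>e\<close> of \<open>\<omega>\<close>. Doing this \<open>k\<close> times closes a gap of \<open>k\<close> in the orders.\<close>

lemma divide_generically:
  assumes \<omega>: "\<omega> \<in> QP e"
    "\<And>n j w h. h \<in> E n \<Longrightarrow> w \<in> QP j \<Longrightarrow> w \<notin> N j \<Longrightarrow> w \<otimes> h \<in> E (n + j + 1) \<Longrightarrow> \<omega> \<otimes> h \<in> E (n + e + 1)"
    and x: "x \<in> QP K" "x \<notin> N K"
    and r: "r \<in> E j" "x \<otimes> r \<in> E (n + K)" "n \<le> j + k"
  shows "\<omega> [^] k \<otimes> r \<in> E (n + k * e)"
  using r
proof (induction k arbitrary: j n r)
  case 0
  then show ?case using E_anti[of n j] E_carr by auto
next
  case (Suc k)
  have c: "\<omega> \<in> carrier R" "x \<in> carrier R" "r \<in> carrier R" using \<omega> x Suc.prems QP_carr E_carr by auto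
  show ?case
  proof (cases "n \<le> j")
    case True
    have "\<omega> [^] Suc k \<in> QP (e * Suc k)" using pow_elem[OF QP_ideal \<omega>(1)] unfolding pow_pow[OF Q_ideal] .
    moreover have "r \<in> E n" using Suc.prems(1) E_anti[OF True] by blast
    ultimately show ?thesis by (intro E_shift) (simp_all add: mult.commute)
  next
    case False
    then have "x \<otimes> r \<in> E (j + K + 1)" using Suc.prems(2) E_anti[of "j + K + 1" "n + K"] by auto
    then have \<omega>r: "\<omega> \<otimes> r \<in> E (j + e + 1)" using \<omega>(2) Suc.prems(1) x by blast
    have "\<omega> \<otimes> (x \<otimes> r) \<in> E ((n + e) + K)" by (rule E_shift[OF Suc.prems(2) \<omega>(1)]) simp
    then have "x \<otimes> (\<omega> \<otimes> r) \<in> E ((n + e) + K)" using c by (simp add: m_lcomm)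
    then have "\<omega> [^] k \<otimes> (\<omega> \<otimes> r) \<in> E (n + e + k * e)"
      using Suc.prems(3) by (intro Suc.IH[OF \<omega>r]) auto
    then show ?thesis using c by (simp add: m_assoc ac_simps)
  qed
qed

section \<open>Divisibility of forms\<close>

text \<open>Congruence in the fibre ring, for forms of degree \<open>n\<close>.\<close>

definition cg :: "nat \<Rightarrow> 'a \<Rightarrow> 'a \<Rightarrow> bool"
  where "cg n a b \<longleftrightarrow> a \<in> carrier R \<and> b \<in> carrier R \<and> a \<ominus> b \<in> N n"

lemma cg_sym: "cg n a b \<Longrightarrow> cg n b a"
proof -
  assume *: "cg n a b"
  then have "\<ominus> (a \<ominus> b) = b \<ominus> a" unfolding cg_def by algebra
  then show ?thesis using * ideal_neg[OF N_ideal, of "a \<ominus> b" n] by (simp add: cg_def)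
qed

lemma cg_trans: "cg n a b \<Longrightarrow> cg n b c \<Longrightarrow> cg n a c"
proof -
  assume *: "cg n a b" "cg n b c"
  then have c: "a \<in> carrier R" "b \<in> carrier R" "c \<in> carrier R" by (auto simp: cg_def)
  then have "(a \<ominus> b) \<oplus> (b \<ominus> c) = a \<ominus> c" by algebra
  then show ?thesis using * c ideal_add[OF N_ideal, of "a \<ominus> b" n "b \<ominus> c"] by (simp add: cg_def)
qed

lemma cg_mult: "cg n a b \<Longrightarrow> z \<in> QP k \<Longrightarrow> m = k + n \<Longrightarrow> cg m (z \<otimes> a) (z \<otimes> b)"
proof -
  assume *: "cg n a b" "z \<in> QP k" "m = k + n"
  then have c: "a \<in> carrier R" "b \<in> carrier R" "z \<in> carrier R" using QP_carr by (auto simp: cg_def)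
  then have "z \<otimes> (a \<ominus> b) = z \<otimes> a \<ominus> z \<otimes> b" by algebra
  moreover have "z \<otimes> (a \<ominus> b) \<in> N m" unfolding *(3) using * QP_le_E by (intro E_mult_N) (auto simp: cg_def)
  ultimately show ?thesis using c by (simp add: cg_def)
qed

lemma cg_N: "cg n a b \<Longrightarrow> b \<in> N n \<Longrightarrow> a \<in> N n"
proof -
  assume *: "cg n a b" "b \<in> N n"
  then have "(a \<ominus> b) \<oplus> b = a" unfolding cg_def by algebra
  then show ?thesis using * ideal_add[OF N_ideal, of "a \<ominus> b" n b] by (simp add: cg_def)
qed

lemma QP_mult_N: "z \<in> QP k \<Longrightarrow> a \<in> N n \<Longrightarrow> z \<otimes> a \<in> N (k + n)"
  using E_mult_N[of z k a n] QP_le_E by blast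

lemma hd_padd: "\<alpha> \<noteq> [] \<Longrightarrow> \<beta> \<noteq> [] \<Longrightarrow> hd (padd \<alpha> \<beta>) = hd \<alpha> + hd \<beta>"
  by (cases \<alpha>; cases \<beta>) auto

text \<open>\<open>H k q n\<close> says that the first variable divides the form \<open>q\<close> of degree \<open>n\<close> exactly \<open>k\<close> times in the fibre ring.
It is a valuation on forms, because leading monomials multiply.\<close>

definition H :: "nat \<Rightarrow> 'a \<Rightarrow> nat \<Rightarrow> bool"
  where "H k q n \<longleftrightarrow> (\<exists>\<gamma>. LM rlt \<gamma> q \<and> hd \<gamma> = k \<and> sum_list \<gamma> = n)"

lemma LM_length: "LM lt \<gamma> q \<Longrightarrow> length \<gamma> = length xs"
  by (simp add: LM_def)

lemma H_notin: "H k q n \<Longrightarrow> q \<notin> N n"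
  using LM_notin_N[OF mon_order_rlt] by (auto simp: H_def)

lemma H_ex: "q \<in> QP n \<Longrightarrow> q \<notin> N n \<Longrightarrow> \<exists>k. H k q n"
  using LM_ex_E[OF mon_order_rlt, of q n] QP_le_E by (fastforce simp: H_def exps_def)

lemma H_unique: "H k q n \<Longrightarrow> H k' q n \<Longrightarrow> k = k'"
  using LM_unique[OF mon_order_rlt] by (auto simp: H_def)

lemma H_cong: "H k q n \<Longrightarrow> cg n q' q \<Longrightarrow> H k q' n"
  unfolding H_def cg_def using LM_cong by blast

text \<open>The exponent vector of the \<open>k\<close>-th power of the first variable.\<close>

definition te :: "nat \<Rightarrow> nat list" where "te k = k # replicate (length xs - 1) 0"

context
  fixes t ys assumes xs_eq: "xs = t # ys"
begin

lemma tc: "t \<in> carrier R" and ysc: "set ys \<subseteq> carrier R"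
  using xs xs_eq by auto

lemma H_mult: "H k q m \<Longrightarrow> H l q' n \<Longrightarrow> H (k + l) (q \<otimes> q') (m + n)"
proof -
  assume "H k q m" "H l q' n"
  then obtain \<gamma> \<delta> where *: "LM rlt \<gamma> q" "hd \<gamma> = k" "sum_list \<gamma> = m" "LM rlt \<delta> q'" "hd \<delta> = l" "sum_list \<delta> = n"
    by (auto simp: H_def)
  have len: "length \<gamma> = length xs" "length \<delta> = length xs" using * LM_length by auto
  have "hd (padd \<gamma> \<delta>) = k + l" using len * xs_eq by (subst hd_padd) auto
  moreover have "sum_list (padd \<gamma> \<delta>) = m + n" using len * by (simp add: sum_list_padd)
  ultimately show ?thesis using LM_mult[OF mon_order_rlt *(1,4)] by (auto simp: H_def)
qed

lemma te_eq: "te k = k # replicate (length ys) 0"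
proof -
  have len: "length xs = Suc (length ys)" by (simp add: xs_eq)
  show ?thesis unfolding te_def len by simp
qed

lemma te: "length (te k) = length xs" "sum_list (te k) = k" "pp (te k) = t [^] k"
  unfolding te_eq using pprod_zero[OF ysc] tc by (auto simp: xs_eq sum_list_replicate)

lemma t_pow_QP: "t [^] k \<in> QP k"
  using pp_QP[OF te(1), of k] by (simp add: te)

lemma H_t: "H k (t [^] k) k"
  unfolding H_def using LM_pp[OF te(1), of rlt k] te by (intro exI[of _ "te k"]) (auto simp: te_eq)

lemma H_pow: "H 0 q n \<Longrightarrow> H 0 (q [^] (c::nat)) (c * n)"
proof (induction c)
  case 0
  then show ?case using H_t[of 0] tc by simp
next
  case (Suc c)
  then show ?case using H_mult[of 0 "q [^] c" "c * n" 0 q n] by (simp add: add.commute)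
qed

lemma QP_ys: assumes "\<phi> \<in> ideal_pow R (Idl (set ys)) n"
  shows "\<phi> \<in> QP n" and "\<phi> \<in> Idl (pp ` ((#) 0 ` exps (length ys) n))"
proof -
  have "Idl (set ys) \<subseteq> Q" using xs xs_eq by (intro genideal_sub_mono) auto
  then show "\<phi> \<in> QP n" using assms pow_mono[OF _ genideal_ideal[OF ysc] Q_ideal] by blast
  have "pp ` ((#) 0 ` exps (length ys) n) = pprod R ys ` exps (length ys) n"
    using ysc by (auto simp: xs_eq image_image)
  then show "\<phi> \<in> Idl (pp ` ((#) 0 ` exps (length ys) n))" using assms pow_eq_monomials[OF ysc] by simp
qed

lemma LM_ys:
  assumes "\<phi> \<in> ideal_pow R (Idl (set ys)) n" "\<phi> \<notin> N n" "mon_order lt"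
  shows "\<exists>\<gamma>. LM lt \<gamma> \<phi> \<and> hd \<gamma> = 0 \<and> sum_list \<gamma> = n"
proof -
  have "\<exists>\<gamma>\<in>(#) 0 ` exps (length ys) n. LM lt \<gamma> \<phi>"
  proof (rule LM_ex[OF assms(3) _ _ assms(2)])
    show "(#) 0 ` exps (length ys) n \<subseteq> exps (length xs) n" by (auto simp: exps_def xs_eq)
    show "\<phi> \<in> Idl (pp ` ((#) 0 ` exps (length ys) n)) <+> N n"
      using QP_ys(2)[OF assms(1)] sum_upper1[OF span_ideal N_ideal] by blast
  qed
  then show ?thesis by (auto simp: exps_def)
qed

text \<open>All monomials of \<open>q\<close> have an exponent of at least \<open>k\<close> in the first variable, so \<open>t ^ j\<close> can be taken out.\<close>

lemma H_div:
  assumes "H k q n" "j \<le> k"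
  obtains q' where "q' \<in> QP (n - j)" "cg n q (t [^] j \<otimes> q')" "j \<le> n"
proof -
  obtain \<gamma> where \<gamma>: "LM rlt \<gamma> q" "hd \<gamma> = k" "sum_list \<gamma> = n" using assms by (auto simp: H_def)
  obtain u b where ub: "length \<gamma> = length xs" "u \<in> carrier R" "b \<in> B rlt \<gamma>" "q = u \<otimes> pp \<gamma> \<oplus> b"
    using \<gamma>(1) by (auto simp: LM_def)
  obtain l \<nu> where l: "l \<in> Idl (pp ` lower rlt \<gamma>)" "\<nu> \<in> N n" "b = l \<oplus> \<nu>"
    using ub(3) \<gamma>(3) by (auto simp: B_def mem_sum)
  let ?D = "(PIdl (t [^] j)) \<cdot> QP (n - j)"
  have tj: "t [^] j \<in> carrier R" using tc by simp
  have D: "ideal ?D R" using cgenideal_ideal[OF tj] QP_ideal by (rule ideal_prod_is_ideal)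
  have ppD: "pp \<beta> \<in> ?D" if \<beta>: "length \<beta> = length xs" "sum_list \<beta> = n" "hd \<beta> \<ge> k" for \<beta>
  proof -
    obtain b0 \<beta>' where b0: "\<beta> = b0 # \<beta>'" "length \<beta>' = length ys" using \<beta>(1) xs_eq by (cases \<beta>) auto
    have jb: "j \<le> b0" using \<beta>(3) b0 assms(2) by simp
    have "t [^] b0 = t [^] j \<otimes> t [^] (b0 - j)" using jb tc by (simp add: nat_pow_mult)
    then have "pp \<beta> = t [^] j \<otimes> pp ((b0 - j) # \<beta>')"
      using b0 tc pprod_closed[OF ysc] by (simp add: xs_eq m_assoc)
    moreover have "sum_list ((b0 - j) # \<beta>') = n - j" using \<beta>(2) b0(1) jb by simp
    then have "pp ((b0 - j) # \<beta>') \<in> QP (n - j)" using pp_QP[of "(b0 - j) # \<beta>'"] b0 xs_eq by (metis length_Cons)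
    ultimately show ?thesis using mem_PIdl_prod[OF tj QP_ideal] by auto
  qed
  have "hd \<beta> \<ge> k" if "\<beta> \<in> lower rlt \<gamma>" for \<beta>
    using that \<gamma>(2) ub(1) xs_eq by (cases \<beta>; cases \<gamma>) (auto simp: lower_def)
  then have "Idl (pp ` lower rlt \<gamma>) \<subseteq> ?D"
    using ppD ub(1) \<gamma>(3) by (intro genideal_le[OF D]) (auto simp: lower_def)
  then have "u \<otimes> pp \<gamma> \<oplus> l \<in> ?D"
    using l(1) ppD[OF ub(1) \<gamma>(3)] \<gamma>(2) ub(2) by (auto intro!: ideal_add[OF D] ideal_mult[OF D])
  then obtain q' where q': "q' \<in> QP (n - j)" "u \<otimes> pp \<gamma> \<oplus> l = t [^] j \<otimes> q'"
    using mem_PIdl_prod[OF tj QP_ideal] by auto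
  have c: "l \<in> carrier R" "\<nu> \<in> carrier R" "pp \<gamma> \<in> carrier R" "q' \<in> carrier R"
    using l q' ideal_carr[OF span_ideal] N_carr pp_closed QP_carr by auto
  have "q = t [^] j \<otimes> q' \<oplus> \<nu>" unfolding ub(4) l(3) q'(2)[symmetric] using c ub(2) by algebra
  then have "q \<ominus> t [^] j \<otimes> q' = \<nu>" using tj c by algebra
  then have "cg n q (t [^] j \<otimes> q')" using l(2) tj c LM_carr[OF \<gamma>(1)] by (simp add: cg_def)
  moreover have "j \<le> n" using assms(2) \<gamma> ub(1) xs_eq by (cases \<gamma>) auto
  ultimately show ?thesis using that q' by blast
qed

end

text \<open>
For a nonzero form \<open>\<omega>\<close> there is a form \<open>x\<close> of degree \<open>K\<close> such that \<open>x\<close> divides a product of a power of \<open>\<omega>\<close> with a form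
\<open>\<phi>\<close> free of \<open>t\<close> only if \<open>\<phi> = 0\<close>, always in the fibre ring. Write \<open>\<omega> = t^a w\<close> with \<open>w\<close> not divisible by \<open>t\<close>, and take
\<open>x = t^K + s w\<close> with \<open>K = deg w + 1\<close>. Then \<open>x\<close> is monic in \<open>t\<close> and prime to \<open>\<omega>\<close>, as \<open>x\<close> is not divisible by \<open>t\<close> and is
\<open>t^K\<close> modulo \<open>w\<close>. Instead of unique factorisation, the proof removes the factors
\<open>t\<close> and \<open>w\<close> one by one, using only leading monomials.
\<close>

lemma coprime_monic_form:
  assumes xs_eq: "xs = t # s # ys" and \<omega>: "\<omega> \<in> QP e" "\<omega> \<notin> N e"
  obtains K x where "x \<in> QP K" "x \<notin> N K"
    "\<And>c n \<phi> k \<theta>. \<phi> \<in> ideal_pow R (Idl (set (s # ys))) n \<Longrightarrow> \<theta> \<in> QP k \<Longrightarrow> c * e + n = K + k \<Longrightarrow>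
      cg (K + k) (\<omega> [^] c \<otimes> \<phi>) (x \<otimes> \<theta>) \<Longrightarrow> \<phi> \<in> N n"
proof -
  note mult = H_mult[OF xs_eq] and t_pow = t_pow_QP[OF xs_eq] and Ht = H_t[OF xs_eq] and hdiv = H_div[OF xs_eq]
  note te = te[OF xs_eq] and te_eq = te_eq[OF xs_eq]
  have lenxs: "length xs = Suc (Suc (length ys))" by (simp add: xs_eq)
  have sc: "s \<in> carrier R" "t \<in> carrier R" using xs xs_eq by auto
  obtain a where a: "H a \<omega> e" using H_ex[OF \<omega>] by blast
  obtain w where w: "w \<in> QP (e - a)" "cg e \<omega> (t [^] a \<otimes> w)" "a \<le> e" using hdiv[OF a order_refl] .
  define f where "f = e - a"
  have ef: "a + f = e" using w(3) by (simp add: f_def)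
  have wf: "w \<in> QP f" using w(1) by (simp add: f_def)
  have wn: "w \<notin> N f"
    using QP_mult_N[OF t_pow, of w f a] cg_N[OF w(2)] \<omega>(2) ef by auto
  have Hw: "H 0 w f"
  proof -
    obtain a' where a': "H a' w f" using H_ex[OF wf wn] by blast
    have "H (a + a') (t [^] a \<otimes> w) e" using mult[OF Ht a', of a] ef by simp
    moreover have "H a (t [^] a \<otimes> w) e" using H_cong[OF a cg_sym[OF w(2)]] .
    ultimately show ?thesis using H_unique a' by fastforce
  qed
  define K where "K = Suc f"
  define x where "x = t [^] K \<oplus> s \<otimes> w"
  have c0: "w \<in> carrier R" "t [^] K \<in> carrier R" using wf QP_carr sc by auto
  have sQP: "s \<in> QP 1" using genideal_mem[OF xs, of s] xs_eq by (intro Q_QP1) auto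
  have Hs: "H 0 s 1"
  proof -
    let ?\<sigma> = "0 # 1 # replicate (length ys) 0"
    have ysc: "set ys \<subseteq> carrier R" using xs xs_eq by auto
    have "pp ?\<sigma> = s" using sc pprod_zero[OF ysc] by (simp add: xs_eq)
    moreover have "LM rlt ?\<sigma> (pp ?\<sigma>)" by (rule LM_pp) (simp add: xs_eq)
    ultimately show ?thesis unfolding H_def by (intro exI[of _ ?\<sigma>]) (auto simp: sum_list_replicate)
  qed
  have swQP: "s \<otimes> w \<in> QP K" using QP_mult[OF sQP wf] by (simp only: K_def plus_1_eq_Suc)
  have xQP: "x \<in> QP K" unfolding x_def using t_pow swQP by (rule ideal_add[OF QP_ideal])
  have xc: "x \<in> carrier R" using xQP QP_carr by blast
  have Hx: "H 0 x K"
  proof -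
    have "H 0 (s \<otimes> w) K" using mult[OF Hs Hw] by (simp add: K_def)
    then obtain \<gamma> where \<gamma>: "LM rlt \<gamma> (s \<otimes> w)" "hd \<gamma> = 0" "sum_list \<gamma> = K" by (auto simp: H_def)
    have "te K \<in> lower rlt \<gamma>"
      using LM_length[OF \<gamma>(1)] te(1,2)[of K] \<gamma>(2,3) by (cases \<gamma>) (auto simp: lower_def te_eq K_def lenxs)
    then have "t [^] K \<in> B rlt \<gamma>" unfolding te(3)[symmetric] using span_mem span_le_B by blast
    then have "LM rlt \<gamma> (s \<otimes> w \<oplus> t [^] K)" using LM_add[OF \<gamma>(1)] by blast
    moreover have "s \<otimes> w \<oplus> t [^] K = x" unfolding x_def using c0 sc by (simp add: a_comm)
    ultimately show ?thesis using \<gamma> by (auto simp: H_def)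
  qed
  have LMx: "LM llt (te K) x"
  proof -
    have "s \<otimes> w \<in> Idl (pp ` lower llt (te K))"
    proof (rule mult_genideal_le[OF span_ideal sc(1)])
      show "w \<in> Idl (pp ` exps (length xs) f)" using wf QP_span by simp
      fix z assume "z \<in> pp ` exps (length xs) f"
      then obtain \<beta> where \<beta>: "\<beta> \<in> exps (length xs) f" "z = pp \<beta>" by auto
      let ?\<beta> = "\<beta>[1 := Suc (\<beta> ! 1)]"
      have "s \<otimes> z = pp ?\<beta>" using pprod_incr[OF xs, of \<beta> 1] \<beta> by (simp add: exps_def xs_eq)
      moreover have "?\<beta> \<in> exps (length xs) K" using exps_incr[OF \<beta>(1), of 1] by (simp add: K_def xs_eq)
      moreover obtain b0 \<beta>' where b0: "\<beta> = b0 # \<beta>'" using \<beta>(1) xs_eq by (cases \<beta>) (auto simp: exps_def)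
      moreover have "b0 < K" using \<beta>(1) b0 by (auto simp: exps_def K_def)
      ultimately have "?\<beta> \<in> lower llt (te K)" using te(1,2)[of K] by (auto simp: lower_def exps_def te_eq)
      then show "s \<otimes> z \<in> Idl (pp ` lower llt (te K))" using \<open>s \<otimes> z = pp ?\<beta>\<close> span_mem by metis
    qed (use xs in auto)
    then have "s \<otimes> w \<in> B llt (te K)" using span_le_B by blast
    then show ?thesis using LM_add[OF LM_pp[OF te(1), of llt K]] by (simp add: te(3) x_def)
  qed
  have wpow: "w [^] (c::nat) \<in> QP (c * f)" for c
    using pow_elem[OF QP_ideal wf, of c] unfolding pow_pow[OF Q_ideal] by (simp add: mult.commute)
  let ?P = "\<lambda>n. ideal_pow R (Idl (set (s # ys))) n"
  \<comment> \<open>Removing the factors \<open>t\<close>: since \<open>x\<close> has order \<open>0\<close> at \<open>t\<close>, all of \<open>t^b\<close> divides \<open>\<theta>\<close>.\<close>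
  have strip: "\<exists>\<theta>'\<in>QP (k - b). b \<le> k \<and> cg (c * f + n) (w [^] c \<otimes> \<phi>) (x \<otimes> \<theta>')"
    if \<phi>: "\<phi> \<in> ?P n" "\<phi> \<notin> N n" and \<theta>: "\<theta> \<in> QP k" and deg: "b + (c * f + n) = K + k"
      and cong: "cg (K + k) (t [^] b \<otimes> (w [^] c \<otimes> \<phi>)) (x \<otimes> \<theta>)"
    for b c :: nat and n k \<phi> \<theta>
  proof -
    let ?y = "w [^] c \<otimes> \<phi>"
    have \<phi>Q: "\<phi> \<in> QP n" using QP_ys[OF xs_eq \<phi>(1)] by simp
    have yQ: "?y \<in> QP (c * f + n)" using QP_mult[OF wpow \<phi>Q] .
    have "H 0 \<phi> n" using LM_ys[OF xs_eq \<phi> mon_order_rlt] by (auto simp: H_def)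
    then have "H (0 + 0) ?y (c * f + n)" by (rule mult[OF H_pow[OF xs_eq Hw]])
    then have "H (b + (0 + 0)) (t [^] b \<otimes> ?y) (b + (c * f + n))" by (rule mult[OF Ht])
    then have "H b (t [^] b \<otimes> ?y) (K + k)" unfolding deg by simp
    then have Hb: "H b (x \<otimes> \<theta>) (K + k)" using H_cong cg_sym[OF cong] by blast
    have "\<theta> \<notin> N k" using QP_mult_N[OF xQP] H_notin[OF Hb] by blast
    then obtain h where h: "H h \<theta> k" using H_ex[OF \<theta>] by blast
    have "H h (x \<otimes> \<theta>) (K + k)" using mult[OF Hx h] by simp
    then have "h = b" using H_unique Hb by blast
    then obtain \<theta>' where \<theta>': "\<theta>' \<in> QP (k - b)" "cg k \<theta> (t [^] b \<otimes> \<theta>')" "b \<le> k"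
      using hdiv[OF h, of b] by auto
    have cc: "?y \<in> carrier R" "\<theta>' \<in> carrier R" "t [^] b \<in> carrier R" using yQ \<theta>' QP_carr sc by auto
    have "cg (K + k) (x \<otimes> \<theta>) (x \<otimes> (t [^] b \<otimes> \<theta>'))" using cg_mult[OF \<theta>'(2) xQP refl] .
    then have "cg (K + k) (t [^] b \<otimes> ?y) (x \<otimes> (t [^] b \<otimes> \<theta>'))" using cg_trans[OF cong] by blast
    moreover have "t [^] b \<otimes> ?y \<ominus> x \<otimes> (t [^] b \<otimes> \<theta>') = t [^] b \<otimes> (?y \<ominus> x \<otimes> \<theta>')" using cc xc by algebra
    ultimately have *: "t [^] b \<otimes> (?y \<ominus> x \<otimes> \<theta>') \<in> N (b + (c * f + n))" unfolding cg_def deg by simp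
    have "K + (k - b) = c * f + n" using deg \<theta>'(3) by simp
    then have "x \<otimes> \<theta>' \<in> QP (c * f + n)" using QP_mult[OF xQP \<theta>'(1)] by simp
    then have "?y \<ominus> x \<otimes> \<theta>' \<in> QP (c * f + n)" using yQ ideal_minus[OF QP_ideal] by blast
    then have "?y \<ominus> x \<otimes> \<theta>' \<in> N (c * f + n)"
      using nonnull_mult_QP[OF t_pow H_notin[OF Ht]] * by blast
    then have "cg (c * f + n) ?y (x \<otimes> \<theta>')" using cc xc by (simp add: cg_def)
    then show ?thesis using \<theta>' by blast
  qed
  have main: "\<phi> \<in> N n"
    if "\<phi> \<in> ?P n" "\<theta> \<in> QP k" "b + (c * f + n) = K + k" "cg (K + k) (t [^] b \<otimes> (w [^] c \<otimes> \<phi>)) (x \<otimes> \<theta>)"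
    for b c :: nat and n k \<phi> \<theta>
    using that
  proof (induction c arbitrary: b k \<theta>)
    case 0
    show ?case
    proof (rule ccontr)
      assume \<phi>: "\<phi> \<notin> N n"
      have \<phi>c: "\<phi> \<in> carrier R" using QP_ys[OF xs_eq 0(1)] QP_carr by blast
      obtain \<theta>' where \<theta>': "\<theta>' \<in> QP (k - b)" "b \<le> k" "cg n \<phi> (x \<otimes> \<theta>')"
        using strip[OF 0(1) \<phi> 0(2-4)] \<phi>c by auto
      have deg: "n = K + (k - b)" using 0(3) \<theta>'(2) by simp
      \<comment> \<open>The lexicographic leading monomial of a multiple of \<open>x\<close> is divisible by \<open>t^K\<close>, that of \<open>\<phi>\<close> is free of \<open>t\<close>.\<close>
      obtain \<gamma> where \<gamma>: "LM llt \<gamma> \<phi>" "hd \<gamma> = 0" "sum_list \<gamma> = n" using LM_ys[OF xs_eq 0(1) \<phi> mon_order_llt] by blast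
      have "LM llt \<gamma> (x \<otimes> \<theta>')" using LM_cong[OF \<gamma>(1)] cg_sym[OF \<theta>'(3)] \<gamma>(3) by (auto simp: cg_def)
      moreover have "\<theta>' \<notin> N (k - b)" using QP_mult_N[OF xQP, of \<theta>' "k - b"] cg_N[OF \<theta>'(3)] \<phi> deg by auto
      then obtain \<delta> where \<delta>: "\<delta> \<in> exps (length xs) (k - b)" "LM llt \<delta> \<theta>'"
        using LM_ex_E[OF mon_order_llt] \<theta>'(1) QP_le_E by blast
      have "LM llt (padd (te K) \<delta>) (x \<otimes> \<theta>')" using LM_mult[OF mon_order_llt LMx \<delta>(2)] .
      moreover have "sum_list (padd (te K) \<delta>) = n" using \<delta>(1) te(1,2)[of K] deg by (simp add: exps_def sum_list_padd)
      ultimately have "\<gamma> = padd (te K) \<delta>" using LM_unique[OF mon_order_llt] \<gamma>(3) by blast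
      moreover have "hd (padd (te K) \<delta>) = K + hd \<delta>"
        using \<delta>(1) lenxs by (subst hd_padd) (auto simp: exps_def te_eq)
      ultimately show False using \<gamma>(2) by (simp add: K_def)
    qed
  next
    case (Suc c)
    show ?case
    proof (rule ccontr)
      assume \<phi>: "\<phi> \<notin> N n"
      have \<phi>Q: "\<phi> \<in> QP n" using QP_ys[OF xs_eq Suc.prems(1)] by simp
      define y where "y = w [^] c \<otimes> \<phi>"
      define m where "m = c * f + n"
      have yQ: "y \<in> QP m" unfolding y_def m_def using QP_mult[OF wpow \<phi>Q] .
      have wy: "w [^] Suc c \<otimes> \<phi> = w \<otimes> y" unfolding y_def using c0 \<phi>Q QP_carr by (simp add: m_ac)
      obtain \<theta>' where \<theta>': "\<theta>' \<in> QP (k - b)" "b \<le> k" "cg (Suc c * f + n) (w \<otimes> y) (x \<otimes> \<theta>')"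
        using strip[OF Suc.prems(1) \<phi> Suc.prems(2-4)] unfolding wy by blast
      define k' where "k' = k - b"
      have deg: "Suc c * f + n = f + m" "f + m = K + k'" "m = 1 + k'"
        using Suc.prems(3) \<theta>'(2) by (auto simp: m_def k'_def K_def)
      have \<theta>k: "\<theta>' \<in> QP k'" and cong: "cg (f + m) (w \<otimes> y) (x \<otimes> \<theta>')" using \<theta>' deg by (auto simp: k'_def)
      have cc: "y \<in> carrier R" "\<theta>' \<in> carrier R" using yQ \<theta>k QP_carr by auto
      \<comment> \<open>From \<open>w y = x \<theta>'\<close> follows \<open>w (y - s \<theta>') = t^K \<theta>'\<close>. As \<open>t\<close> does not divide \<open>w\<close>, there is
        \<open>\<rho>\<close> with \<open>y - s \<theta>' = t^K \<rho>\<close>. Then \<open>\<theta>' = w \<rho>\<close>, and \<open>y = t^K \<rho> + s w \<rho> = x \<rho>\<close>: one factor \<open>w\<close> is gone.\<close>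
      define \<psi> where "\<psi> = y \<ominus> s \<otimes> \<theta>'"
      have "s \<otimes> \<theta>' \<in> QP m" unfolding deg(3) using QP_mult[OF sQP \<theta>k] .
      then have \<psi>Q: "\<psi> \<in> QP m" unfolding \<psi>_def by (rule ideal_minus[OF QP_ideal yQ])
      have \<psi>c: "\<psi> \<in> carrier R" using \<psi>Q QP_carr by blast
      have "w \<otimes> \<psi> \<ominus> t [^] K \<otimes> \<theta>' = w \<otimes> y \<ominus> x \<otimes> \<theta>'" unfolding \<psi>_def x_def using cc c0 sc by algebra
      then have cong': "cg (f + m) (w \<otimes> \<psi>) (t [^] K \<otimes> \<theta>')" using cong c0 cc \<psi>c by (simp add: cg_def)
      have "H 0 \<phi> n" using LM_ys[OF xs_eq Suc.prems(1) \<phi> mon_order_rlt] by (auto simp: H_def)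
      then have "H (0 + 0) y m" unfolding y_def m_def by (rule mult[OF H_pow[OF xs_eq Hw]])
      then have "H (0 + (0 + 0)) (w \<otimes> y) (f + m)" by (rule mult[OF Hw])
      then have "x \<otimes> \<theta>' \<notin> N (f + m)" using cg_N[OF cong] H_notin by blast
      then have "\<theta>' \<notin> N k'" using QP_mult_N[OF xQP, of \<theta>' k'] deg(2) by auto
      then obtain h where h: "H h \<theta>' k'" using H_ex[OF \<theta>k] by blast
      have "H (K + h) (t [^] K \<otimes> \<theta>') (f + m)" using mult[OF Ht h] deg(2) by simp
      then have H\<psi>: "H (K + h) (w \<otimes> \<psi>) (f + m)" using H_cong cong' by blast
      then have "\<psi> \<notin> N m" using QP_mult_N[OF wf, of \<psi> m] H_notin by blast
      then obtain h' where h': "H h' \<psi> m" using H_ex[OF \<psi>Q] by blast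
      have "H h' (w \<otimes> \<psi>) (f + m)" using mult[OF Hw h'] by simp
      then have "h' = K + h" using H_unique H\<psi> by blast
      then obtain \<rho> where \<rho>: "\<rho> \<in> QP (m - K)" "cg m \<psi> (t [^] K \<otimes> \<rho>)" "K \<le> m" using hdiv[OF h', of K] by auto
      have \<rho>c: "\<rho> \<in> carrier R" using \<rho> QP_carr by blast
      have "w \<otimes> (\<psi> \<ominus> t [^] K \<otimes> \<rho>) \<in> N (f + m)" using \<rho>(2) QP_mult_N[OF wf] by (simp add: cg_def)
      then have "(w \<otimes> \<psi> \<ominus> t [^] K \<otimes> \<theta>') \<ominus> w \<otimes> (\<psi> \<ominus> t [^] K \<otimes> \<rho>) \<in> N (f + m)"
        using cong' ideal_minus[OF N_ideal] by (simp add: cg_def)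
      moreover have "(w \<otimes> \<psi> \<ominus> t [^] K \<otimes> \<theta>') \<ominus> w \<otimes> (\<psi> \<ominus> t [^] K \<otimes> \<rho>) = t [^] K \<otimes> (w \<otimes> \<rho> \<ominus> \<theta>')"
        using c0 cc \<psi>c \<rho>c by algebra
      ultimately have *: "t [^] K \<otimes> (w \<otimes> \<rho> \<ominus> \<theta>') \<in> N (K + k')" using deg(2) by simp
      have "f + (m - K) = k'" using deg(2) \<rho>(3) by simp
      then have "w \<otimes> \<rho> \<in> QP k'" using QP_mult[OF wf \<rho>(1)] by simp
      then have "w \<otimes> \<rho> \<ominus> \<theta>' \<in> QP k'" using \<theta>k ideal_minus[OF QP_ideal] by blast
      then have "w \<otimes> \<rho> \<ominus> \<theta>' \<in> N k'" using nonnull_mult_QP[OF t_pow H_notin[OF Ht]] * by blast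
      then have "s \<otimes> (w \<otimes> \<rho> \<ominus> \<theta>') \<in> N m" using QP_mult_N[OF sQP] deg(3) by simp
      then have "(\<psi> \<ominus> t [^] K \<otimes> \<rho>) \<ominus> s \<otimes> (w \<otimes> \<rho> \<ominus> \<theta>') \<in> N m"
        using \<rho>(2) ideal_minus[OF N_ideal] by (simp add: cg_def)
      moreover have "(\<psi> \<ominus> t [^] K \<otimes> \<rho>) \<ominus> s \<otimes> (w \<otimes> \<rho> \<ominus> \<theta>') = y \<ominus> x \<otimes> \<rho>"
        unfolding \<psi>_def x_def using c0 cc \<rho>c sc by algebra
      ultimately have "cg m y (x \<otimes> \<rho>)" using cc xc \<rho>c by (simp add: cg_def)
      then have "cg (K + (m - K)) (t [^] (0::nat) \<otimes> (w [^] c \<otimes> \<phi>)) (x \<otimes> \<rho>)"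
        using \<rho>(3) cc(1) by (simp add: y_def)
      moreover have "0 + (c * f + n) = K + (m - K)" using \<rho>(3) by (simp add: m_def)
      ultimately have "\<phi> \<in> N n" using Suc.IH[OF Suc.prems(1) \<rho>(1)] by blast
      then show False using \<phi> by simp
    qed
  qed
  have powcg: "cg (c * e) (\<omega> [^] c) ((t [^] a \<otimes> w) [^] c)" for c :: nat
  proof (induction c)
    case 0
    then show ?case using ideal_zero[OF N_ideal] by (simp add: cg_def r_neg minus_eq)
  next
    case (Suc c)
    let ?w = "t [^] a \<otimes> w"
    have wQ: "?w \<in> QP e" using QP_mult[OF t_pow wf, of a] unfolding ef .
    have oc: "\<omega> \<in> carrier R" "?w \<in> carrier R" using \<omega> wQ QP_carr by auto
    have wQc: "?w [^] c \<in> QP (c * e)"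
      using pow_elem[OF QP_ideal wQ, of c] unfolding pow_pow[OF Q_ideal] by (simp add: mult.commute)
    have "cg (Suc c * e) (\<omega> \<otimes> \<omega> [^] c) (\<omega> \<otimes> ?w [^] c)" using cg_mult[OF Suc \<omega>(1)] by simp
    moreover have "cg (Suc c * e) (?w [^] c \<otimes> \<omega>) (?w [^] c \<otimes> ?w)" by (rule cg_mult[OF w(2) wQc]) simp
    moreover have "\<omega> \<otimes> ?w [^] c = ?w [^] c \<otimes> \<omega>" "\<omega> \<otimes> \<omega> [^] c = \<omega> [^] Suc c" using oc by (simp_all add: m_comm)
    ultimately show ?case using cg_trans by (metis nat_pow_Suc)
  qed
  have "\<phi> \<in> N n"
    if *: "\<phi> \<in> ?P n" "\<theta> \<in> QP k" "c * e + n = K + k" "cg (K + k) (\<omega> [^] c \<otimes> \<phi>) (x \<otimes> \<theta>)" for c n \<phi> k \<theta>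
  proof (rule main[OF *(1,2)])
    show "a * c + (c * f + n) = K + k" using *(3) ef by (metis add.assoc distrib_left mult.commute)
    have \<phi>Q: "\<phi> \<in> QP n" using QP_ys[OF xs_eq *(1)] by simp
    have cc: "\<phi> \<in> carrier R" "\<omega> \<in> carrier R" using \<phi>Q \<omega> QP_carr by auto
    have "cg (K + k) (\<phi> \<otimes> \<omega> [^] c) (\<phi> \<otimes> (t [^] a \<otimes> w) [^] c)"
      by (rule cg_mult[OF powcg \<phi>Q]) (use *(3) in simp)
    moreover have "\<phi> \<otimes> (t [^] a \<otimes> w) [^] c = t [^] (a * c) \<otimes> (w [^] c \<otimes> \<phi>)"
      using cc sc c0 by (simp add: nat_pow_distrib nat_pow_pow m_ac)
    moreover have "\<phi> \<otimes> \<omega> [^] c = \<omega> [^] c \<otimes> \<phi>" using cc by (simp add: m_comm)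
    ultimately have "cg (K + k) (\<omega> [^] c \<otimes> \<phi>) (t [^] (a * c) \<otimes> (w [^] c \<otimes> \<phi>))" by simp
    then show "cg (K + k) (t [^] (a * c) \<otimes> (w [^] c \<otimes> \<phi>)) (x \<otimes> \<theta>)" using cg_sym cg_trans *(4) by blast
  qed
  then show ?thesis using that[OF xQP H_notin[OF Hx]] by blast
qed

section \<open>Chains of prime ideals\<close>

text \<open>Take \<open>\<omega>\<close> from \<open>tors_killer\<close> and \<open>x\<close> from \<open>coprime_monic_form\<close>. A relation between the remaining elements modulo \<open>x\<close>
is a form \<open>\<phi>\<close> free of \<open>t\<close> with \<open>\<phi> = x r\<close> modulo \<open>\<aa>\<close>. By Artin-Rees, the order of \<open>r\<close> is too small by at most a
constant \<open>c\<close>, so \<open>\<omega>^c r\<close> has the order of a form \<open>\<theta>\<close> with \<open>\<omega>^c \<phi> = x \<theta>\<close> in the fibre ring. Hence \<open>\<phi>\<close> is zero there.\<close>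

lemma independent_modulo_element:
  assumes xs_eq: "xs = t # s # ys" and prime: "primeideal \<aa> R"
  shows "\<exists>x\<in>carrier R. x \<notin> \<aa> \<and> indep (PIdl x <+> \<aa>) (s # ys)"
proof -
  obtain \<omega> e where \<omega>: "\<omega> \<in> QP e" "\<omega> \<notin> N e"
    "\<And>n j w h. h \<in> E n \<Longrightarrow> w \<in> QP j \<Longrightarrow> w \<notin> N j \<Longrightarrow> w \<otimes> h \<in> E (n + j + 1) \<Longrightarrow> \<omega> \<otimes> h \<in> E (n + e + 1)"
  proof (rule tors_killer)
    fix \<omega> e assume "\<omega> \<in> QP e" "\<omega> \<notin> N e"
      "\<And>n j w h. h \<in> E n \<Longrightarrow> w \<in> QP j \<Longrightarrow> w \<notin> N j \<Longrightarrow> w \<otimes> h \<in> E (n + j + 1) \<Longrightarrow> \<omega> \<otimes> h \<in> E (n + e + 1)"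
    then show thesis by (rule that)
  qed
  obtain K x where x: "x \<in> QP K" "x \<notin> N K"
    "\<And>c n \<phi> k \<theta>. \<phi> \<in> ideal_pow R (Idl (set (s # ys))) n \<Longrightarrow> \<theta> \<in> QP k \<Longrightarrow> c * e + n = K + k \<Longrightarrow>
      cg (K + k) (\<omega> [^] c \<otimes> \<phi>) (x \<otimes> \<theta>) \<Longrightarrow> \<phi> \<in> N n"
  proof (rule coprime_monic_form[OF xs_eq \<omega>(1,2)])
    fix K x assume "x \<in> QP K" "x \<notin> N K"
      "\<And>c n \<phi> k \<theta>. \<phi> \<in> ideal_pow R (Idl (set (s # ys))) n \<Longrightarrow> \<theta> \<in> QP k \<Longrightarrow> c * e + n = K + k \<Longrightarrow>
        cg (K + k) (\<omega> [^] c \<otimes> \<phi>) (x \<otimes> \<theta>) \<Longrightarrow> \<phi> \<in> N n"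
    then show thesis by (rule that)
  qed
  have xc: "x \<in> carrier R" "x \<notin> \<aa>" using QP_carr[OF x(1)] aa_le_N[of K] x(2) by auto
  obtain c where c: "\<And>n r. n \<ge> c \<Longrightarrow> r \<in> carrier R \<Longrightarrow> x \<otimes> r \<in> E n \<Longrightarrow> r \<in> E (n - c)"
  proof (rule artin_rees_principal[OF prime xc])
    fix c assume "\<And>n r. n \<ge> c \<Longrightarrow> r \<in> carrier R \<Longrightarrow> x \<otimes> r \<in> E n \<Longrightarrow> r \<in> E (n - c)"
    then show thesis by (rule that)
  qed
  let ?ys = "s # ys" and ?Q2 = "Idl (set (s # ys))"
  let ?P = "\<lambda>n. ideal_pow R ?Q2 n"
  have ysc: "set ?ys \<subseteq> carrier R" and sc: "s \<in> carrier R" using xs xs_eq by auto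
  have Q2: "ideal ?Q2 R" using ysc by (rule genideal_ideal)
  have Px: "ideal (PIdl x) R" using xc(1) by (rule cgenideal_ideal)
  have key: "\<phi> \<in> N n" if \<phi>: "\<phi> \<in> ?P n" and r: "r \<in> carrier R" "p \<in> \<aa>" "\<phi> = x \<otimes> r \<oplus> p" for \<phi> n r p
  proof (rule ccontr)
    assume "\<phi> \<notin> N n"
    \<comment> \<open>Multiplication by \<open>s^d\<close> raises the degree of \<open>\<phi>\<close> above \<open>c\<close> and \<open>K\<close>, so that the differences of degrees below are exact.\<close>
    define d where "d = c + K"
    define \<phi>' where "\<phi>' = s [^] d \<otimes> \<phi>"
    define n' where "n' = d + n"
    have s2: "s \<in> ?Q2" using genideal_mem[OF ysc] by simp
    have sd2: "s [^] d \<in> ?P d" using pow_elem[OF Q2 s2] .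
    have \<phi>'2: "\<phi>' \<in> ?P n'" unfolding \<phi>'_def n'_def using pow_mult_mem[OF Q2 sd2 \<phi>] .
    have sQ: "s \<in> QP 1" using genideal_mem[OF xs, of s] xs_eq by (intro Q_QP1) auto
    have sN: "s \<notin> N 1"
    proof -
      let ?\<sigma> = "0 # 1 # replicate (length ys) 0"
      have "set ys \<subseteq> carrier R" using ysc by auto
      then have "pp ?\<sigma> = s" using sc pprod_zero by (simp add: xs_eq)
      moreover have "pp ?\<sigma> \<notin> N (sum_list ?\<sigma>)"
        by (rule LM_notin_N[OF mon_order_llt LM_pp]) (simp add: xs_eq)
      ultimately show ?thesis by (simp add: sum_list_replicate)
    qed
    have \<phi>Q: "\<phi> \<in> QP n" "\<phi>' \<in> QP n'" using QP_ys[OF xs_eq] \<phi> \<phi>'2 by auto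
    have "s [^] d \<in> QP d" using QP_ys[OF xs_eq sd2] by simp
    moreover have "s [^] d \<notin> N d" using nonnull_pow[OF sQ sN, of d] by simp
    ultimately have \<phi>'N: "\<phi>' \<notin> N n'"
      unfolding \<phi>'_def n'_def using nonnull_mult_QP \<phi>Q(1) \<open>\<phi> \<notin> N n\<close> by blast
    define r' where "r' = s [^] d \<otimes> r"
    have rc: "r' \<in> carrier R" "\<phi>' \<in> carrier R" "p \<in> carrier R" "s [^] d \<in> carrier R"
      using r sc \<phi>Q QP_carr ideal_carr[OF aa] by (auto simp: r'_def)
    have \<phi>'r: "\<phi>' = x \<otimes> r' \<oplus> s [^] d \<otimes> p"
      unfolding \<phi>'_def r'_def r(3) using xc(1) r(1) rc(3,4) by algebra
    have sp: "s [^] d \<otimes> p \<in> \<aa>" using ideal_mult[OF aa r(2)] rc by blast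
    have "x \<otimes> r' = \<phi>' \<ominus> s [^] d \<otimes> p" unfolding \<phi>'r using xc(1) rc by algebra
    moreover have "\<phi>' \<in> E n'" "s [^] d \<otimes> p \<in> E n'" using \<phi>Q(2) sp QP_le_E aa_le_E by blast+
    ultimately have xr: "x \<otimes> r' \<in> E n'" using ideal_minus[OF E_ideal] by simp
    have le: "c \<le> n'" "n' - K + K = n'" "n' - K \<le> n' - c + c" by (simp_all add: n'_def d_def)
    have r1: "r' \<in> E (n' - c)" using c[OF le(1) rc(1) xr] .
    have r2: "x \<otimes> r' \<in> E ((n' - K) + K)" unfolding le(2) by (rule xr)
    have "\<omega> [^] c \<otimes> r' \<in> E ((n' - K) + c * e)"
    proof (rule divide_generically[OF \<omega>(1) _ x(1,2) r1 r2 le(3)])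
      fix n j w h assume "h \<in> E n" "w \<in> QP j" "w \<notin> N j" "w \<otimes> h \<in> E (n + j + 1)"
      then show "\<omega> \<otimes> h \<in> E (n + e + 1)" by (rule \<omega>(3))
    qed
    then obtain \<theta> q where \<theta>: "\<theta> \<in> QP ((n' - K) + c * e)" "q \<in> \<aa>" "\<omega> [^] c \<otimes> r' = \<theta> \<oplus> q"
      by (auto simp: E_def mem_sum)
    have cc: "\<theta> \<in> carrier R" "q \<in> carrier R" "\<omega> [^] c \<in> carrier R"
      using \<theta> QP_carr ideal_carr[OF aa] \<omega>(1) by auto
    have "\<omega> [^] c \<otimes> \<phi>' = x \<otimes> (\<omega> [^] c \<otimes> r') \<oplus> \<omega> [^] c \<otimes> (s [^] d \<otimes> p)"
      unfolding \<phi>'r using xc(1) rc cc(3) by algebra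
    also have "\<dots> = x \<otimes> (\<theta> \<oplus> q) \<oplus> \<omega> [^] c \<otimes> (s [^] d \<otimes> p)" by (simp only: \<theta>(3))
    finally have "\<omega> [^] c \<otimes> \<phi>' \<ominus> x \<otimes> \<theta> = x \<otimes> q \<oplus> \<omega> [^] c \<otimes> (s [^] d \<otimes> p)"
      using xc(1) rc cc by algebra
    moreover have "x \<otimes> q \<oplus> \<omega> [^] c \<otimes> (s [^] d \<otimes> p) \<in> \<aa>"
      using ideal_add[OF aa ideal_mult[OF aa \<theta>(2) xc(1)] ideal_mult[OF aa sp cc(3)]] .
    ultimately have "cg (K + ((n' - K) + c * e)) (\<omega> [^] c \<otimes> \<phi>') (x \<otimes> \<theta>)"
      unfolding cg_def using aa_le_N xc(1) rc cc by auto
    moreover have "c * e + n' = K + ((n' - K) + c * e)" by (simp add: n'_def d_def)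
    ultimately have "\<phi>' \<in> N n'" using x(3)[OF \<phi>'2 \<theta>(1)] by blast
    then show False using \<phi>'N by simp
  qed
  have "indep (PIdl x <+> \<aa>) ?ys"
    unfolding indep_def
  proof (intro allI impI notI)
    fix \<beta> :: "nat list" assume \<beta>: "length \<beta> = length ?ys"
    define n where "n = sum_list \<beta>"
    let ?T = "exps (length ?ys) n - {\<beta>}"
    assume "pprod R ?ys \<beta> \<in> Idl (pprod R ?ys ` (exps (length ?ys) (sum_list \<beta>) - {\<beta>})) <+> nul (PIdl x <+> \<aa>) ?ys (sum_list \<beta>)"
    then obtain l z where l: "l \<in> Idl (pprod R ?ys ` ?T)" "z \<in> nul (PIdl x <+> \<aa>) ?ys n" "pprod R ?ys \<beta> = l \<oplus> z"
      unfolding n_def[symmetric] mem_sum[of "pprod R ?ys \<beta>"] by blast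
    then obtain m z' where m: "m \<in> \<mm> \<cdot> ?P n" "z' \<in> PIdl x <+> \<aa>" "z = m \<oplus> z'"
      unfolding nul_def mem_sum[of z] by blast
    then obtain r p where "r \<in> carrier R" "p \<in> \<aa>" "z' = r \<otimes> x \<oplus> p" unfolding mem_PIdl_sum by blast
    with l m have *: "l \<in> Idl (pprod R ?ys ` ?T)" "m \<in> \<mm> \<cdot> ?P n" "r \<in> carrier R" "p \<in> \<aa>"
      "pprod R ?ys \<beta> = l \<oplus> (m \<oplus> (r \<otimes> x \<oplus> p))"
      by simp_all
    have P: "ideal (?P n) R" using Q2 by (rule pow_ideal)
    have sub: "pprod R ?ys ` exps (length ?ys) n \<subseteq> carrier R" using ysc by (intro pprod_in_carr_sub)
    have lP: "l \<in> ?P n" using *(1) genideal_sub_mono[OF image_mono[of ?T "exps (length ?ys) n"] sub] pow_eq_monomials[OF ysc, of n] by auto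
    have mP: "m \<in> ?P n" using *(2) ideal_prod_inter[OF max_ideal P] by blast
    have bP: "pprod R ?ys \<beta> \<in> ?P n"
      unfolding n_def using pprod_in_pow[OF Q2 genideal_self[OF ysc] \<beta>] .
    define \<phi> where "\<phi> = pprod R ?ys \<beta> \<ominus> l \<ominus> m"
    have \<phi>P: "\<phi> \<in> ?P n" unfolding \<phi>_def using lP mP bP ideal_minus[OF P] by blast
    have cc: "l \<in> carrier R" "m \<in> carrier R" "p \<in> carrier R" "pprod R ?ys \<beta> \<in> carrier R"
      using lP mP bP ideal_carr[OF P] ideal_carr[OF aa] *(4) by auto
    have "\<phi> = x \<otimes> r \<oplus> p" unfolding \<phi>_def *(5) using cc *(3) xc(1) by algebra
    then have \<phi>N: "\<phi> \<in> N n" using key[OF \<phi>P *(3,4)] by blast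
    have "?Q2 \<subseteq> Q" using xs xs_eq by (intro genideal_sub_mono) auto
    then have "\<mm> \<cdot> ?P n \<subseteq> \<mm> \<cdot> QP n"
      using max_ideal QP_ideal pow_mono[OF _ Q2 Q_ideal] by (intro prod_mono) auto
    then have mN: "m \<in> N n" using *(2) mQP_le_N by blast
    let ?\<gamma> = "0 # \<beta>"
    have pg: "pprod R xs (0 # \<delta>) = pprod R ?ys \<delta>" for \<delta> using ysc unfolding xs_eq by simp
    have lg: "l \<in> Idl (pp ` (exps (length xs) (sum_list ?\<gamma>) - {?\<gamma>}))"
    proof -
      have "pprod R ?ys ` ?T \<subseteq> pp ` (exps (length xs) (sum_list ?\<gamma>) - {?\<gamma>})"
      proof
        fix z assume "z \<in> pprod R ?ys ` ?T"
        then obtain \<delta> where \<delta>: "\<delta> \<in> exps (length ?ys) n" "\<delta> \<noteq> \<beta>" "z = pprod R ?ys \<delta>" by auto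
        then have "0 # \<delta> \<in> exps (length xs) (sum_list ?\<gamma>) - {?\<gamma>}" by (auto simp: exps_def n_def xs_eq)
        then show "z \<in> pp ` (exps (length xs) (sum_list ?\<gamma>) - {?\<gamma>})"
          by (rule image_eqI[of z pp "0 # \<delta>", rotated]) (simp only: \<delta>(3) pg)
      qed
      then show ?thesis using *(1) genideal_sub_mono[OF _ pprod_in_carr_sub[OF xs]] by blast
    qed
    have "pprod R ?ys \<beta> = l \<oplus> (\<phi> \<oplus> m)" unfolding \<phi>_def using cc by algebra
    moreover have "\<phi> \<oplus> m \<in> N n" using \<phi>N mN ideal_add[OF N_ideal] by blast
    ultimately have "pp ?\<gamma> \<in> Idl (pp ` (exps (length xs) (sum_list ?\<gamma>) - {?\<gamma>})) <+> N (sum_list ?\<gamma>)"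
      using lg by (simp add: pg n_def sum_memI)
    moreover have "length ?\<gamma> = length xs" using \<beta> xs_eq by simp
    ultimately show False using indep unfolding indep_def by blast
  qed
  then show ?thesis using xc by blast
qed

end

context noetherian_local
begin

definition prime_chain_above :: "'a set \<Rightarrow> nat \<Rightarrow> bool"
  where "prime_chain_above K l \<longleftrightarrow> (\<exists>P :: nat \<Rightarrow> 'a set.
    (\<forall>i\<le>l. primeideal (P i) R) \<and> (\<forall>i<l. P i \<subset> P (Suc i)) \<and> K \<subseteq> P 0)"

lemma prime_chain_above_Suc:
  assumes "primeideal P R" "K \<subseteq> P" "P \<subset> K'" "prime_chain_above K' l"
  shows "prime_chain_above K (Suc l)"
proof -
  obtain C :: "nat \<Rightarrow> 'a set" where C: "\<And>i. i \<le> l \<Longrightarrow> primeideal (C i) R"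
    "\<And>i. i < l \<Longrightarrow> C i \<subset> C (Suc i)" "K' \<subseteq> C 0"
    using assms(4) unfolding prime_chain_above_def by blast
  define D where "D i = (case i of 0 \<Rightarrow> P | Suc j \<Rightarrow> C j)" for i
  have "primeideal (D i) R" if "i \<le> Suc l" for i using that assms(1) C(1) by (cases i) (auto simp: D_def)
  moreover have "D i \<subset> D (Suc i)" if "i < Suc l" for i
    using that assms(3) C(2,3) by (cases i) (auto simp: D_def)
  ultimately show ?thesis
    unfolding prime_chain_above_def using assms(2) by (intro exI[of _ D]) (auto simp: D_def)
qed

lemma independent_familyI:
  "ideal \<aa> R \<Longrightarrow> set xs \<subseteq> carrier R \<Longrightarrow> indep \<aa> xs \<Longrightarrow> independent_family R \<aa> xs"
  by (intro independent_family.intro noetherian_local_axioms independent_family_axioms.intro)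

text \<open>Enlarge \<open>\<aa>\<close> to an ideal \<open>\<pp>\<close> that is maximal among those modulo which \<open>xs\<close> is independent. It is prime, the chain
starts with it, and the rest of the chain comes from \<open>xs\<close> without its first element, modulo \<open>x\<close> and \<open>\<pp>\<close>.
With one element left, \<open>\<pp> \<subset> \<mm>\<close> is the chain.\<close>

theorem independent_imp_prime_chain:
  "ideal \<aa> R \<Longrightarrow> set xs \<subseteq> \<mm> \<Longrightarrow> indep \<aa> xs \<Longrightarrow> prime_chain_above \<aa> (length xs)"
proof (induction "length xs" arbitrary: \<aa> xs)
  case 0
  then have "independent_family R \<aa> xs" using ideal_sub[OF max_ideal] by (intro independent_familyI) auto
  then have "\<one> \<notin> \<aa>" by (rule independent_family.aa_proper)
  then have "\<aa> \<subseteq> \<mm>" using proper_ideal_le_max[OF "0.prems"(1)] by blast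
  then show ?case using "0.hyps"[symmetric] max_prime unfolding prime_chain_above_def by (intro exI[of _ "\<lambda>_. \<mm>"]) auto
next
  case (Suc l)
  have xsc: "set xs \<subseteq> carrier R" using Suc.prems ideal_sub[OF max_ideal] by auto
  obtain \<pp> where pp: "ideal \<pp> R" "\<aa> \<subseteq> \<pp>" "indep \<pp> xs"
    "\<And>\<bb>. ideal \<bb> R \<Longrightarrow> indep \<bb> xs \<Longrightarrow> \<pp> \<subseteq> \<bb> \<Longrightarrow> \<bb> = \<pp>"
    using ex_maximal_ideal_in[of \<aa> "\<lambda>\<bb>. indep \<bb> xs"] Suc.prems by blast
  interpret F: independent_family R \<pp> xs using pp xsc by (intro independent_familyI)
  have prime: "primeideal \<pp> R" using pp(4) by (rule F.maximal_independent_prime)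
  obtain t zs where t: "xs = t # zs" using Suc.hyps by (cases xs) auto
  show ?case
  proof (cases zs)
    case Nil
    have "t \<notin> F.N 1"
      using F.LM_notin_N[OF mon_order_llt F.LM_pp[of "[1]"]] xsc by (simp add: t Nil)
    then have "t \<notin> \<pp>" using F.aa_le_N by blast
    moreover have "\<pp> \<subseteq> \<mm>" using proper_ideal_le_max[OF pp(1) F.aa_proper] .
    ultimately have "\<pp> \<subset> \<mm>" using Suc.prems(2) t by auto
    moreover have "prime_chain_above \<mm> 0"
      using max_prime unfolding prime_chain_above_def by (intro exI[of _ "\<lambda>_. \<mm>"]) auto
    ultimately have "prime_chain_above \<aa> (Suc 0)" using prime_chain_above_Suc prime pp(2) by blast
    then show ?thesis by (simp add: t Nil)
  next
    case (Cons s ys)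
    obtain x where x: "x \<in> carrier R" "x \<notin> \<pp>" "indep (PIdl x <+> \<pp>) zs"
      using F.independent_modulo_element[OF _ prime, of t s ys] t Cons by auto
    have P: "ideal (PIdl x) R" using x(1) by (rule cgenideal_ideal)
    have "prime_chain_above (PIdl x <+> \<pp>) (length zs)"
      using Suc.hyps Suc.prems(2) t x(3) add_ideals[OF P pp(1)] by auto
    moreover have "\<pp> \<subset> PIdl x <+> \<pp>"
      using sum_upper1[OF P pp(1)] sum_upper2[OF P pp(1)] cgenideal_self[OF x(1)] x(2) by blast
    ultimately show ?thesis using prime_chain_above_Suc prime pp(2) t by auto
  qed
qed

end

section \<open>The number of generators of powers of an ideal\<close>

lemma acc_bool: "acc (UNIV :: bool set)"
  unfolding acc_def
proof (intro allI impI)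
  fix s :: "nat \<Rightarrow> bool" assume s: "mono s"
  show "\<exists>k. \<forall>n\<ge>k. s n = s k"
  proof (cases "\<exists>k. s k")
    case True
    then obtain k where "s k" by blast
    then have "s n = s k" if "n \<ge> k" for n using monoD[OF s that] by auto
    then show ?thesis by blast
  qed auto
qed

text \<open>Moving a box to the origin and restricting to its free coordinates turns the monomials of the box into all monomials in the
selected generators.\<close>

definition zero_corner :: "(nat \<times> bool) list \<Rightarrow> (nat \<times> bool) list"
  where "zero_corner S = map (\<lambda>(a, f). (0, f)) S"

definition free_entries :: "(nat \<times> bool) list \<Rightarrow> 'a list \<Rightarrow> 'a list"
  where "free_entries S zs = map snd (filter (\<lambda>p. snd (fst p)) (zip S zs))"

lemma frees_zero_corner [simp]: "frees (zero_corner S) = frees S"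
  by (induction S) (auto simp: frees_def zero_corner_def)

lemma length_zero_corner [simp]: "length (zero_corner S) = length S"
  by (simp add: zero_corner_def)

lemma length_free_entries: "length S = length zs \<Longrightarrow> length (free_entries S zs) = frees S"
  by (induction S zs rule: list_induct2) (auto simp: free_entries_def frees_def)

lemma set_free_entries: "set (free_entries S zs) \<subseteq> set zs"
  by (auto simp: free_entries_def dest: set_zip_rightD)

lemma zero_corner_sum [simp]: "sum_list (map fst (zero_corner S)) = 0"
  by (induction S) (auto simp: zero_corner_def)

lemma plug_zero_corner_ple: "length \<beta> = frees S \<Longrightarrow> ple (plug (zero_corner S) \<beta>) (plug S \<beta>)"
  by (induction S \<beta> rule: plug.induct) (auto simp: frees_def zero_corner_def)

lemma plug_length: "length \<beta> = frees S \<Longrightarrow> length (plug S \<beta>) = length S"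
  using fits_length[OF fits_plug] by blast

lemma (in cring) pprod_free_entries:
  assumes "set zs \<subseteq> carrier R" "length S = length zs" "length \<beta> = frees S"
  shows "pprod R zs (plug (zero_corner S) \<beta>) = pprod R (free_entries S zs) \<beta>"
  using assms
proof (induction zs arbitrary: S \<beta>)
  case Nil
  then show ?case by (simp add: free_entries_def zero_corner_def)
next
  case (Cons z zs)
  obtain a free S' where S: "S = (a, free) # S'" "length S' = length zs" using Cons.prems(2) by (cases S) auto
  show ?case
  proof (cases free)
    case True
    then obtain b \<beta>' where \<beta>: "\<beta> = b # \<beta>'" "length \<beta>' = frees S'"
      using Cons.prems(3) S by (cases \<beta>) (auto simp: frees_def)
    then show ?thesis using Cons.IH[OF _ S(2) \<beta>(2)] Cons.prems(1) True by (simp add: S free_entries_def zero_corner_def)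
  next
    case False
    then have \<beta>: "length \<beta> = frees S'" using Cons.prems(3) S by (simp add: frees_def)
    have "set (free_entries S' zs) \<subseteq> carrier R" using set_free_entries[of S' zs] Cons.prems(1) by auto
    then show ?thesis using Cons.IH[OF _ S(2) \<beta>] Cons.prems(1) False by (simp add: S free_entries_def zero_corner_def)
  qed
qed

text \<open>The factor \<open>d\<close> makes the bound hold for \<open>d = 0\<close>, too: a box without free coordinates has no vector beyond its corner.\<close>

lemma cnt_le:
  assumes "frees S \<le> d" "n > sum_list (map fst S)"
  shows "cnt S n \<le> d * ((d + 1) * (n + 1)) ^ (d - 1)"
proof (cases "frees S")
  case 0
  then show ?thesis using assms by (simp add: cnt_eq Let_def binomial_eq_0)
next
  case (Suc f)
  define k where "k = n - sum_list (map fst S)"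
  have kn: "k \<le> n" by (simp add: k_def)
  have "cnt S n = (k + f) choose k" using assms Suc by (simp add: cnt_eq Let_def k_def)
  also have "\<dots> = (k + f) choose f" using binomial_symmetric[of k "k + f"] by simp
  also have "\<dots> \<le> (k + f) ^ f" by (rule binomial_le_pow) simp
  also have "\<dots> \<le> ((d + 1) * (n + 1)) ^ f"
    using kn Suc assms(1) by (intro power_mono) (auto simp: algebra_simps intro: order_trans[of _ "n + d"])
  also have "\<dots> \<le> ((d + 1) * (n + 1)) ^ (d - 1)" using Suc assms(1) by (intro power_increasing) auto
  also have "\<dots> \<le> d * \<dots>" using Suc assms(1) by simp
  finally show ?thesis .
qed

context noetherian_local
begin

context
  fixes I :: "'a set" and zs :: "'a list"
  assumes zs: "set zs \<subseteq> carrier R" and I: "I = Idl (set zs)"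
begin

text \<open>A monomial is standard if it is not a combination of smaller ones in the fibre ring of \<open>I\<close>. Standard monomials of degree \<open>n\<close> are
a minimal set of generators of \<open>I^n\<close>, and divisors of standard monomials are standard.\<close>

definition std :: "nat list \<Rightarrow> bool"
  where "std \<alpha> \<longleftrightarrow> pprod R zs \<alpha> \<notin> Idl (pprod R zs ` lower llt \<alpha>) <+> \<mm> \<cdot> ideal_pow R I (sum_list \<alpha>)"

lemma I_ideal: "ideal I R" unfolding I using zs by (rule genideal_ideal)
lemma max_I_pow_ideal: "ideal (\<mm> \<cdot> ideal_pow R I n) R" using max_ideal pow_ideal[OF I_ideal] by (rule ideal_prod_is_ideal)
lemma span_ideal_zs: "ideal (Idl (pprod R zs ` T)) R" using zs by (intro genideal_ideal pprod_in_carr_sub)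
lemma span_mono_zs: "S \<subseteq> T \<Longrightarrow> Idl (pprod R zs ` S) \<subseteq> Idl (pprod R zs ` T)"
  using zs by (intro genideal_sub_mono image_mono pprod_in_carr_sub)
lemma span_mem_zs: "\<alpha> \<in> T \<Longrightarrow> pprod R zs \<alpha> \<in> Idl (pprod R zs ` T)"
  using zs by (intro genideal_mem pprod_in_carr_sub) auto

lemma std_mono:
  assumes "length \<alpha> = length zs" "ple \<alpha> \<beta>" "std \<beta>" shows "std \<alpha>"
proof (rule ccontr)
  assume "\<not> std \<alpha>"
  then obtain l m where l: "l \<in> Idl (pprod R zs ` lower llt \<alpha>)" "m \<in> \<mm> \<cdot> ideal_pow R I (sum_list \<alpha>)"
    "pprod R zs \<alpha> = l \<oplus> m" unfolding std_def mem_sum by blast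
  obtain \<gamma> where \<gamma>: "length \<gamma> = length zs" "\<beta> = padd \<alpha> \<gamma>" using ple_imp_padd[OF assms(2)] assms(1) by auto
  let ?g = "pprod R zs \<gamma>"
  have c: "?g \<in> carrier R" "l \<in> carrier R" "m \<in> carrier R" using zs l ideal_carr[OF span_ideal_zs] ideal_carr[OF max_I_pow_ideal] by auto
  have "pprod R zs \<beta> = ?g \<otimes> (l \<oplus> m)"
    unfolding \<gamma>(2) using pprod_padd[OF zs assms(1) \<gamma>(1)] l(3) zs c by (simp add: m_comm)
  then have eq: "pprod R zs \<beta> = ?g \<otimes> l \<oplus> ?g \<otimes> m" using c by (simp add: r_distr)
  have gl: "?g \<otimes> l \<in> Idl (pprod R zs ` lower llt \<beta>)"
    using low_mult[OF mon_order_llt zs assms(1) \<gamma>(1) l(1)] \<gamma>(2) by simp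
  have "?g \<in> ideal_pow R I (sum_list \<gamma>)"
    using pprod_in_pow[OF I_ideal _ \<gamma>(1)] genideal_self[OF zs] I by simp
  then have "m \<otimes> ?g \<in> (\<mm> \<cdot> ideal_pow R I (sum_list \<alpha>)) \<cdot> ideal_pow R I (sum_list \<gamma>)"
    using l(2) by (intro ideal_prod.prod)
  also have "\<dots> = \<mm> \<cdot> ideal_pow R I (sum_list \<beta>)"
    using ideal_prod_assoc[OF max_ideal pow_ideal[OF I_ideal] pow_ideal[OF I_ideal]] pow_add[OF I_ideal] \<gamma> assms(1)
    by (simp add: sum_list_padd)
  finally have "?g \<otimes> m \<in> \<mm> \<cdot> ideal_pow R I (sum_list \<beta>)" using c by (simp add: m_comm)
  then show False using assms(3) gl eq unfolding std_def mem_sum by blast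
qed

lemma std_spans:
  "ideal_pow R I n \<subseteq> Idl (pprod R zs ` {\<alpha> \<in> exps (length zs) n. std \<alpha>}) <+> \<mm> \<cdot> ideal_pow R I n"
proof -
  let ?M = "\<mm> \<cdot> ideal_pow R I n" and ?D = "\<lambda>T. Idl (pprod R zs ` {\<alpha> \<in> T. std \<alpha>})"
  have D: "ideal (?D T <+> ?M) R" for T using span_ideal_zs max_I_pow_ideal by (rule add_ideals)
  have "Idl (pprod R zs ` exps (length zs) n) \<subseteq> ?D (exps (length zs) n) <+> ?M"
  proof (rule lower_induct[where P = "\<lambda>T. Idl (pprod R zs ` T) \<subseteq> ?D T <+> ?M", OF mon_order_llt])
    show "Idl (pprod R zs ` {}) \<subseteq> ?D {} <+> ?M" using ideal_zero[OF D[of "{}"]] by (simp add: genideal_empty)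
    fix \<alpha> assume \<alpha>: "\<alpha> \<in> exps (length zs) n" and IH: "Idl (pprod R zs ` lower llt \<alpha>) \<subseteq> ?D (lower llt \<alpha>) <+> ?M"
    let ?T = "insert \<alpha> (lower llt \<alpha>)"
    have le: "?D (lower llt \<alpha>) <+> ?M \<subseteq> ?D ?T <+> ?M" by (intro add_ideals_mono span_mono_zs) auto
    have "pprod R zs \<alpha> \<in> ?D ?T <+> ?M"
    proof (cases "std \<alpha>")
      case True
      then show ?thesis using span_mem_zs[of \<alpha> "{\<alpha> \<in> ?T. std \<alpha>}"] sum_upper1[OF span_ideal_zs max_I_pow_ideal] by blast
    next
      case False
      then have "pprod R zs \<alpha> \<in> Idl (pprod R zs ` lower llt \<alpha>) <+> ?M"
        using \<alpha> by (simp add: std_def exps_def)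
      moreover have "Idl (pprod R zs ` lower llt \<alpha>) <+> ?M \<subseteq> ?D ?T <+> ?M"
        using IH le sum_upper2[OF span_ideal_zs max_I_pow_ideal] by (intro sum_le D) blast+
      ultimately show ?thesis by blast
    qed
    moreover have "pprod R zs ` lower llt \<alpha> \<subseteq> ?D ?T <+> ?M"
      using IH le span_mem_zs by blast
    ultimately show "Idl (pprod R zs ` ?T) \<subseteq> ?D ?T <+> ?M" by (intro genideal_le D) auto
  qed
  then show ?thesis using pow_eq_monomials[OF zs] I by simp
qed

text \<open>In a relation between standard monomials with some coefficient a unit, the largest monomial with a unit coefficient would be a
combination of smaller ones.\<close>

lemma std_irredundant:
  assumes "T \<subseteq> exps (length zs) n" "\<alpha> \<in> exps (length zs) n" "\<alpha> \<notin> T" "std \<alpha>" "\<And>\<gamma>. \<gamma> \<in> T \<Longrightarrow> std \<gamma>"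
  shows "pprod R zs \<alpha> \<notin> Idl (pprod R zs ` T) <+> \<mm> \<cdot> ideal_pow R I n"
proof -
  let ?M = "\<mm> \<cdot> ideal_pow R I n" and ?p = "pprod R zs"
  have M: "ideal ?M R" by (rule max_I_pow_ideal)
  have stdD: "?p \<gamma> \<notin> Idl (?p ` U) <+> ?M" if "std \<gamma>" "\<gamma> \<in> exps (length zs) n" "U \<subseteq> lower llt \<gamma>" for \<gamma> U
  proof -
    have "Idl (?p ` U) <+> ?M \<subseteq> Idl (?p ` lower llt \<gamma>) <+> ?M" using span_mono_zs[OF that(3)] by (intro add_ideals_mono) auto
    then show ?thesis using that(1,2) by (auto simp: std_def exps_def)
  qed
  have "finite T" using assms(1) finite_exps finite_subset by blast
  then show ?thesis using assms(1,3,5)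
  proof (induction "card T" arbitrary: T rule: less_induct)
    case less
    show ?case
    proof (cases "T = {}")
      case True
      then show ?thesis using stdD[OF assms(4,2), of T] by simp
    next
      case False
      then obtain \<gamma> where \<gamma>: "\<gamma> \<in> T" "T - {\<gamma>} \<subseteq> lower llt \<gamma>"
        using ex_max_exponent[OF mon_order_llt less.prems(1) _ less.prems(2)] by blast
      let ?T = "T - {\<gamma>}"
      have \<gamma>e: "\<gamma> \<in> exps (length zs) n" "\<gamma> \<noteq> \<alpha>" using \<gamma>(1) less.prems by auto
      have "card ?T < card T" using less.prems(1) \<gamma>(1) by (meson card_Diff1_less)
      then have IH: "?p \<alpha> \<notin> Idl (?p ` ?T) <+> ?M" using less.prems by (intro less.hyps) auto
      show ?thesis
      proof
        assume "?p \<alpha> \<in> Idl (?p ` T) <+> ?M"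
        moreover have "?p ` T = insert (?p \<gamma>) (?p ` ?T)" using \<gamma>(1) by auto
        then have "Idl (?p ` T) = PIdl (?p \<gamma>) <+> Idl (?p ` ?T)"
          using zs by (simp add: genideal_insert image_subset_iff)
        ultimately obtain z m where z: "z \<in> PIdl (?p \<gamma>) <+> Idl (?p ` ?T)" "m \<in> ?M" "?p \<alpha> = z \<oplus> m"
          unfolding mem_sum[of "?p \<alpha>"] by auto
        then obtain r l where r: "r \<in> carrier R" "l \<in> Idl (?p ` ?T)" "z = r \<otimes> ?p \<gamma> \<oplus> l"
          unfolding mem_PIdl_sum by blast
        have c: "l \<in> carrier R" "m \<in> carrier R" "?p \<gamma> \<in> carrier R" "?p \<alpha> \<in> carrier R"
          using r z ideal_carr[OF span_ideal_zs] ideal_carr[OF M] zs by auto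
        show False
        proof (cases "r \<in> \<mm>")
          case True
          have "?p \<gamma> \<in> ideal_pow R I n"
            using pprod_in_pow[OF I_ideal, of zs \<gamma>] genideal_self[OF zs] I \<gamma>e(1) by (simp add: exps_def)
          then have "r \<otimes> ?p \<gamma> \<in> ?M" using True by (intro ideal_prod.prod)
          then have "r \<otimes> ?p \<gamma> \<oplus> m \<in> ?M" using z(2) ideal_add[OF M] by blast
          moreover have "?p \<alpha> = l \<oplus> (r \<otimes> ?p \<gamma> \<oplus> m)" unfolding z(3) r(3) using c r(1) by algebra
          ultimately show False using IH r(2) sum_memI by metis
        next
          case False
          obtain v where v: "v \<in> carrier R" "v \<otimes> r = \<one>" using unit_if_notin_max[OF r(1) False] .
          consider "llt \<gamma> \<alpha>" | "llt \<alpha> \<gamma>"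
            using llt_total[of \<gamma> \<alpha>] \<gamma>e assms(2) by (auto simp: exps_def)
          then show False
          proof cases
            case 1
            have "T \<subseteq> lower llt \<alpha>"
            proof
              fix \<delta> assume \<delta>: "\<delta> \<in> T"
              then have "\<delta> \<in> exps (length zs) n" using less.prems(2) by auto
              moreover have "llt \<delta> \<alpha>" using \<delta> \<gamma>(2) 1 llt_trans[of \<delta> \<gamma> \<alpha>] by (cases "\<delta> = \<gamma>") (auto simp: lower_def)
              ultimately show "\<delta> \<in> lower llt \<alpha>" using assms(2) by (auto simp: lower_def exps_def)
            qed
            then show False using stdD[OF assms(4,2)] \<open>?p \<alpha> \<in> Idl (?p ` T) <+> ?M\<close> by blast
          next
            case 2
            let ?U = "insert \<alpha> ?T"
            have "\<alpha> \<in> lower llt \<gamma>" using 2 assms(2) \<gamma>e by (auto simp: lower_def exps_def)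
            then have U: "?U \<subseteq> lower llt \<gamma>" using \<gamma>(2) by auto
            have "?p \<alpha> \<ominus> l \<in> Idl (?p ` ?U)"
              using span_mem_zs[of \<alpha> ?U] r(2) span_mono_zs[of ?T ?U] by (intro ideal_minus[OF span_ideal_zs]) auto
            then have "v \<otimes> (?p \<alpha> \<ominus> l) \<in> Idl (?p ` ?U)" using v(1) ideal_mult[OF span_ideal_zs] by blast
            moreover have "\<ominus> (v \<otimes> m) \<in> ?M" using z(2) v(1) ideal_mult[OF M] ideal_neg[OF M] by blast
            ultimately have "v \<otimes> (?p \<alpha> \<ominus> l) \<oplus> (\<ominus> (v \<otimes> m)) \<in> Idl (?p ` ?U) <+> ?M" by (rule sum_memI)
            moreover have "v \<otimes> (?p \<alpha> \<ominus> l) \<oplus> (\<ominus> (v \<otimes> m)) = (v \<otimes> r) \<otimes> ?p \<gamma>"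
              unfolding z(3) r(3) using c r(1) v(1) by algebra
            ultimately have "?p \<gamma> \<in> Idl (?p ` ?U) <+> ?M" using v(2) c by simp
            then show False using stdD[OF less.prems(4)[OF \<gamma>(1)] \<gamma>e(1) U] by simp
          qed
        qed
      qed
    qed
  qed
qed

text \<open>The monomials in the generators that belong to the free coordinates divide monomials of the box, so they are standard.\<close>

lemma std_box_independent:
  assumes "length S = length zs" and S: "\<And>\<alpha>. fits S \<alpha> \<Longrightarrow> std \<alpha>"
  shows "indep {\<zero>} (free_entries S zs)"
  unfolding indep_def
proof (intro allI impI notI)
  let ?ys = "free_entries S zs" and ?S = "zero_corner S"
  have len: "length ?ys = frees S" using length_free_entries[OF assms(1)] .
  have ysc: "set ?ys \<subseteq> carrier R" "set ?ys \<subseteq> set zs" using set_free_entries[of S zs] zs by auto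
  fix \<beta> :: "nat list" assume \<beta>: "length \<beta> = length ?ys"
  define n where "n = sum_list \<beta>"
  let ?T = "plug ?S ` (exps (frees S) n - {\<beta>})"
  assume *: "pprod R ?ys \<beta> \<in> Idl (pprod R ?ys ` (exps (length ?ys) (sum_list \<beta>) - {\<beta>})) <+> nul {\<zero>} ?ys (sum_list \<beta>)"
  have st: "std (plug ?S \<delta>)" "plug ?S \<delta> \<in> exps (length zs) (sum_list \<delta>)" if "length \<delta> = frees S" for \<delta>
  proof -
    have l: "length (plug ?S \<delta>) = length zs" using plug_length[of \<delta> ?S] that assms(1) by simp
    show "std (plug ?S \<delta>)" using std_mono[OF l plug_zero_corner_ple[OF that]] S fits_plug[OF that] by blast
    show "plug ?S \<delta> \<in> exps (length zs) (sum_list \<delta>)" using l sum_list_plug[of \<delta> ?S] that by (simp add: exps_def)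
  qed
  have img: "pprod R ?ys ` (exps (frees S) n - {\<beta>}) = pprod R zs ` ?T"
    unfolding image_image using pprod_free_entries[OF zs assms(1)] by (intro image_cong) (auto simp: exps_def)
  have "ideal (Idl (set ?ys)) R" using ysc(1) by (rule genideal_ideal)
  moreover have "Idl (set ?ys) \<subseteq> I" unfolding I using ysc(2) zs by (rule genideal_sub_mono)
  ultimately have "\<mm> \<cdot> ideal_pow R (Idl (set ?ys)) n \<subseteq> \<mm> \<cdot> ideal_pow R I n"
    using max_ideal pow_ideal[OF I_ideal] pow_mono I_ideal by (intro prod_mono) auto
  then have "nul {\<zero>} ?ys n \<subseteq> \<mm> \<cdot> ideal_pow R I n"
    unfolding nul_def using ideal_zero[OF max_I_pow_ideal] by (intro sum_le max_I_pow_ideal) auto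
  then have "Idl (pprod R ?ys ` (exps (length ?ys) (sum_list \<beta>) - {\<beta>})) <+> nul {\<zero>} ?ys (sum_list \<beta>)
      \<subseteq> Idl (pprod R zs ` ?T) <+> \<mm> \<cdot> ideal_pow R I n"
    unfolding len n_def[symmetric] img by (intro add_ideals_mono order_refl)
  then have "pprod R zs (plug ?S \<beta>) \<in> Idl (pprod R zs ` ?T) <+> \<mm> \<cdot> ideal_pow R I n"
    using * pprod_free_entries[OF zs assms(1), of \<beta>] \<beta> len by auto
  moreover have "pprod R zs (plug ?S \<beta>) \<notin> Idl (pprod R zs ` ?T) <+> \<mm> \<cdot> ideal_pow R I n"
  proof (rule std_irredundant)
    show "?T \<subseteq> exps (length zs) n" using st(2) by (auto simp: exps_def)
    show "plug ?S \<beta> \<in> exps (length zs) n" using st(2)[of \<beta>] \<beta> len by (simp add: n_def)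
    show "plug ?S \<beta> \<notin> ?T" using plug_inj[of _ ?S \<beta>] \<beta> len by (auto simp: exps_def)
    show "std (plug ?S \<beta>)" using st(1) \<beta> len by simp
    show "std \<gamma>" if "\<gamma> \<in> ?T" for \<gamma> using that st(1) by (auto simp: exps_def)
  qed
  ultimately show False by blast
qed

end

lemma prime_chain_le_dim:
  assumes "krull_dim R = enat d" "prime_chain_above K l" shows "l \<le> d"
proof -
  have "enat l \<le> krull_dim R"
    unfolding krull_dim_def using assms(2) by (intro Sup_upper) (auto simp: prime_chain_above_def)
  then show ?thesis using assms(1) by simp
qed

text \<open>Standardness is constant on the boxes of a finite partition. The standard boxes have at most \<open>d\<close> free coordinates,
since these give analytically independent elements and hence a chain of primes. The number of standard monomials of degree \<open>n\<close>
is then a sum of binomial coefficients of degree less than \<open>d\<close> in \<open>n\<close>.\<close>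

theorem few_generators_of_powers:
  assumes I: "ideal I R" "I \<subseteq> \<mm>" and dim: "krull_dim R = enat d"
  shows "\<exists>C n0. \<forall>n. \<exists>G. finite G \<and> G \<subseteq> ideal_pow R I n \<and>
    ideal_pow R I n \<subseteq> Idl G <+> \<mm> \<cdot> ideal_pow R I n \<and> (n \<ge> n0 \<longrightarrow> card G \<le> C * d * (n + 1) ^ (d - 1))"
proof -
  obtain zs where zs: "set zs \<subseteq> carrier R" "I = Idl (set zs)" using ideal_finite_gens[OF I(1)] .
  let ?r = "length zs" and ?std = "std I zs" and ?p = "pprod R zs"
  have "\<exists>\<B>. partitions ?r \<B> \<and> (\<forall>S\<in>\<B>. \<forall>\<alpha>. fits S \<alpha> \<longrightarrow> (\<not> ?std \<alpha>) = (\<not> ?std (map fst S)))"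
    using std_mono[OF zs] by (intro monotone_decomp[OF acc_bool]) (auto simp: le_bool_def)
  then obtain \<B> where \<B>: "partitions ?r \<B>" "\<And>S \<alpha>. S \<in> \<B> \<Longrightarrow> fits S \<alpha> \<Longrightarrow> ?std \<alpha> = ?std (map fst S)" by blast
  have fin: "finite \<B>" and lenS: "\<And>S. S \<in> \<B> \<Longrightarrow> length S = ?r" using \<B>(1) by (auto simp: partitions_def)
  have fr: "frees S \<le> d" if S: "S \<in> \<B>" "?std (map fst S)" for S
  proof -
    have "indep {\<zero>} (free_entries S zs)" using \<B>(2) S lenS by (intro std_box_independent[OF zs]) auto
    moreover have "set (free_entries S zs) \<subseteq> \<mm>" using set_free_entries[of S zs] genideal_self[OF zs(1)] zs(2) I(2) by auto
    ultimately have "prime_chain_above {\<zero>} (length (free_entries S zs))" by (intro independent_imp_prime_chain zeroideal)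
    then show ?thesis using prime_chain_le_dim[OF dim] length_free_entries lenS S by metis
  qed
  define n0 where "n0 = (\<Sum>S\<in>\<B>. sum_list (map fst S)) + 1"
  define C where "C = card \<B> * (d + 1) ^ (d - 1)"
  show ?thesis
  proof (rule exI[of _ C], rule exI[of _ n0], rule allI)
    fix n
    let ?E = "{\<alpha> \<in> exps ?r n. ?std \<alpha>}" and ?G = "?p ` {\<alpha> \<in> exps ?r n. ?std \<alpha>}"
    have "card ?G \<le> C * d * (n + 1) ^ (d - 1)" if n: "n \<ge> n0"
    proof -
      have "card ?G \<le> card ?E" by (rule card_image_le) simp
      also have "\<dots> = (\<Sum>\<alpha>\<in>exps ?r n. if ?std \<alpha> then 1 else 0)"
        by (simp add: sum.If_cases) (simp add: Int_def)
      also have "\<dots> = (\<Sum>S\<in>\<B>. \<Sum>\<alpha> | fits S \<alpha> \<and> sum_list \<alpha> = n. if ?std \<alpha> then 1 else 0)"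
        by (rule sum_partitions[OF \<B>(1)])
      also have "\<dots> = (\<Sum>S\<in>\<B>. if ?std (map fst S) then cnt S n else 0)"
        using \<B>(2) by (intro sum.cong refl) (simp add: cnt_def)
      also have "\<dots> \<le> (\<Sum>S\<in>\<B>. d * ((d + 1) * (n + 1)) ^ (d - 1))"
      proof (rule sum_mono)
        fix S assume S: "S \<in> \<B>"
        have "sum_list (map fst S) \<le> (\<Sum>S\<in>\<B>. sum_list (map fst S))" using fin S by (intro member_le_sum) auto
        then have "n > sum_list (map fst S)" using n by (simp add: n0_def)
        then show "(if ?std (map fst S) then cnt S n else 0) \<le> d * ((d + 1) * (n + 1)) ^ (d - 1)"
          using cnt_le fr[OF S] by simp
      qed
      also have "\<dots> = C * d * (n + 1) ^ (d - 1)"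
        by (simp only: sum_constant C_def power_mult_distrib of_nat_id mult_ac)
      finally show ?thesis .
    qed
    moreover have "?G \<subseteq> ideal_pow R I n"
      using pprod_in_pow[OF I(1), of zs] genideal_self[OF zs(1)] zs(2) by (auto simp: exps_def)
    moreover have "ideal_pow R I n \<subseteq> Idl ?G <+> \<mm> \<cdot> ideal_pow R I n" by (rule std_spans[OF zs])
    ultimately show "\<exists>G. finite G \<and> G \<subseteq> ideal_pow R I n \<and>
        ideal_pow R I n \<subseteq> Idl G <+> \<mm> \<cdot> ideal_pow R I n \<and> (n \<ge> n0 \<longrightarrow> card G \<le> C * d * (n + 1) ^ (d - 1))"
      by (intro exI[of _ ?G]) simp
  qed
qed

end

section \<open>Saturations of powers\<close>

context noetherian_local
begin

abbreviation sat :: "'a set \<Rightarrow> 'a set" where "sat \<equiv> saturation R"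

lemma saturation_eq_colon:
  assumes "ideal K R"
  shows "\<exists>k. sat K = ideal_colon R K (ideal_pow R \<mm> k)"
proof -
  let ?c = "\<lambda>i. ideal_colon R K (ideal_pow R \<mm> i)"
  have "range ?c \<subseteq> {I. ideal I R}"
    using assms pow_ideal[OF max_ideal] ideal_sub by (auto intro!: ideal_colon_ideal)
  moreover have "mono ?c"
    using pow_anti[OF max_ideal] by (intro monoI) (auto simp: ideal_colon_def)
  ultimately obtain k where k: "\<And>n. n \<ge> k \<Longrightarrow> ?c n = ?c k"
    using acc_ideals unfolding acc_def by blast
  have "?c i \<subseteq> ?c k" for i
    using monoD[OF \<open>mono ?c\<close>, of i "max i k"] k[of "max i k"] by auto
  then have "sat K = ?c k" unfolding saturation_def by blast
  then show ?thesis by blast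
qed

lemma saturation_ideal: "ideal K R \<Longrightarrow> ideal (sat K) R"
  using saturation_eq_colon[of K] pow_ideal[OF max_ideal] ideal_sub ideal_colon_ideal by metis

lemma saturation_mono: "K \<subseteq> L \<Longrightarrow> sat K \<subseteq> sat L"
  unfolding saturation_def ideal_colon_def by blast

lemma saturation_upper: "ideal K R \<Longrightarrow> K \<subseteq> sat K"
proof
  fix x assume "ideal K R" "x \<in> K"
  then have "x \<in> ideal_colon R K (ideal_pow R \<mm> 0)"
    using ideal_mult_right ideal_carr by (auto simp: ideal_colon_def)
  then show "x \<in> sat K" unfolding saturation_def by blast
qed

lemma saturation_killed:
  assumes "ideal K R"
  obtains s where "\<And>x y. x \<in> sat K \<Longrightarrow> y \<in> ideal_pow R \<mm> s \<Longrightarrow> y \<otimes> x \<in> K"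
proof -
  obtain s where s: "sat K = ideal_colon R K (ideal_pow R \<mm> s)" using saturation_eq_colon[OF assms] by blast
  have "y \<otimes> x \<in> K" if "x \<in> sat K" "y \<in> ideal_pow R \<mm> s" for x y
    using that ideal_carr[OF pow_ideal[OF max_ideal]] unfolding s ideal_colon_def by (auto simp: m_comm)
  then show ?thesis using that by blast
qed

lemma saturation_prod:
  assumes "ideal K R" "ideal L R" "x \<in> sat K" "y \<in> sat L" shows "x \<otimes> y \<in> sat (K \<cdot> L)"
proof -
  obtain i j where i: "x \<in> ideal_colon R K (ideal_pow R \<mm> i)" "y \<in> ideal_colon R L (ideal_pow R \<mm> j)"
    using assms unfolding saturation_def by blast
  have KL: "ideal (K \<cdot> L) R" using assms by (intro ideal_prod_is_ideal)
  have c: "x \<in> carrier R" "y \<in> carrier R" using i by (auto simp: ideal_colon_def)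
  have "ideal_pow R \<mm> i \<cdot> ideal_pow R \<mm> j \<subseteq> ideal_colon R (K \<cdot> L) {x \<otimes> y}"
  proof (rule prod_le[OF ideal_colon_ideal[OF KL]])
    fix a b assume ab: "a \<in> ideal_pow R \<mm> i" "b \<in> ideal_pow R \<mm> j"
    have ac: "a \<in> carrier R" "b \<in> carrier R" using ab ideal_carr[OF pow_ideal[OF max_ideal]] by auto
    have "(x \<otimes> a) \<otimes> (y \<otimes> b) \<in> K \<cdot> L" using i ab by (intro ideal_prod.prod) (auto simp: ideal_colon_def)
    then show "a \<otimes> b \<in> ideal_colon R (K \<cdot> L) {x \<otimes> y}" using c ac by (simp add: ideal_colon_def m_ac)
  qed (use c in auto)
  then have "x \<otimes> y \<in> ideal_colon R (K \<cdot> L) (ideal_pow R \<mm> (i + j))"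
    using c ideal_carr[OF pow_ideal[OF max_ideal]]
    unfolding pow_add[OF max_ideal] by (auto simp: ideal_colon_def m_comm)
  then show ?thesis unfolding saturation_def by blast
qed

lemma saturation_pow:
  assumes "ideal K R" shows "ideal_pow R (sat K) n \<subseteq> sat (ideal_pow R K n)"
proof (induction n)
  case 0
  then show ?case using saturation_upper[OF oneideal] by simp
next
  case (Suc n)
  have "ideal_pow R (sat K) n \<cdot> sat K \<subseteq> sat (ideal_pow R K n \<cdot> K)"
    using Suc assms pow_ideal[OF assms]
    by (intro prod_le saturation_ideal ideal_prod_is_ideal saturation_prod) auto
  then show ?case by simp
qed

lemma len_finite:
  assumes "ideal A R" "ideal B R" "B \<subseteq> A" "\<And>x y. x \<in> A \<Longrightarrow> y \<in> ideal_pow R \<mm> s \<Longrightarrow> y \<otimes> x \<in> B"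
  shows "len R A B < \<infinity>"
proof -
  obtain zs where zs: "set zs \<subseteq> carrier R" "A = Idl (set zs)" using ideal_finite_gens[OF assms(1)] .
  have "A <+> B = A" using sum_le[OF assms(1) order_refl assms(3)] sum_upper1[OF assms(1,2)] by blast
  then have "len R A B = len R (Idl (set zs) <+> B) B" using zs by simp
  also have "\<dots> \<le> of_nat (card (set zs)) * len R (carrier R) (ideal_pow R \<mm> s)"
    using assms(4) genideal_self[OF zs(1)] zs
    by (intro len_le_generators assms(2) pow_ideal[OF max_ideal]) auto
  also have "\<dots> < \<infinity>" using len_max_pow_finite[of s] by (auto simp: of_nat_eq_enat)
  finally show ?thesis .
qed

text \<open>A form of Nakayama's lemma that is enough for modules killed by a power of \<open>\<mm>\<close>.\<close>

lemma nakayama_iterate: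
  assumes "ideal A R" "ideal D R" "D \<subseteq> A" "A \<subseteq> D <+> \<mm> \<cdot> A"
  shows "A \<subseteq> D <+> ideal_pow R \<mm> k \<cdot> A"
proof (induction k)
  case 0
  have "carrier R \<cdot> A = A" using ideal_prod_commute[OF oneideal assms(1)] ideal_prod_one[OF assms(1)] by simp
  then show ?case using sum_upper2[OF assms(2,1)] by simp
next
  case (Suc k)
  let ?P = "ideal_pow R \<mm> k"
  note P = pow_ideal[OF max_ideal, of k]
  have PmA: "ideal (?P \<cdot> (\<mm> \<cdot> A)) R" and D': "ideal (D <+> ?P \<cdot> (\<mm> \<cdot> A)) R"
    using assms P max_ideal by (auto intro!: ideal_prod_is_ideal add_ideals)
  have "?P \<cdot> A \<subseteq> ?P \<cdot> (D <+> \<mm> \<cdot> A)"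
    using assms P max_ideal by (intro prod_mono add_ideals ideal_prod_is_ideal) auto
  also have "\<dots> = ?P \<cdot> D <+> ?P \<cdot> (\<mm> \<cdot> A)"
    using assms P max_ideal by (intro ideal_prod_distr ideal_prod_is_ideal) auto
  also have "\<dots> \<subseteq> D <+> ?P \<cdot> (\<mm> \<cdot> A)"
    using ideal_prod_inter[OF P assms(2)] by (intro add_ideals_mono) auto
  finally have "D <+> ?P \<cdot> A \<subseteq> D <+> ?P \<cdot> (\<mm> \<cdot> A)"
    using sum_upper1[OF assms(2) PmA] by (intro sum_le D')
  then have "A \<subseteq> D <+> ?P \<cdot> (\<mm> \<cdot> A)" using Suc by blast
  then show ?case using ideal_prod_assoc[OF P max_ideal assms(1)] by simp
qed

text \<open>Modulo \<open>I^(j+1)\<close>, this is the degree \<open>j\<close> part of the elements of the associated graded ring of \<open>I\<close> that are killed by a power of \<open>\<mm>\<close>.\<close>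

definition satdiff :: "'a set \<Rightarrow> nat \<Rightarrow> 'a set"
  where "satdiff I j = ideal_pow R I j \<inter> sat (ideal_pow R I (Suc j))"

lemma satdiff_ideal: "ideal I R \<Longrightarrow> ideal (satdiff I j) R"
  unfolding satdiff_def by (intro i_intersect pow_ideal saturation_ideal)

lemma satdiff_ge: "ideal I R \<Longrightarrow> ideal_pow R I (Suc j) \<subseteq> satdiff I j"
  unfolding satdiff_def using pow_anti[of I j "Suc j"] saturation_upper[OF pow_ideal[of I "Suc j"]] by auto

lemma satdiff_len_finite: "ideal I R \<Longrightarrow> len R (satdiff I j) (ideal_pow R I (Suc j)) < \<infinity>"
proof -
  assume I: "ideal I R"
  show ?thesis
  proof (rule saturation_killed[OF pow_ideal[OF I, of "Suc j"]])
    fix s assume s: "\<And>x y. x \<in> sat (ideal_pow R I (Suc j)) \<Longrightarrow> y \<in> ideal_pow R \<mm> s \<Longrightarrow> y \<otimes> x \<in> ideal_pow R I (Suc j)"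
    show ?thesis
    proof (rule len_finite[OF satdiff_ideal[OF I] pow_ideal[OF I] satdiff_ge[OF I]])
      fix x y assume "x \<in> satdiff I j" "y \<in> ideal_pow R \<mm> s"
      then show "y \<otimes> x \<in> ideal_pow R I (Suc j)" using s[of x y] unfolding satdiff_def by blast
    qed
  qed
qed

text \<open>From some degree \<open>j1\<close> on, \<open>satdiff\<close> is generated in degree \<open>j1\<close>: \<open>satdiff I (j1 + i) \<subseteq> I^i \<cdot> satdiff I j1\<close>. Modulo the
next power of \<open>I\<close>, the right-hand side is killed by the power of \<open>\<mm>\<close> that kills \<open>satdiff I j1\<close>, and its number of
generators is at most a constant times that of \<open>I^i\<close>.\<close>

theorem satdiff_len_bound:
  assumes I: "ideal I R" "I \<subseteq> \<mm>" and dim: "krull_dim R = enat d"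
  shows "\<exists>C j0. \<forall>j\<ge>j0. len R (satdiff I j) (ideal_pow R I (Suc j)) \<le> enat (C * d * (j + 1) ^ (d - 1))"
proof -
  let ?P = "ideal_pow R I"
  note P = pow_ideal[OF I(1)]
  obtain zs where zs: "set zs \<subseteq> carrier R" "I = Idl (set zs)" using ideal_finite_gens[OF I(1)] .
  have sub: "satdiff I n \<subseteq> ?P n" for n by (simp add: satdiff_def)
  have QG: "q \<otimes> g \<in> satdiff I (Suc n)" if q: "q \<in> I" and g: "g \<in> satdiff I n" for q g n
  proof -
    have q1: "q \<in> ?P 1" using pow_1[OF I(1)] q unfolding One_nat_def by (simp only:)
    have c: "q \<in> carrier R" "g \<in> carrier R" using q g ideal_carr[OF I(1)] ideal_carr[OF P] by (auto simp: satdiff_def)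
    have "q \<otimes> g \<in> ?P (1 + n)" using g by (intro pow_mult_mem[OF I(1) q1]) (simp add: satdiff_def)
    moreover have "q \<otimes> g \<in> sat (?P 1 \<cdot> ?P (Suc n))"
      using g saturation_upper[OF P, of 1] q1 by (intro saturation_prod P) (auto simp: satdiff_def simp del: nat_pow_Suc)
    then have "q \<otimes> g \<in> sat (?P (1 + Suc n))" unfolding pow_add[OF I(1)] .
    ultimately show ?thesis unfolding satdiff_def by (simp only: plus_1_eq_Suc Int_iff)
  qed
  obtain j1 where j1: "\<And>n. n \<ge> j1 \<Longrightarrow> satdiff I (Suc n) \<subseteq> I \<cdot> satdiff I n"
    using graded_ideals_finitely_generated[OF zs satdiff_ideal[OF I(1)] sub QG] by blast
  let ?U = "satdiff I j1"
  note U = satdiff_ideal[OF I(1), of j1]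
  have gen: "satdiff I (j1 + i) \<subseteq> ?P i \<cdot> ?U" for i
  proof (induction i)
    case 0
    then show ?case using ideal_prod_commute[OF oneideal U] ideal_prod_one[OF U] by simp
  next
    case (Suc i)
    have "satdiff I (Suc (j1 + i)) \<subseteq> I \<cdot> satdiff I (j1 + i)" by (rule j1) simp
    also have "\<dots> \<subseteq> I \<cdot> (?P i \<cdot> ?U)" using Suc I(1) P U by (intro prod_mono ideal_prod_is_ideal) auto
    also have "\<dots> = ?P (Suc i) \<cdot> ?U"
      using ideal_prod_assoc[OF I(1) P U, of i] ideal_prod_commute[OF I(1) P, of i] by simp
    finally show ?case by simp
  qed
  obtain vs where vs: "set vs \<subseteq> carrier R" "?U = Idl (set vs)" using ideal_finite_gens[OF U] .
  obtain s where s: "\<And>x y. x \<in> ?U \<Longrightarrow> y \<in> ideal_pow R \<mm> s \<Longrightarrow> y \<otimes> x \<in> ?P (Suc j1)"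
  proof (rule saturation_killed[OF P, of "Suc j1"])
    fix s assume s: "\<And>x y. x \<in> sat (?P (Suc j1)) \<Longrightarrow> y \<in> ideal_pow R \<mm> s \<Longrightarrow> y \<otimes> x \<in> ?P (Suc j1)"
    show thesis by (rule that[of s]) (use s in \<open>simp add: satdiff_def\<close>)
  qed
  obtain w where w: "len R (carrier R) (ideal_pow R \<mm> s) = enat w"
    using len_max_pow_finite[of s] by auto
  obtain C0 n0 where C0: "\<And>n. \<exists>G. finite G \<and> G \<subseteq> ?P n \<and> ?P n \<subseteq> Idl G <+> \<mm> \<cdot> ?P n \<and>
      (n \<ge> n0 \<longrightarrow> card G \<le> C0 * d * (n + 1) ^ (d - 1))"
    using few_generators_of_powers[OF I dim] by blast
  define C where "C = C0 * card (set vs) * w"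
  show ?thesis
  proof (rule exI[of _ C], rule exI[of _ "j1 + n0"], intro allI impI)
    fix j assume j: "j1 + n0 \<le> j"
    define i where "i = j - j1"
    have ij: "j = j1 + i" "n0 \<le> i" using j by (auto simp: i_def)
    obtain G where G: "finite G" "G \<subseteq> ?P i" "?P i \<subseteq> Idl G <+> \<mm> \<cdot> ?P i" "card G \<le> C0 * d * (i + 1) ^ (d - 1)"
      using C0[of i] ij(2) by blast
    let ?A = "?P i \<cdot> ?U" and ?B = "?P (Suc j)"
    define GV where "GV = (\<lambda>(g, v). g \<otimes> v) ` (G \<times> set vs)"
    have Gc: "G \<subseteq> carrier R" using G(2) ideal_sub[OF P] by blast
    have GVc: "GV \<subseteq> carrier R" using Gc vs(1) by (auto simp: GV_def)
    have IG: "ideal (Idl G) R" "ideal (Idl GV) R" using Gc GVc genideal_ideal by auto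
    have A: "ideal ?A R" using P U by (rule ideal_prod_is_ideal)
    have mA: "ideal (\<mm> \<cdot> ?A) R" using max_ideal A by (rule ideal_prod_is_ideal)
    have D: "ideal (Idl GV <+> \<mm> \<cdot> ?A) R" using IG mA add_ideals by blast
    have vU: "v \<in> ?U" if "v \<in> set vs" for v using that vs genideal_self by blast
    have "GV \<subseteq> ?A" using G(2) vU by (auto simp: GV_def intro!: ideal_prod.prod)
    then have GVA: "Idl GV \<subseteq> ?A" by (rule genideal_le[OF A])
    have "?A \<subseteq> Idl GV <+> \<mm> \<cdot> ?A"
    proof (rule prod_le[OF D])
      fix p u assume pu: "p \<in> ?P i" "u \<in> ?U"
      then obtain a b where ab: "a \<in> Idl G" "b \<in> \<mm> \<cdot> ?P i" "p = a \<oplus> b" using G(3) unfolding subset_iff mem_sum by blast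
      have c: "a \<in> carrier R" "b \<in> carrier R" "u \<in> carrier R"
        using ab pu ideal_carr[OF IG(1)] ideal_carr[OF ideal_prod_is_ideal[OF max_ideal P]] ideal_carr[OF U] by auto
      have "a \<otimes> u \<in> Idl GV"
      proof (rule genideal_mult_genideal_le[OF IG(2) Gc vs(1) _ ab(1)])
        show "u \<in> Idl (set vs)" using pu(2) vs(2) by simp
        show "x \<otimes> y \<in> Idl GV" if "x \<in> G" "y \<in> set vs" for x y
          using that by (intro genideal_mem[OF GVc]) (auto simp: GV_def)
      qed
      moreover have "b \<otimes> u \<in> (\<mm> \<cdot> ?P i) \<cdot> ?U" using ab pu by (intro ideal_prod.prod)
      then have "b \<otimes> u \<in> \<mm> \<cdot> ?A" using ideal_prod_assoc[OF max_ideal P U] by simp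
      ultimately show "p \<otimes> u \<in> Idl GV <+> \<mm> \<cdot> ?A" unfolding ab(3) using c by (simp add: l_distr sum_memI)
    qed
    then have it: "?A \<subseteq> Idl GV <+> ideal_pow R \<mm> s \<cdot> ?A" by (rule nakayama_iterate[OF A IG(2) GVA])
    have PU: "x \<otimes> y \<in> ?B" if "x \<in> ?P i" "y \<in> ?P (Suc j1)" for x y
      using pow_mult_mem[OF I(1) that] ij(1) by (simp only: add_Suc_right add.commute)
    note ms = pow_ideal[OF max_ideal, of s]
    have "ideal_pow R \<mm> s \<cdot> ?A \<subseteq> ?B"
    proof -
      have "ideal_pow R \<mm> s \<cdot> ?A = ?P i \<cdot> (ideal_pow R \<mm> s \<cdot> ?U)"
        using ideal_prod_assoc[OF ms P U, of i] ideal_prod_assoc[OF P ms U, of i] ideal_prod_commute[OF ms P, of i] by simp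
      moreover have "ideal_pow R \<mm> s \<cdot> ?U \<subseteq> ?P (Suc j1)" using s by (intro prod_le P)
      then have "?P i \<cdot> (ideal_pow R \<mm> s \<cdot> ?U) \<subseteq> ?B" using PU by (intro prod_le[OF P]) blast
      ultimately show ?thesis by simp
    qed
    then have "Idl GV <+> ideal_pow R \<mm> s \<cdot> ?A \<subseteq> Idl GV <+> ?B" by (intro add_ideals_mono order_refl)
    then have "satdiff I j \<subseteq> Idl GV <+> ?B" using gen[of i] ij(1) it by blast
    then have "len R (satdiff I j) ?B \<le> len R (Idl GV <+> ?B) ?B"
      using satdiff_ideal[OF I(1)] satdiff_ge[OF I(1)] P[of "Suc j"] add_ideals[OF IG(2) P] by (intro len_mono) blast+
    also have "\<dots> \<le> of_nat (card GV) * len R (carrier R) (ideal_pow R \<mm> s)"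
    proof (rule len_le_generators[OF _ GVc P ms])
      show "finite GV" using G(1) by (simp add: GV_def)
      fix x c assume "x \<in> GV" and c: "c \<in> ideal_pow R \<mm> s"
      then obtain g v where gv: "g \<in> G" "v \<in> set vs" "x = g \<otimes> v" by (auto simp: GV_def)
      have cc: "g \<in> carrier R" "v \<in> carrier R" "c \<in> carrier R" using gv Gc vs(1) c ideal_carr[OF ms] by auto
      have "g \<otimes> (c \<otimes> v) \<in> ?B" using PU[of g "c \<otimes> v"] G(2) gv s[OF vU[OF gv(2)] c] by blast
      then show "c \<otimes> x \<in> ?B" unfolding gv(3) using cc by (simp add: m_lcomm)
    qed
    also have "\<dots> = enat (card GV * w)" by (simp add: w of_nat_eq_enat)
    also have "card GV \<le> card G * card (set vs)"
      unfolding GV_def using card_image_le[of "G \<times> set vs" "\<lambda>(g, v). g \<otimes> v"] G(1) by (simp add: card_cartesian_product)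
    also have "\<dots> \<le> (C0 * d * (j + 1) ^ (d - 1)) * card (set vs)"
    proof (rule mult_right_mono)
      have "(i + 1) ^ (d - 1) \<le> (j + 1) ^ (d - 1)" using ij(1) by (intro power_mono) auto
      then show "card G \<le> C0 * d * (j + 1) ^ (d - 1)" using G(4) by (meson mult_le_mono2 order_trans)
    qed simp
    finally show "len R (satdiff I j) ?B \<le> enat (C * d * (j + 1) ^ (d - 1))"
      by (simp add: C_def mult_ac)
  qed
qed

text \<open>Intersecting the saturation of \<open>I^B\<close> with the powers from \<open>I^A\<close> to \<open>I^B\<close> gives a filtration whose \<open>j\<close>-th quotient embeds into
\<open>satdiff I j\<close> modulo \<open>I^(j+1)\<close>.\<close>

lemma satdiff_filtration:
  assumes I: "ideal I R" and "A \<le> B"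
  shows "len R (ideal_pow R I A \<inter> sat (ideal_pow R I B)) (ideal_pow R I B)
    \<le> (\<Sum>j\<in>{A..<B}. len R (satdiff I j) (ideal_pow R I (Suc j)))"
  using assms(2)
proof (induction rule: inc_induct)
  case base
  have "ideal_pow R I B \<inter> sat (ideal_pow R I B) = ideal_pow R I B"
    using saturation_upper[OF pow_ideal[OF I]] by blast
  then show ?case using pow_ideal[OF I] by simp
next
  case (step A)
  let ?P = "ideal_pow R I"
  note P = pow_ideal[OF I]
  let ?J = "sat (?P B)"
  have J: "ideal ?J R" using P by (rule saturation_ideal)
  let ?X = "?P A \<inter> ?J" and ?Y = "?P (Suc A) \<inter> ?J"
  have "Suc A \<le> B" using step.hyps by simp
  then have anti: "?P (Suc A) \<subseteq> ?P A" "?P B \<subseteq> ?P (Suc A)"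
    using pow_anti[OF I, of A "Suc A"] pow_anti[OF I, of "Suc A" B] by (simp_all only: le_SucI order_refl)
  have X: "ideal ?X R" "ideal ?Y R" "?Y \<subseteq> ?X" "?P B \<subseteq> ?Y"
    using i_intersect[OF P J] anti saturation_upper[OF P, of B] by blast+
  have "len R ?X ?Y = len R ?X (?X \<inter> ?P (Suc A))"
    using X(3) by (intro arg_cong[where f = "len R ?X"]) blast
  also have "\<dots> = len R (?X <+> ?P (Suc A)) (?P (Suc A))" by (rule len_second_iso[OF X(1) P, symmetric])
  also have "\<dots> \<le> len R (satdiff I A) (?P (Suc A))"
  proof (rule len_mono)
    have "?J \<subseteq> sat (?P (Suc A))" using pow_anti[OF I, of "Suc A" B] step.hyps by (intro saturation_mono) auto
    then show "?X <+> ?P (Suc A) \<subseteq> satdiff I A"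
      using satdiff_ge[OF I, of A] by (intro sum_le satdiff_ideal[OF I]) (auto simp: satdiff_def simp del: nat_pow_Suc)
    show "?P (Suc A) \<subseteq> ?X <+> ?P (Suc A)" using sum_upper2[OF X(1) P] .
  qed (use P X add_ideals satdiff_ideal[OF I] in blast)+
  finally have 1: "len R ?X ?Y \<le> len R (satdiff I A) (?P (Suc A))" .
  have "len R ?X (?P B) = len R ?X ?Y + len R ?Y (?P B)" using X P by (intro len_add) blast+
  also have "\<dots> \<le> len R (satdiff I A) (?P (Suc A)) + (\<Sum>j\<in>{Suc A..<B}. len R (satdiff I j) (?P (Suc j)))"
    using 1 step.IH by (intro add_mono)
  also have "\<dots> = (\<Sum>j\<in>{A..<B}. len R (satdiff I j) (?P (Suc j)))"
    using step.hyps by (simp only: sum.atLeast_Suc_lessThan)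
  finally show ?case .
qed

end

section \<open>The length of a quotient module\<close>

lemma ideal_chain_imp_fun:
  "ideal_chain R n A B \<Longrightarrow>
    \<exists>N. (\<forall>i\<le>n. ideal (N i) R \<and> B \<subseteq> N i \<and> N i \<subseteq> A) \<and> (\<forall>i<n. N i \<subset> N (Suc i))"
proof (induction rule: ideal_chain.induct)
  case (base A B)
  then show ?case by (intro exI[of _ "\<lambda>_. A"]) auto
next
  case (step n A B' B)
  then obtain N where N: "\<And>i. i \<le> n \<Longrightarrow> ideal (N i) R \<and> B' \<subseteq> N i \<and> N i \<subseteq> A" "\<And>i. i < n \<Longrightarrow> N i \<subset> N (Suc i)"
    by blast
  define M where "M i = (case i of 0 \<Rightarrow> B | Suc j \<Rightarrow> N j)" for i
  have B: "B \<subset> B'" "B' \<subseteq> A" using step.hyps(3) ideal_chainD[OF step.hyps(1)] by auto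
  have "ideal (M i) R \<and> B \<subseteq> M i \<and> M i \<subseteq> A" if "i \<le> Suc n" for i
  proof (cases i)
    case 0
    then show ?thesis using B step.hyps(2) by (auto simp: M_def)
  next
    case (Suc j)
    then show ?thesis using N(1)[of j] that B by (auto simp: M_def)
  qed
  moreover have "M i \<subset> M (Suc i)" if "i < Suc n" for i
  proof (cases i)
    case 0
    then show ?thesis using N(1)[of 0] B by (auto simp: M_def)
  next
    case (Suc j)
    then show ?thesis using N(2)[of j] that by (auto simp: M_def)
  qed
  ultimately show ?case by blast
qed

lemma fun_imp_ideal_chain:
  assumes N: "\<And>i. i \<le> n \<Longrightarrow> ideal (N i) R \<and> B \<subseteq> N i \<and> N i \<subseteq> A" "\<And>i. i < n \<Longrightarrow> N i \<subset> N (Suc i)"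
    and A: "ideal A R" and B: "ideal B R"
  shows "ideal_chain R n A B"
proof -
  have "ideal_chain R k A (N (n - k))" if "k \<le> n" for k
    using that
  proof (induction k)
    case 0
    then show ?case using N(1)[of n] A by (auto intro: ideal_chain.base)
  next
    case (Suc k)
    have eq: "Suc (n - Suc k) = n - k" using Suc.prems by simp
    have "ideal_chain R k A (N (Suc (n - Suc k)))" using Suc unfolding eq by simp
    then show ?case using N(1)[of "n - Suc k"] N(2)[of "n - Suc k"] Suc.prems
      by (intro ideal_chain.step) auto
  qed
  from this[of n] show ?thesis using N(1)[of 0] B by (auto intro: ideal_chain_bottom)
qed

context cring
begin

lemma coset_eq_iff:
  "ideal K R \<Longrightarrow> x \<in> carrier R \<Longrightarrow> y \<in> carrier R \<Longrightarrow> K +> x = K +> y \<longleftrightarrow> x \<ominus> y \<in> K"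
  using quotient_eq_iff_same_a_r_cos by blast

lemma submodule_of_ideal:
  assumes J: "ideal J R" and K: "ideal K R" and N: "ideal N R" "N \<subseteq> J"
  shows "submodule ((\<lambda>x. K +> x) ` N) R (quot_module R J K)"
proof -
  let ?M = "quot_module R J K"
  interpret M: module R ?M using quot_module_module[OF is_cring J K] .
  note s = quot_module_simps[OF K]
  have Nc: "x \<in> carrier R" if "x \<in> N" for x using that ideal_carr[OF N(1)] by blast
  have carr: "(\<lambda>x. K +> x) ` N \<subseteq> carrier ?M" using N(2) by (auto simp: s)
  have sm: "a \<odot>\<^bsub>?M\<^esub> x \<in> (\<lambda>x. K +> x) ` N" if "a \<in> carrier R" "x \<in> (\<lambda>x. K +> x) ` N" for a x
    using that ideal_mult[OF N(1)] Nc by (auto simp: s)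
  show ?thesis
  proof (rule M.submoduleI[OF carr _ _ _ sm])
    show "\<zero>\<^bsub>?M\<^esub> \<in> (\<lambda>x. K +> x) ` N" using ideal_zero[OF N(1)] by (auto simp: s)
    show "a \<oplus>\<^bsub>?M\<^esub> b \<in> (\<lambda>x. K +> x) ` N" if "a \<in> (\<lambda>x. K +> x) ` N" "b \<in> (\<lambda>x. K +> x) ` N" for a b
      using that ideal_add[OF N(1)] Nc by (auto simp: s)
    show "\<ominus>\<^bsub>?M\<^esub> a \<in> (\<lambda>x. K +> x) ` N" if a: "a \<in> (\<lambda>x. K +> x) ` N" for a
    proof -
      have "a \<in> carrier ?M" using a carr by blast
      then have "\<ominus>\<^bsub>?M\<^esub> a = (\<ominus> \<one>) \<odot>\<^bsub>?M\<^esub> a" by (simp add: M.smult_l_minus)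
      then show ?thesis using sm[OF _ a] by simp
    qed
  qed
qed

lemma ideal_of_submodule:
  assumes J: "ideal J R" and K: "ideal K R" "K \<subseteq> J" and N: "submodule N R (quot_module R J K)"
  shows "ideal {x \<in> J. K +> x \<in> N} R" "K \<subseteq> {x \<in> J. K +> x \<in> N}"
    "N = (\<lambda>x. K +> x) ` {x \<in> J. K +> x \<in> N}"
proof -
  let ?M = "quot_module R J K" and ?I = "{x \<in> J. K +> x \<in> N}"
  interpret M: module R ?M using quot_module_module[OF is_cring J K(1)] .
  note s = quot_module_simps[OF K(1)]
  interpret N: submodule N R ?M by fact
  have Jc: "x \<in> carrier R" if "x \<in> J" for x using that ideal_carr[OF J] by blast
  have mul: "a \<otimes> x \<in> ?I" if "x \<in> ?I" "a \<in> carrier R" for a x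
    using that N.smult_closed[of a "K +> x"] ideal_mult[OF J] Jc by (auto simp: s)
  have K0: "K +> x = \<zero>\<^bsub>?M\<^esub>" if "x \<in> K" for x
    using that ideal_carr[OF K(1)] coset_eq_iff[OF K(1), of x \<zero>] by (simp add: s minus_eq)
  have zero: "\<zero>\<^bsub>?M\<^esub> \<in> N" using N.one_closed by simp
  show sub: "K \<subseteq> ?I" using K(2) K0 zero by auto
  show "ideal ?I R"
  proof (rule idealI[OF ring_axioms])
    show "a \<otimes> x \<in> ?I" if "x \<in> ?I" "a \<in> carrier R" for a x using mul that .
    then show "x \<otimes> a \<in> ?I" if "x \<in> ?I" "a \<in> carrier R" for a x
      using that Jc m_comm[of x a] by fastforce
    show "subgroup ?I (add_monoid R)"
    proof (rule add.subgroupI)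
      show "?I \<subseteq> carrier R" using Jc by auto
      show "?I \<noteq> {}" using sub ideal_zero[OF K(1)] by blast
      show "\<ominus> x \<in> ?I" if "x \<in> ?I" for x
      proof -
        have "\<ominus> x = (\<ominus> \<one>) \<otimes> x" using that Jc by (simp add: l_minus)
        then show ?thesis using mul[OF that, of "\<ominus> \<one>"] by simp
      qed
      show "x \<oplus> y \<in> ?I" if "x \<in> ?I" "y \<in> ?I" for x y
        using that N.m_closed[of "K +> x" "K +> y"] ideal_add[OF J] Jc by (auto simp: s)
    qed
  qed
  have "N \<subseteq> carrier ?M" using N.subset by simp
  then show "N = (\<lambda>x. K +> x) ` ?I" by (auto simp: s)
qed

theorem module_length_quot_module:
  assumes J: "ideal J R" and K: "ideal K R" "K \<subseteq> J"
  shows "module_length R (quot_module R J K) = len R J K"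
proof -
  let ?M = "quot_module R J K" and ?q = "\<lambda>x. K +> x"
  have "(\<exists>N :: nat \<Rightarrow> 'a set set. (\<forall>i\<le>n. submodule (N i) R ?M) \<and> (\<forall>i<n. N i \<subset> N (Suc i)))
      \<longleftrightarrow> ideal_chain R n J K" for n
  proof
    assume "\<exists>N :: nat \<Rightarrow> 'a set set. (\<forall>i\<le>n. submodule (N i) R ?M) \<and> (\<forall>i<n. N i \<subset> N (Suc i))"
    then obtain N :: "nat \<Rightarrow> 'a set set" where N: "\<And>i. i \<le> n \<Longrightarrow> submodule (N i) R ?M" "\<And>i. i < n \<Longrightarrow> N i \<subset> N (Suc i)"
      by blast
    show "ideal_chain R n J K"
    proof (rule fun_imp_ideal_chain[where N = "\<lambda>i. {x \<in> J. ?q x \<in> N i}", OF _ _ J K(1)])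
      fix i assume "i \<le> n"
      then show "ideal {x \<in> J. ?q x \<in> N i} R \<and> K \<subseteq> {x \<in> J. ?q x \<in> N i} \<and> {x \<in> J. ?q x \<in> N i} \<subseteq> J"
        using ideal_of_submodule(1,2)[OF J K N(1)] by blast
    next
      fix i assume i: "i < n"
      have "N i = ?q ` {x \<in> J. ?q x \<in> N i}" "N (Suc i) = ?q ` {x \<in> J. ?q x \<in> N (Suc i)}"
        using ideal_of_submodule(3)[OF J K N(1)] i by auto
      then have "{x \<in> J. ?q x \<in> N i} \<noteq> {x \<in> J. ?q x \<in> N (Suc i)}" using N(2)[OF i] by (metis psubset_eq)
      then show "{x \<in> J. ?q x \<in> N i} \<subset> {x \<in> J. ?q x \<in> N (Suc i)}" using N(2)[OF i] by blast
    qed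
  next
    assume "ideal_chain R n J K"
    then obtain N where N: "(\<forall>i\<le>n. ideal (N i) R \<and> K \<subseteq> N i \<and> N i \<subseteq> J) \<and> (\<forall>i<n. N i \<subset> N (Suc i))"
      by (rule exE[OF ideal_chain_imp_fun])
    have N: "\<And>i. i \<le> n \<Longrightarrow> ideal (N i) R \<and> K \<subseteq> N i \<and> N i \<subseteq> J" "\<And>i. i < n \<Longrightarrow> N i \<subset> N (Suc i)"
      using N by simp_all
    have "?q ` N i \<subset> ?q ` N (Suc i)" if i: "i < n" for i
    proof -
      obtain x where x: "x \<in> N (Suc i)" "x \<notin> N i" using N(2)[OF i] by auto
      have ids: "ideal (N i) R" "K \<subseteq> N i" "ideal (N (Suc i)) R" using N(1)[of i] N(1)[of "Suc i"] i by auto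
      have "?q x \<notin> ?q ` N i"
      proof
        assume "?q x \<in> ?q ` N i"
        then obtain y where y: "y \<in> N i" "?q x = ?q y" by blast
        have c: "x \<in> carrier R" "y \<in> carrier R" using x y ids ideal_carr by blast+
        then have "x \<ominus> y \<in> N i" using y(2) coset_eq_iff[OF K(1)] ids(2) by blast
        then have "(x \<ominus> y) \<oplus> y \<in> N i" using y(1) ideal_add[OF ids(1)] by blast
        moreover have "(x \<ominus> y) \<oplus> y = x" using c by algebra
        ultimately show False using x by simp
      qed
      then show ?thesis using N(2)[OF i] x by blast
    qed
    moreover have "submodule (?q ` N i) R ?M" if "i \<le> n" for i
      using N(1)[OF that] by (intro submodule_of_ideal J K) auto
    ultimately show "\<exists>N :: nat \<Rightarrow> 'a set set. (\<forall>i\<le>n. submodule (N i) R ?M) \<and> (\<forall>i<n. N i \<subset> N (Suc i))"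
      by (intro exI[of _ "\<lambda>i. ?q ` N i"]) blast
  qed
  then show ?thesis unfolding module_length_def len_def by (simp add: image_Collect)
qed

end

section \<open>The lengths of quotients of powers\<close>

lemma llt_zero_prefix:
  "take r \<alpha> \<noteq> replicate r 0 \<Longrightarrow> length \<alpha> = r + length \<beta> \<Longrightarrow> llt (replicate r 0 @ \<beta>) \<alpha>"
proof (induction r arbitrary: \<alpha>)
  case (Suc r)
  then show ?case by (cases \<alpha>) auto
qed simp

lemma llt_move:
  "i < k \<Longrightarrow> k < length \<alpha> \<Longrightarrow> \<alpha> ! i > 0 \<Longrightarrow> llt ((\<alpha>[i := \<alpha> ! i - 1])[k := Suc (\<alpha> ! k)]) \<alpha>"
proof (induction \<alpha> arbitrary: i k)
  case (Cons a \<alpha>)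
  obtain k' where k: "k = Suc k'" using Cons.prems by (cases k) auto
  then show ?case using Cons by (cases i) auto
qed simp

lemma zero_prefix_mono:
  "ple \<alpha> \<beta> \<Longrightarrow> take r \<beta> = replicate r 0 \<Longrightarrow> take r \<alpha> = replicate r 0"
proof (induction r arbitrary: \<alpha> \<beta>)
  case (Suc r)
  then obtain b \<beta>' where "\<beta> = b # \<beta>'" by (cases \<beta>) auto
  then show ?case using Suc by (auto simp: list_all2_Cons2)
qed simp

lemma sum_enat: "(\<Sum>x\<in>A. enat (f x)) = enat (\<Sum>x\<in>A. f x)"
  by (simp flip: of_nat_eq_enat)

lemma (in cring) pprod_append:
  assumes "set xs \<subseteq> carrier R" "set ys \<subseteq> carrier R" "length \<alpha> = length xs"
  shows "pprod R (xs @ ys) (\<alpha> @ \<beta>) = pprod R xs \<alpha> \<otimes> pprod R ys \<beta>"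
  using assms(1,3)
proof (induction xs arbitrary: \<alpha>)
  case Nil
  then show ?case using pprod_closed[OF assms(2)] by simp
next
  case (Cons x xs)
  then obtain a \<alpha>' where "\<alpha> = a # \<alpha>'" "length \<alpha>' = length xs" by (cases \<alpha>) auto
  then show ?case using Cons pprod_closed[OF assms(2)] by (simp add: m_assoc)
qed

context noetherian_local
begin

text \<open>The empty set is added as a value below all ideals, to mark the monomials that do not contribute to a length.\<close>

lemma acc_ideals_empty: "acc ({I. ideal I R} \<union> {{}})"
  unfolding acc_def
proof (intro allI impI)
  fix s :: "nat \<Rightarrow> 'a set" assume s: "range s \<subseteq> {I. ideal I R} \<union> {{}}" "mono s"
  show "\<exists>k. \<forall>n\<ge>k. s n = s k"
  proof (cases "\<exists>k. s k \<noteq> {}")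
    case True
    then obtain k where k: "s k \<noteq> {}" by blast
    have "s (n + k) \<noteq> {}" for n using monoD[OF s(2), of k "n + k"] k by auto
    then have "range (\<lambda>n. s (n + k)) \<subseteq> {I. ideal I R}" using s(1) by blast
    moreover have "mono (\<lambda>n. s (n + k))" using s(2) by (auto simp: mono_def)
    ultimately obtain l where l: "\<And>n. n \<ge> l \<Longrightarrow> s (n + k) = s (l + k)" using acc_ideals unfolding acc_def by blast
    have "s n = s (l + k)" if "n \<ge> l + k" for n using l[of "n - k"] that by simp
    then show ?thesis by blast
  qed auto
qed

text \<open>List the generators of \<open>J\<close> before those of \<open>K\<close>. The monomials in the generators of \<open>K\<close> alone, called pure, span \<open>K^m\<close>
and are lexicographically smaller than all others. Adding the other monomials of degree \<open>m\<close> to \<open>K^m\<close> in increasing order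
filters \<open>J^m / K^m\<close> by cyclic modules \<open>R / col \<alpha>\<close>, where \<open>col \<alpha>\<close> consists of the \<open>r\<close> for which \<open>r\<close> times
the monomial is a combination of smaller ones. As \<open>col\<close> is monotone, the length of \<open>R / col \<alpha>\<close> is constant on the boxes of a finite
partition. It is finite: multiplying by an element of \<open>\<mm>^s\<close> moves a factor from \<open>J\<close> into \<open>K\<close>, which makes
the monomials smaller.\<close>

theorem pow_quotient_len_eq_sum:
  assumes J: "ideal J R" and K: "ideal K R" "K \<subseteq> J"
    and kill: "\<And>x y. x \<in> J \<Longrightarrow> y \<in> ideal_pow R \<mm> s \<Longrightarrow> y \<otimes> x \<in> K"
  shows "\<exists>\<B> w. finite \<B> \<and>
    (\<forall>m. len R (ideal_pow R J m) (ideal_pow R K m) = enat (\<Sum>S\<in>\<B>. w S * cnt S m))"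
proof -
  obtain xs where xs: "set xs \<subseteq> carrier R" "J = Idl (set xs)" using ideal_finite_gens[OF J] .
  obtain ys where ys: "set ys \<subseteq> carrier R" "K = Idl (set ys)" using ideal_finite_gens[OF K(1)] .
  define zs where "zs = xs @ ys"
  let ?r = "length xs" and ?n = "length zs" and ?p = "pprod R zs"
  have zs: "set zs \<subseteq> carrier R" using xs ys by (auto simp: zs_def)
  have xsJ: "set xs \<subseteq> J" and ysK: "set ys \<subseteq> K" using xs ys genideal_self by auto
  have Jzs: "J = Idl (set zs)"
  proof
    show "J \<subseteq> Idl (set zs)" unfolding xs(2) using zs by (intro genideal_sub_mono) (auto simp: zs_def)
    show "Idl (set zs) \<subseteq> J" using xsJ ysK K(2) by (intro genideal_le[OF J]) (auto simp: zs_def)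
  qed
  define pure where "pure \<alpha> \<longleftrightarrow> take ?r \<alpha> = replicate ?r 0" for \<alpha> :: "nat list"
  define low where "low \<alpha> = Idl (?p ` lower llt \<alpha>)" for \<alpha>
  have sp: "ideal (Idl (?p ` T)) R" for T using zs by (intro genideal_ideal pprod_in_carr_sub)
  have low: "ideal (low \<alpha>) R" for \<alpha> unfolding low_def by (rule sp)
  have spin: "?p \<alpha> \<in> Idl (?p ` T)" if "\<alpha> \<in> T" for \<alpha> T using that zs by (intro genideal_mem pprod_in_carr_sub) auto
  have pc: "?p \<alpha> \<in> carrier R" for \<alpha> using zs by simp
  define col where "col \<alpha> = ideal_colon R (low \<alpha>) {?p \<alpha>}" for \<alpha>
  have col: "ideal (col \<alpha>) R" for \<alpha> unfolding col_def using low pc by (intro ideal_colon_ideal) auto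
  define c where "c \<alpha> = (if pure \<alpha> then {} else col \<alpha>)" for \<alpha>
  have c_empty: "c \<alpha> = {} \<longleftrightarrow> pure \<alpha>" for \<alpha> using ideal_zero[OF col[of \<alpha>]] by (auto simp: c_def)
  have "\<exists>\<B>. partitions ?n \<B> \<and> (\<forall>S\<in>\<B>. \<forall>\<alpha>. fits S \<alpha> \<longrightarrow> c \<alpha> = c (map fst S))"
  proof (rule monotone_decomp[OF acc_ideals_empty])
    show "c \<alpha> \<in> {I. ideal I R} \<union> {{}}" for \<alpha> using col by (auto simp: c_def)
    fix \<alpha> \<beta> assume \<alpha>: "length \<alpha> = ?n" "ple \<alpha> \<beta>"
    then obtain \<gamma> where \<gamma>: "length \<gamma> = ?n" "\<beta> = padd \<alpha> \<gamma>" using ple_imp_padd by metis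
    have "col \<alpha> \<subseteq> col \<beta>"
    proof
      fix r assume "r \<in> col \<alpha>"
      then have r: "r \<in> carrier R" "r \<otimes> ?p \<alpha> \<in> low \<alpha>" by (auto simp: col_def ideal_colon_def)
      have "r \<otimes> ?p \<beta> = ?p \<gamma> \<otimes> (r \<otimes> ?p \<alpha>)"
        unfolding \<gamma>(2) pprod_padd[OF zs \<alpha>(1) \<gamma>(1)] using r(1) pc by (simp add: m_ac)
      then have "r \<otimes> ?p \<beta> \<in> low \<beta>"
        using low_mult[OF mon_order_llt zs \<alpha>(1) \<gamma>(1)] r(2) \<gamma>(2) by (simp add: low_def)
      then show "r \<in> col \<beta>" using r(1) by (simp add: col_def ideal_colon_def)
    qed
    moreover have "pure \<alpha>" if "pure \<beta>" using zero_prefix_mono[OF \<alpha>(2)] that by (simp add: pure_def)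
    ultimately show "c \<alpha> \<subseteq> c \<beta>" by (auto simp: c_def)
  qed
  then obtain \<B> where \<B>: "partitions ?n \<B>" "\<And>S \<alpha>. S \<in> \<B> \<Longrightarrow> fits S \<alpha> \<Longrightarrow> c \<alpha> = c (map fst S)" by blast
  define f where "f \<alpha> = (if pure \<alpha> then 0 else len R (carrier R) (col \<alpha>))" for \<alpha>
  have f_finite: "f \<alpha> < \<infinity>" if len: "length \<alpha> = ?n" for \<alpha>
  proof (cases "pure \<alpha>")
    case False
    obtain i where i: "i < ?r" "\<alpha> ! i > 0"
    proof (rule ccontr)
      assume "\<not> thesis"
      then have "\<And>i. i < ?r \<Longrightarrow> \<alpha> ! i = 0" using that by blast
      then have "take ?r \<alpha> = replicate ?r 0" using len by (intro nth_equalityI) (auto simp: zs_def)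
      then show False using False by (simp add: pure_def)
    qed
    have in': "i < ?n" using i by (simp add: zs_def)
    let ?\<alpha>' = "\<alpha>[i := \<alpha> ! i - 1]"
    have pa: "?p \<alpha> = zs ! i \<otimes> ?p ?\<alpha>'" using pprod_decr[OF zs len in' i(2)] .
    have zi: "zs ! i \<in> J" "zs ! i \<in> carrier R" using i(1) xsJ xs(1) by (auto simp: zs_def nth_append)
    have "ideal_pow R \<mm> s \<subseteq> col \<alpha>"
    proof
      fix y assume y: "y \<in> ideal_pow R \<mm> s"
      have yc: "y \<in> carrier R" using y ideal_carr[OF pow_ideal[OF max_ideal]] by blast
      have "y \<otimes> zs ! i \<in> Idl (set ys)" using kill[OF zi(1) y] ys(2) by simp
      then have "?p ?\<alpha>' \<otimes> (y \<otimes> zs ! i) \<in> low \<alpha>"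
      proof (rule mult_genideal_le[OF low pc ys(1), rotated])
        fix x assume "x \<in> set ys"
        then obtain j where j: "j < length ys" "x = ys ! j" by (auto simp: in_set_conv_nth)
        let ?k = "?r + j"
        have k: "?k < ?n" "zs ! ?k = x" using j by (auto simp: zs_def nth_append)
        let ?\<beta> = "?\<alpha>'[?k := Suc (?\<alpha>' ! ?k)]"
        have "?p ?\<beta> = x \<otimes> ?p ?\<alpha>'" using pprod_incr[OF zs, of ?\<alpha>' ?k] k len by simp
        then have "?p ?\<alpha>' \<otimes> x = ?p ?\<beta>" using j ys(1) pc by (simp add: m_comm subset_iff)
        moreover have "?\<beta> \<in> lower llt \<alpha>"
        proof -
          have \<alpha>e: "\<alpha> \<in> exps ?n (Suc (sum_list \<alpha> - 1))"
            using len i(2) in' elem_le_sum_list[of i \<alpha>] by (simp add: exps_def)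
          have "?\<beta> \<in> exps ?n (Suc (sum_list \<alpha> - 1))"
            using exps_incr[OF exps_decr[OF \<alpha>e in' i(2)] k(1)] .
          moreover have "llt ?\<beta> \<alpha>" using llt_move[of i ?k \<alpha>] i k len by simp
          ultimately show ?thesis using \<alpha>e by (auto simp: lower_def exps_def)
        qed
        ultimately show "?p ?\<alpha>' \<otimes> x \<in> low \<alpha>" unfolding low_def using spin by simp
      qed
      moreover have "?p ?\<alpha>' \<otimes> (y \<otimes> zs ! i) = y \<otimes> ?p \<alpha>" unfolding pa using yc zi(2) pc by (simp add: m_ac)
      ultimately show "y \<in> col \<alpha>" using yc by (simp add: col_def ideal_colon_def)
    qed
    then have "len R (carrier R) (col \<alpha>) \<le> len R (carrier R) (ideal_pow R \<mm> s)"
      using col pow_ideal[OF max_ideal] oneideal ideal_sub by (intro len_mono) auto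
    then have "len R (carrier R) (col \<alpha>) < \<infinity>" using len_max_pow_finite[of s] by (rule order_le_less_trans)
    then show ?thesis using False by (simp add: f_def)
  qed (simp add: f_def)
  define w where "w S = the_enat (f (map fst S))" for S :: "(nat \<times> bool) list"
  have w: "f \<alpha> = enat (w S)" if "S \<in> \<B>" "fits S \<alpha>" for S \<alpha>
  proof -
    have len: "length (map fst S) = ?n" "length \<alpha> = ?n" using that \<B>(1) fits_length[OF that(2)] by (auto simp: partitions_def)
    have ceq: "c \<alpha> = c (map fst S)" using \<B>(2) that by blast
    then have "pure \<alpha> = pure (map fst S)" using c_empty by metis
    then have "f \<alpha> = f (map fst S)" using ceq by (auto simp: f_def c_def split: if_splits)
    then show ?thesis using f_finite[OF len(1)] by (auto simp: w_def)
  qed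
  have main: "len R (ideal_pow R J m) (ideal_pow R K m) = (\<Sum>\<alpha>\<in>exps ?n m. f \<alpha>)" for m
  proof -
    let ?K = "ideal_pow R K m"
    note Km = pow_ideal[OF K(1), of m]
    have Kspan: "?K = Idl (pprod R ys ` exps (length ys) m)" using pow_eq_monomials[OF ys(1)] ys(2) by simp
    have pys: "?p (replicate ?r 0 @ \<beta>) = pprod R ys \<beta>" for \<beta>
      unfolding zs_def using pprod_append[OF xs(1) ys(1), of "replicate ?r 0" \<beta>] pprod_zero[OF xs(1)] pprod_closed[OF ys(1)] by simp
    have ids: "ideal (Idl (?p ` T) <+> ?K) R" for T using sp Km by (rule add_ideals)
    have "len R (Idl (?p ` exps ?n m) <+> ?K) ?K = (\<Sum>\<alpha>\<in>exps ?n m. f \<alpha>)"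
    proof (rule lower_induct[where P = "\<lambda>T. len R (Idl (?p ` T) <+> ?K) ?K = (\<Sum>\<alpha>\<in>T. f \<alpha>)", OF mon_order_llt])
      show "len R (Idl (?p ` {}) <+> ?K) ?K = (\<Sum>\<alpha>\<in>{}. f \<alpha>)"
        using Km zero_add_ideal[OF Km] by (simp add: genideal_empty)
      fix \<alpha> assume \<alpha>: "\<alpha> \<in> exps ?n m"
        and IH: "len R (Idl (?p ` lower llt \<alpha>) <+> ?K) ?K = (\<Sum>\<alpha>\<in>lower llt \<alpha>. f \<alpha>)"
      have len: "length \<alpha> = ?n" "sum_list \<alpha> = m" using \<alpha> by (auto simp: exps_def)
      have notin: "\<alpha> \<notin> lower llt \<alpha>" using llt_irrefl by (simp add: lower_def)
      have P: "ideal (PIdl (?p \<alpha>)) R" using pc by (rule cgenideal_ideal)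
      have ins: "Idl (?p ` insert \<alpha> (lower llt \<alpha>)) <+> ?K = PIdl (?p \<alpha>) <+> (low \<alpha> <+> ?K)"
        using genideal_insert[OF pc pprod_in_carr_sub[OF zs], of \<alpha> "lower llt \<alpha>"]
          ideal_sub[OF P] ideal_sub[OF low[of \<alpha>]] ideal_sub[OF Km]
        by (simp add: low_def set_add_def add.set_mult_assoc)
      show "len R (Idl (?p ` insert \<alpha> (lower llt \<alpha>)) <+> ?K) ?K = (\<Sum>\<alpha>\<in>insert \<alpha> (lower llt \<alpha>). f \<alpha>)"
      proof (cases "pure \<alpha>")
        case True
        have "\<alpha> = replicate ?r 0 @ drop ?r \<alpha>" using True append_take_drop_id[of ?r \<alpha>] by (simp add: pure_def)
        then have p\<alpha>: "?p \<alpha> = pprod R ys (drop ?r \<alpha>)" and s\<alpha>: "sum_list (drop ?r \<alpha>) = m"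
          using pys len(2) by (metis, metis sum_list.append sum_list_replicate mult_zero_right add_0)
        have "?p \<alpha> \<in> ?K"
          using pprod_in_pow[OF K(1) ysK, of "drop ?r \<alpha>"] len(1) s\<alpha> p\<alpha> by (simp add: zs_def)
        then have "PIdl (?p \<alpha>) \<subseteq> low \<alpha> <+> ?K" using sum_upper2[OF low Km] cgenideal_minimal[OF Km] by blast
        then have "PIdl (?p \<alpha>) <+> (low \<alpha> <+> ?K) = low \<alpha> <+> ?K"
          using sum_le[OF add_ideals[OF low Km] _ order_refl] sum_upper2[OF P add_ideals[OF low Km]] by blast
        then show ?thesis using ins IH True notin finite_lower by (simp add: low_def f_def)
      next
        case False
        have "?K \<subseteq> low \<alpha>"
          unfolding Kspan
        proof (rule genideal_le[OF low], rule subsetI)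
          fix z assume "z \<in> pprod R ys ` exps (length ys) m"
          then obtain \<beta> where \<beta>: "\<beta> \<in> exps (length ys) m" "z = ?p (replicate ?r 0 @ \<beta>)" using pys by auto
          have "llt (replicate ?r 0 @ \<beta>) \<alpha>"
            using False len(1) \<beta>(1) by (intro llt_zero_prefix) (auto simp: pure_def exps_def zs_def)
          then have "replicate ?r 0 @ \<beta> \<in> lower llt \<alpha>"
            using \<beta>(1) len by (auto simp: lower_def exps_def zs_def sum_list_replicate)
          then show "z \<in> low \<alpha>" unfolding low_def \<beta>(2) by (rule spin)
        qed
        then have lK: "low \<alpha> <+> ?K = low \<alpha>" "?K \<subseteq> low \<alpha>"
          using sum_le[OF low order_refl, of ?K \<alpha>] sum_upper1[OF low Km] by blast+
        have PL: "ideal (PIdl (?p \<alpha>) <+> low \<alpha>) R" using P low by (rule add_ideals)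
        have "len R (PIdl (?p \<alpha>) <+> low \<alpha>) ?K = len R (PIdl (?p \<alpha>) <+> low \<alpha>) (low \<alpha>) + len R (low \<alpha>) ?K"
          using PL low Km lK(2) sum_upper2[OF P low] by (intro len_add)
        also have "len R (PIdl (?p \<alpha>) <+> low \<alpha>) (low \<alpha>) = f \<alpha>"
          using len_cyclic[OF low pc] False by (simp add: f_def col_def)
        also have "len R (low \<alpha>) ?K = (\<Sum>\<alpha>\<in>lower llt \<alpha>. f \<alpha>)" using IH lK(1) by (simp add: low_def)
        finally show ?thesis using ins lK(1) notin finite_lower by simp
      qed
    qed
    moreover have "Idl (?p ` exps ?n m) <+> ?K = ideal_pow R J m"
    proof -
      have e: "Idl (?p ` exps ?n m) = ideal_pow R J m" using pow_eq_monomials[OF zs] Jzs by simp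
      note Jm = pow_ideal[OF J, of m]
      show ?thesis unfolding e
        using sum_le[OF Jm order_refl pow_mono[OF K(2,1) J]] sum_upper1[OF Jm Km] by blast
    qed
    ultimately show ?thesis by simp
  qed
  have "len R (ideal_pow R J m) (ideal_pow R K m) = enat (\<Sum>S\<in>\<B>. w S * cnt S m)" for m
  proof -
    have "(\<Sum>\<alpha>\<in>exps ?n m. f \<alpha>) = (\<Sum>S\<in>\<B>. \<Sum>\<alpha> | fits S \<alpha> \<and> sum_list \<alpha> = m. f \<alpha>)"
      by (rule sum_partitions[OF \<B>(1)])
    also have "\<dots> = (\<Sum>S\<in>\<B>. enat (w S * cnt S m))"
    proof (rule sum.cong[OF refl])
      fix S assume S: "S \<in> \<B>"
      have "(\<Sum>\<alpha> | fits S \<alpha> \<and> sum_list \<alpha> = m. f \<alpha>) = (\<Sum>\<alpha> | fits S \<alpha> \<and> sum_list \<alpha> = m. enat (w S))"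
        using w[OF S] by (intro sum.cong) auto
      also have "\<dots> = enat (w S * cnt S m)" by (simp add: cnt_def mult.commute of_nat_eq_enat)
      finally show "(\<Sum>\<alpha> | fits S \<alpha> \<and> sum_list \<alpha> = m. f \<alpha>) = enat (w S * cnt S m)" .
    qed
    also have "\<dots> = enat (\<Sum>S\<in>\<B>. w S * cnt S m)" by (rule sum_enat)
    finally show ?thesis using main by simp
  qed
  moreover have "finite \<B>" using \<B>(1) by (simp add: partitions_def)
  ultimately show ?thesis by blast
qed

end

section \<open>Limits\<close>

lemma shifted_ratio_tendsto: "(\<lambda>k. real (k + c) / real (k + a)) \<longlonglongrightarrow> 1"
proof -
  have "(\<lambda>k. inverse (real (k + a))) \<longlonglongrightarrow> 0"
    using LIMSEQ_ignore_initial_segment[OF lim_inverse_n, of a] by simp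
  then have "(\<lambda>k. 1 + (real c - real a) * inverse (real (k + a))) \<longlonglongrightarrow> 1 + (real c - real a) * 0"
    by (intro tendsto_intros)
  moreover have "eventually (\<lambda>k. 1 + (real c - real a) * inverse (real (k + a)) = real (k + c) / real (k + a)) sequentially"
    using eventually_ge_at_top[of 1] by eventually_elim (simp add: field_simps)
  ultimately show ?thesis by (simp add: tendsto_cong)
qed

lemma binomial_ratio_tendsto: "(\<lambda>k. real ((k + e) choose e) / real (k + a) ^ e) \<longlonglongrightarrow> 1 / fact e"
proof (induction e)
  case (Suc e)
  have "(\<lambda>k. (real ((k + e) choose e) / real (k + a) ^ e) * ((real (k + Suc e) / real (k + a)) * (1 / real (Suc e))))
      \<longlonglongrightarrow> (1 / fact e) * (1 * (1 / real (Suc e)))"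
    by (intro tendsto_mult Suc shifted_ratio_tendsto tendsto_const)
  moreover have "(real ((k + e) choose e) / real (k + a) ^ e) * ((real (k + Suc e) / real (k + a)) * (1 / real (Suc e))) =
      real ((k + Suc e) choose Suc e) / real (k + a) ^ Suc e" for k
  proof -
    have "Suc e * ((k + Suc e) choose Suc e) = (k + Suc e) * ((k + e) choose e)"
      using Suc_times_binomial[of e "k + e"] by (simp only: add_Suc_right)
    then have "real (Suc e) * real ((k + Suc e) choose Suc e) = real (k + Suc e) * real ((k + e) choose e)"
      by (simp only: of_nat_mult[symmetric])
    then have "real ((k + Suc e) choose Suc e) = real (k + Suc e) * real ((k + e) choose e) / real (Suc e)"
      by (simp add: field_simps)
    then show ?thesis by (simp add: mult_ac)
  qed
  ultimately show ?case by (simp add: mult.commute)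
qed simp

text \<open>The number of vectors in a box is a polynomial for large degrees, of degree one less than the number of free coordinates. The bound
excludes growth faster than \<open>m^d\<close>.\<close>

lemma cnt_convergent:
  assumes bound: "\<And>m. m \<ge> 1 \<Longrightarrow> real (cnt S m) \<le> C * real m ^ d"
  shows "convergent (\<lambda>m. real (cnt S m) / real m ^ d)"
proof -
  define A where "A = sum_list (map fst S)"
  show ?thesis
  proof (cases "frees S")
    case 0
    have "eventually (\<lambda>m. real (cnt S m) / real m ^ d = 0) sequentially"
      using eventually_gt_at_top[of A] by eventually_elim (simp add: cnt_eq Let_def 0 A_def binomial_eq_0)
    then have "(\<lambda>m. real (cnt S m) / real m ^ d) \<longlonglongrightarrow> 0" by (rule tendsto_eventually)
    then show ?thesis by (rule convergentI)
  next
    case (Suc e)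
    have "cnt S (k + A) = (k + e) choose e" for k
      using Suc binomial_symmetric[of k "k + e"] by (simp add: cnt_eq Let_def A_def)
    then have "(\<lambda>k. real (cnt S (k + A)) / real (k + A) ^ e) \<longlonglongrightarrow> 1 / fact e"
      using binomial_ratio_tendsto[of e A] by simp
    then have lim: "(\<lambda>m. real (cnt S m) / real m ^ e) \<longlonglongrightarrow> 1 / fact e" by (rule LIMSEQ_offset)
    have inv: "(\<lambda>m. inverse (real m) ^ j) \<longlonglongrightarrow> 0 ^ j" for j
      by (intro tendsto_power lim_inverse_n)
    show ?thesis
    proof (cases "e \<le> d")
      case True
      have t: "(\<lambda>m. real (cnt S m) / real m ^ e * inverse (real m) ^ (d - e)) \<longlonglongrightarrow> 1 / fact e * 0 ^ (d - e)"
        by (intro tendsto_mult lim inv)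
      have ev: "eventually (\<lambda>m. real (cnt S m) / real m ^ e * inverse (real m) ^ (d - e) = real (cnt S m) / real m ^ d) sequentially"
        using eventually_ge_at_top[of 1]
      proof eventually_elim
        case (elim m)
        have "real m ^ d = real m ^ e * real m ^ (d - e)" using True by (simp flip: power_add)
        then show ?case by (simp add: divide_inverse power_inverse)
      qed
      show ?thesis using Lim_transform_eventually[OF t ev] by (rule convergentI)
    next
      case False
      have "(\<lambda>m. C * inverse (real m) ^ (e - d)) \<longlonglongrightarrow> C * 0 ^ (e - d)" by (intro tendsto_mult tendsto_const inv)
      moreover have "\<exists>M. \<forall>m\<ge>M. real (cnt S m) / real m ^ e \<le> C * inverse (real m) ^ (e - d)"
      proof (intro exI[of _ 1] allI impI)
        fix m :: nat assume m: "1 \<le> m"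
        have "real m ^ e = real m ^ d * real m ^ (e - d)" using False by (simp flip: power_add)
        then have "C * inverse (real m) ^ (e - d) = C * real m ^ d / real m ^ e"
          using m by (simp add: field_simps power_inverse)
        then show "real (cnt S m) / real m ^ e \<le> C * inverse (real m) ^ (e - d)"
          using bound[OF m] by (simp add: divide_right_mono)
      qed
      ultimately have "1 / fact e \<le> C * 0 ^ (e - d)" using lim LIMSEQ_le by blast
      then have "(1 / fact e :: real) \<le> 0" using False by (simp add: power_0_left)
      moreover have "(0 :: real) < 1 / fact e" by simp
      ultimately show ?thesis by linarith
    qed
  qed
qed

text \<open>The terms are nonnegative, so the bound for the sum holds for each of them, up to the weight.\<close>

lemma weighted_cnt_convergent:
  assumes "finite \<B>" and phi: "\<And>m. \<phi> m = (\<Sum>S\<in>\<B>. w S * cnt S m)"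
    and bound: "\<And>m. m \<ge> 1 \<Longrightarrow> real (\<phi> m) \<le> C * real m ^ d"
  shows "convergent (\<lambda>m. real (\<phi> m) / real m ^ d)"
proof -
  have "convergent (\<lambda>m. real (w S) * (real (cnt S m) / real m ^ d))" if S: "S \<in> \<B>" for S
  proof (cases "w S = 0")
    case True
    then show ?thesis by (simp add: convergent_const)
  next
    case False
    have "real (cnt S m) \<le> C * real m ^ d" if "m \<ge> 1" for m
    proof -
      have "cnt S m \<le> w S * cnt S m" using False by simp
      also have "\<dots> \<le> \<phi> m" unfolding phi using assms(1) S by (intro member_le_sum) auto
      finally show ?thesis using bound[OF that] by linarith
    qed
    then show ?thesis by (intro convergent_mult convergent_const cnt_convergent)
  qed
  then have "convergent (\<lambda>m. \<Sum>S\<in>\<B>. real (w S) * (real (cnt S m) / real m ^ d))" by (rule convergent_sum)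
  then show ?thesis by (simp add: phi sum_divide_distrib)
qed

text \<open>The limit is the supremum.\<close>

lemma almost_monotone_convergent:
  fixes F :: "nat \<Rightarrow> real"
  assumes bound: "\<And>n. n \<ge> 1 \<Longrightarrow> F n \<le> D"
    and mono: "\<And>n. n \<ge> 1 \<Longrightarrow> \<exists>E N0. \<forall>N\<ge>N0. F n \<le> F N + E / real N"
  shows "convergent F"
proof -
  define S where "S = (SUP n\<in>{1..}. F n)"
  have bdd: "bdd_above (F ` {1..})" by (rule bdd_aboveI2[of _ _ D]) (use bound in simp)
  have "F \<longlonglongrightarrow> S"
  proof (rule LIMSEQ_I)
    fix e :: real assume e: "e > 0"
    have "\<exists>n\<in>{1..}. S - e / 2 < F n"
      using less_cSUP_iff[of "{1..}" F "S - e / 2"] bdd e unfolding S_def by auto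
    then obtain n where n: "n \<ge> 1" "S - e / 2 < F n" by auto
    obtain E N0 where N0: "\<And>N. N \<ge> N0 \<Longrightarrow> F n \<le> F N + E / real N" using mono[OF n(1)] by blast
    have "(\<lambda>N. E / real N) \<longlonglongrightarrow> 0" by (rule lim_const_over_n)
    then obtain N1 where N1: "\<And>N. N \<ge> N1 \<Longrightarrow> norm (E / real N - 0) < e / 2"
      using LIMSEQ_D[of _ 0 "e / 2"] e by (metis half_gt_zero)
    have "norm (F N - S) < e" if N: "N \<ge> max (max N0 N1) 1" for N
    proof -
      have "F N \<le> S" unfolding S_def using bdd N by (intro cSUP_upper) auto
      moreover have "F n \<le> F N + E / real N" "\<bar>E / real N\<bar> < e / 2" using N0[of N] N1[of N] N by auto
      ultimately show ?thesis using n(2) unfolding real_norm_def by linarith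
    qed
    then show "\<exists>M. \<forall>N\<ge>M. norm (F N - S) < e" by blast
  qed
  then show ?thesis by (rule convergentI)
qed

section \<open>The limit of the Amao multiplicities\<close>

context noetherian_local
begin

lemma saturated_powers_len:
  assumes I: "ideal I R"
  shows "\<exists>\<B> w. finite \<B> \<and>
    (\<forall>m. len R (ideal_pow R (sat (ideal_pow R I n)) m) (ideal_pow R I (n * m)) = enat (\<Sum>S\<in>\<B>. w S * cnt S m))"
proof (rule saturation_killed[OF pow_ideal[OF I, of n]])
  fix s assume s: "\<And>x y. x \<in> sat (ideal_pow R I n) \<Longrightarrow> y \<in> ideal_pow R \<mm> s \<Longrightarrow> y \<otimes> x \<in> ideal_pow R I n"
  show ?thesis
    using pow_quotient_len_eq_sum[OF saturation_ideal[OF pow_ideal[OF I]] pow_ideal[OF I] saturation_upper[OF pow_ideal[OF I]] s]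
    unfolding pow_pow[OF I] by blast
qed

lemma saturated_power_le: "ideal I R \<Longrightarrow> ideal_pow R (sat (ideal_pow R I n)) m \<subseteq> sat (ideal_pow R I (n * m))"
  using saturation_pow[OF pow_ideal, of I n m] by (simp only: pow_pow)

lemma saturated_power_ge: "ideal I R \<Longrightarrow> ideal_pow R I (n * m) \<subseteq> ideal_pow R (sat (ideal_pow R I n)) m"
  using pow_mono[OF saturation_upper[OF pow_ideal] pow_ideal saturation_ideal[OF pow_ideal], of I n m]
  by (simp only: pow_pow)

lemma saturated_powers_len_le:
  assumes I: "ideal I R"
  shows "len R (ideal_pow R (sat (ideal_pow R I n)) m) (ideal_pow R I (n * m))
    \<le> (\<Sum>j\<in>{0..<n * m}. len R (satdiff I j) (ideal_pow R I (Suc j)))"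
proof -
  let ?K = "ideal_pow R I (n * m)"
  have ids: "ideal ?K R" "ideal (sat ?K) R" "ideal (ideal_pow R (sat (ideal_pow R I n)) m) R"
    using I by (auto intro!: pow_ideal saturation_ideal)
  have "len R (ideal_pow R (sat (ideal_pow R I n)) m) ?K \<le> len R (sat ?K) ?K"
    using saturated_power_le[OF I] saturated_power_ge[OF I] ids by (intro len_mono) auto
  also have "sat ?K = ideal_pow R I 0 \<inter> sat ?K" using ideal_sub[OF ids(2)] by auto
  also have "len R \<dots> ?K \<le> (\<Sum>j\<in>{0..<n * m}. len R (satdiff I j) (ideal_pow R I (Suc j)))"
    by (rule satdiff_filtration[OF I]) simp
  finally show ?thesis .
qed

text \<open>Cut \<open>J\<^sub>n^(qm) / I^(nqm)\<close> at \<open>I^(Nm)\<close>. The upper part embeds into \<open>J\<^sub>N^m / I^(Nm)\<close> because \<open>J\<^sub>n^q \<subseteq> J\<^sub>N\<close>, and the lower part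
is contained in the part of the saturation of \<open>I^(nqm)\<close> below \<open>I^(Nm)\<close>.\<close>

lemma saturated_powers_len_compare:
  assumes I: "ideal I R" and NT: "N \<le> n * q"
  shows "len R (ideal_pow R (sat (ideal_pow R I n)) (q * m)) (ideal_pow R I (n * (q * m)))
    \<le> len R (ideal_pow R (sat (ideal_pow R I N)) m) (ideal_pow R I (N * m))
      + (\<Sum>j\<in>{N * m..<n * (q * m)}. len R (satdiff I j) (ideal_pow R I (Suc j)))"
proof -
  let ?P = "ideal_pow R I" and ?J = "\<lambda>n. sat (ideal_pow R I n)"
  let ?X = "ideal_pow R (?J n) (q * m)" and ?K = "?P (n * (q * m))" and ?L = "?P (N * m)" and ?Y = "ideal_pow R (?J N) m"
  have le: "N * m \<le> n * (q * m)" using mult_le_mono1[OF NT, of m] by (simp add: mult.assoc)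
  have ids: "ideal ?X R" "ideal ?K R" "ideal ?L R" "ideal ?Y R" "ideal (sat ?K) R" "ideal (?J n) R" "ideal (?J N) R"
    using I by (auto intro!: pow_ideal saturation_ideal)
  have XL: "ideal (?X \<inter> ?L) R" "ideal (?X <+> ?L) R" using ids by (auto intro: i_intersect add_ideals)
  have KX: "?K \<subseteq> ?X" using saturated_power_ge[OF I] .
  have KL: "?K \<subseteq> ?L" using le by (intro pow_anti I)
  have "ideal_pow R (?J n) q \<subseteq> ?J N"
    using saturated_power_le[OF I, of n q] saturation_mono[OF pow_anti[OF I NT]] by blast
  then have XY: "?X \<subseteq> ?Y"
    using pow_mono[OF _ pow_ideal[OF ids(6)] ids(7), of q m] by (simp only: pow_pow[OF ids(6)])
  have LY: "?L \<subseteq> ?Y" using saturated_power_ge[OF I] .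
  have split: "len R ?X ?K = len R ?X (?X \<inter> ?L) + len R (?X \<inter> ?L) ?K" using ids XL KX KL by (intro len_add) auto
  have "len R ?X (?X \<inter> ?L) = len R (?X <+> ?L) ?L" using len_second_iso[OF ids(1,3)] by simp
  also have "\<dots> \<le> len R ?Y ?L"
    using ids XL sum_upper2[OF ids(1,3)] sum_le[OF ids(4) XY LY] by (intro len_mono) auto
  finally have top: "len R ?X (?X \<inter> ?L) \<le> len R ?Y ?L" .
  have "len R (?X \<inter> ?L) ?K \<le> len R (?L \<inter> sat ?K) ?K"
    using ids XL KX KL saturated_power_le[OF I, of n "q * m"] i_intersect by (intro len_mono) auto
  also have "\<dots> \<le> (\<Sum>j\<in>{N * m..<n * (q * m)}. len R (satdiff I j) (ideal_pow R I (Suc j)))"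
    by (rule satdiff_filtration[OF I le])
  finally show ?thesis unfolding split by (rule add_mono[OF top])
qed

lemma amao_limit_proper:
  assumes I: "ideal I R" "I \<subseteq> \<mm>" and dim: "krull_dim R = enat d"
  shows "convergent (\<lambda>n. amao_mult R (ideal_pow R I n) (sat (ideal_pow R I n)) / real n ^ d)"
proof -
  define u where "u j = the_enat (len R (satdiff I j) (ideal_pow R I (Suc j)))" for j
  have u: "len R (satdiff I j) (ideal_pow R I (Suc j)) = enat (u j)" for j
    using satdiff_len_finite[OF I(1), of j] by (auto simp: u_def simp del: nat_pow_Suc)
  obtain C j0 where C: "\<And>j. j \<ge> j0 \<Longrightarrow> u j \<le> C * d * (j + 1) ^ (d - 1)"
    using satdiff_len_bound[OF I dim] unfolding u by auto
  define \<phi> where "\<phi> n m = the_enat (len R (ideal_pow R (sat (ideal_pow R I n)) m) (ideal_pow R I (n * m)))" for n m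
  have "\<exists>\<B> w. finite \<B> \<and> (\<forall>m. \<phi> n m = (\<Sum>S\<in>\<B>. w S * cnt S m)) \<and>
      (\<forall>m. len R (ideal_pow R (sat (ideal_pow R I n)) m) (ideal_pow R I (n * m)) = enat (\<phi> n m))" for n
  proof -
    obtain \<B> w where Bw: "finite \<B>"
      "\<forall>m. len R (ideal_pow R (sat (ideal_pow R I n)) m) (ideal_pow R I (n * m)) = enat (\<Sum>S\<in>\<B>. w S * cnt S m)"
      using saturated_powers_len[OF I(1), of n] by blast
    then have "\<forall>m. \<phi> n m = (\<Sum>S\<in>\<B>. w S * cnt S m)" by (simp add: \<phi>_def)
    with Bw show ?thesis by (intro exI[of _ \<B>] exI[of _ w]) simp
  qed
  then obtain \<B> w where \<phi>B: "\<And>n. finite (\<B> n)" "\<And>n m. \<phi> n m = (\<Sum>S\<in>\<B> n. w n S * cnt S m)"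
    and \<phi>: "\<And>n m. len R (ideal_pow R (sat (ideal_pow R I n)) m) (ideal_pow R I (n * m)) = enat (\<phi> n m)"
    by metis
  define D where "D = (\<Sum>j<j0. u j) + C * d"
  have sum_u: "(\<Sum>j\<in>{0..<B}. u j) \<le> D * B ^ d" if B: "B \<ge> 1" for B
  proof -
    have "(\<Sum>j\<in>{0..<B}. u j) \<le> (\<Sum>j\<in>{0..<B}. (if j < j0 then u j else 0) + C * d * B ^ (d - 1))"
    proof (rule sum_mono)
      fix j assume j: "j \<in> {0..<B}"
      have "(j + 1) ^ (d - 1) \<le> B ^ (d - 1)" using j by (intro power_mono) auto
      then have "C * d * (j + 1) ^ (d - 1) \<le> C * d * B ^ (d - 1)" by simp
      then show "u j \<le> (if j < j0 then u j else 0) + C * d * B ^ (d - 1)" using order_trans[OF C[of j]] by (cases "j < j0") simp_all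
    qed
    also have "\<dots> = (\<Sum>j\<in>{0..<B}. if j < j0 then u j else 0) + B * (C * d * B ^ (d - 1))"
      by (simp add: sum.distrib)
    also have "(\<Sum>j\<in>{0..<B}. if j < j0 then u j else 0) \<le> (\<Sum>j<j0. u j)"
      unfolding sum.inter_restrict[symmetric, OF finite_atLeastLessThan]
      by (subst sum.inter_filter[symmetric]) (auto intro!: sum_mono2)
    also have "(\<Sum>j<j0. u j) \<le> (\<Sum>j<j0. u j) * B ^ d" using B by simp
    also have "B * (C * d * B ^ (d - 1)) = C * d * B ^ d" by (cases d) auto
    finally show ?thesis by (simp add: D_def algebra_simps)
  qed
  have \<phi>_le: "\<phi> n m \<le> D * (n * m) ^ d" if "n \<ge> 1" "m \<ge> 1" for n m
  proof -
    have "enat (\<phi> n m) \<le> enat (\<Sum>j\<in>{0..<n * m}. u j)"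
      using saturated_powers_len_le[OF I(1), of n m] unfolding \<phi> u sum_enat .
    also have "\<dots> \<le> enat (D * (n * m) ^ d)" using sum_u[of "n * m"] that by simp
    finally show ?thesis by simp
  qed
  have \<phi>_real: "real (\<phi> n m) \<le> (real D * real n ^ d) * real m ^ d" if "n \<ge> 1" "m \<ge> 1" for n m
    using \<phi>_le[OF that] by (metis mult.assoc of_nat_le_iff of_nat_mult of_nat_power power_mult_distrib)
  have "convergent (\<lambda>m. real (\<phi> n m) / real m ^ d)" if "n \<ge> 1" for n
    using weighted_cnt_convergent[OF \<phi>B(1) \<phi>B(2) \<phi>_real[OF that]] .
  then have "\<exists>l. (\<lambda>m. real (\<phi> n m) / real m ^ d) \<longlonglongrightarrow> l" if "n \<ge> 1" for n
    using that by (simp add: convergent_def)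
  then obtain L where L: "\<And>n. n \<ge> 1 \<Longrightarrow> (\<lambda>m. real (\<phi> n m) / real m ^ d) \<longlonglongrightarrow> L n" by metis
  have amao: "amao_mult R (ideal_pow R I n) (sat (ideal_pow R I n)) = fact d * L n" if "n \<ge> 1" for n
  proof -
    have "module_length R (quot_module R (ideal_pow R (sat (ideal_pow R I n)) m) (ideal_pow R (ideal_pow R I n) m)) = enat (\<phi> n m)" for m
      unfolding pow_pow[OF I(1)]
      using module_length_quot_module[OF pow_ideal[OF saturation_ideal[OF pow_ideal[OF I(1)]]] pow_ideal[OF I(1)] saturated_power_ge[OF I(1)]] \<phi>
      by simp
    then have "amao_mult R (ideal_pow R I n) (sat (ideal_pow R I n)) = lim (\<lambda>m. real (\<phi> n m) / (real m ^ d / fact d))"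
      by (simp add: amao_mult_def dim)
    also have "(\<lambda>m. real (\<phi> n m) / (real m ^ d / fact d)) = (\<lambda>m. fact d * (real (\<phi> n m) / real m ^ d))"
      by (simp add: fun_eq_iff)
    also have "lim \<dots> = fact d * L n" by (intro limI tendsto_mult tendsto_const L that)
    finally show ?thesis .
  qed
  define F where "F n = L n / real n ^ d" for n
  have "convergent F"
  proof (rule almost_monotone_convergent)
    show "F n \<le> real D" if n: "n \<ge> 1" for n
    proof -
      have "real (\<phi> n m) / real m ^ d \<le> real D * real n ^ d" if "m \<ge> 1" for m
        using \<phi>_real[OF n that] that by (simp add: divide_le_eq)
      then have "L n \<le> real D * real n ^ d" by (intro LIMSEQ_le_const2[OF L[OF n]]) blast
      then show ?thesis using n by (simp add: F_def divide_le_eq)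
    qed
  next
    fix n :: nat assume n: "n \<ge> 1"
    define E where "E = real n * (real C * real d * 2 ^ (d - 1))"
    have "F n \<le> F N + E / real N" if N: "N \<ge> max (max j0 n) 1" for N
    proof -
      \<comment> \<open>The least multiple of \<open>n\<close> above \<open>N\<close>: large enough for \<open>J\<^sub>n^q \<subseteq> J\<^sub>N\<close>, and exceeding \<open>N\<close> by at most \<open>n\<close>.\<close>
      define q where "q = N div n + 1"
      have q: "N \<le> n * q" "n * q \<le> N + n"
        using n by (auto simp: q_def dividend_less_times_div less_imp_le)
      have q1: "q \<ge> 1" by (simp add: q_def)
      define c where "c = n * (C * d * (n * q) ^ (d - 1))"
      have step: "\<phi> n (q * m) \<le> \<phi> N m + c * m ^ d" if m: "m \<ge> 1" for m
      proof -
        have Nm: "N * m \<ge> j0" using N m by (metis le_trans max.boundedE mult.right_neutral mult_le_mono)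
        have sub: "n * (q * m) - N * m \<le> n * m"
          using mult_le_mono1[OF q(2), of m] by (simp add: algebra_simps)
        have "\<phi> n (q * m) \<le> \<phi> N m + (\<Sum>j\<in>{N * m..<n * (q * m)}. u j)"
          using saturated_powers_len_compare[OF I(1) q(1), of m] unfolding \<phi> u sum_enat by simp
        also have "(\<Sum>j\<in>{N * m..<n * (q * m)}. u j) \<le> (\<Sum>j\<in>{N * m..<n * (q * m)}. C * d * (n * (q * m)) ^ (d - 1))"
        proof (rule sum_mono)
          fix j assume j: "j \<in> {N * m..<n * (q * m)}"
          have "(j + 1) ^ (d - 1) \<le> (n * (q * m)) ^ (d - 1)" using j by (intro power_mono) auto
          then have "C * d * (j + 1) ^ (d - 1) \<le> C * d * (n * (q * m)) ^ (d - 1)" by simp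
          then show "u j \<le> C * d * (n * (q * m)) ^ (d - 1)" using C[of j] j Nm by (meson atLeastLessThan_iff order_trans)
        qed
        also have "\<dots> = (n * (q * m) - N * m) * (C * d * (n * (q * m)) ^ (d - 1))" by simp
        also have "\<dots> \<le> (n * m) * (C * d * (n * (q * m)) ^ (d - 1))" using sub by (rule mult_le_mono1)
        also have "\<dots> = c * m ^ d" unfolding c_def by (cases d) (auto simp: power_mult_distrib algebra_simps)
        finally show ?thesis by simp
      qed
      have N1: "N \<ge> 1" using N by simp
      have "(\<lambda>m. real (\<phi> n (q * m)) / real (q * m) ^ d) \<longlonglongrightarrow> L n"
        using LIMSEQ_subseq_LIMSEQ[OF L[OF n], of "\<lambda>m. q * m"] q1 by (simp add: strict_mono_def o_def)
      then have "(\<lambda>m. real q ^ d * (real (\<phi> n (q * m)) / real (q * m) ^ d)) \<longlonglongrightarrow> real q ^ d * L n"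
        by (intro tendsto_mult tendsto_const)
      moreover have "(\<lambda>m. real (\<phi> N m) / real m ^ d + real c) \<longlonglongrightarrow> L N + real c"
        by (intro tendsto_add tendsto_const L N1)
      moreover have "\<exists>M. \<forall>m\<ge>M. real q ^ d * (real (\<phi> n (q * m)) / real (q * m) ^ d) \<le> real (\<phi> N m) / real m ^ d + real c"
      proof (intro exI[of _ 1] allI impI)
        fix m :: nat assume m: "1 \<le> m"
        have "real (\<phi> n (q * m)) \<le> real (\<phi> N m) + real c * real m ^ d"
          using step[OF m] by (metis of_nat_add of_nat_le_iff of_nat_mult of_nat_power)
        then have "real (\<phi> n (q * m)) / real m ^ d \<le> (real (\<phi> N m) + real c * real m ^ d) / real m ^ d"
          by (rule divide_right_mono) simp
        moreover have "real q ^ d * (real (\<phi> n (q * m)) / real (q * m) ^ d) = real (\<phi> n (q * m)) / real m ^ d"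
          using q1 by (simp add: power_mult_distrib)
        ultimately show "real q ^ d * (real (\<phi> n (q * m)) / real (q * m) ^ d) \<le> real (\<phi> N m) / real m ^ d + real c"
          using m by (simp add: add_divide_distrib)
      qed
      ultimately have LN: "real q ^ d * L n \<le> L N + real c" by (rule LIMSEQ_le)
      have L0: "0 \<le> L n" by (rule LIMSEQ_le_const[OF L[OF n]]) auto
      have F0: "0 \<le> F n" using L0 by (simp add: F_def)
      have "real N ^ d * F n \<le> real (n * q) ^ d * F n"
        using q(1) F0 by (intro mult_right_mono power_mono) (simp_all only: of_nat_le_iff of_nat_0_le_iff)
      also have "\<dots> = real q ^ d * L n" using n by (simp add: F_def power_mult_distrib)
      also have "\<dots> \<le> L N + real c" by (rule LN)
      finally have "F n \<le> (L N + real c) / real N ^ d" using N1 by (simp add: le_divide_eq mult.commute)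
      also have "\<dots> = F N + real c / real N ^ d" by (simp add: F_def add_divide_distrib)
      also have "real c / real N ^ d \<le> E / real N"
      proof (cases d)
        case 0
        then show ?thesis by (simp add: c_def E_def)
      next
        case (Suc e)
        have "n * q \<le> 2 * N" using q(2) N by simp
        then have "(n * q) ^ e \<le> (2 * N) ^ e" by (rule power_mono) simp
        then have "c \<le> n * (C * d * (2 * N) ^ e)" unfolding c_def by (simp add: Suc)
        then have "real c \<le> real (n * (C * d * (2 * N) ^ e))" by (rule of_nat_mono)
        also have "\<dots> = E * real N ^ e" by (simp add: E_def Suc power_mult_distrib algebra_simps)
        finally have "real c / real N ^ d \<le> E * real N ^ e / real N ^ d" by (rule divide_right_mono) simp
        also have "\<dots> = E / real N" using N1 by (simp add: Suc)
        finally show ?thesis .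
      qed
      finally show ?thesis by simp
    qed
    then show "\<exists>E N0. \<forall>N\<ge>N0. F n \<le> F N + E / real N" by blast
  qed
  then obtain l where "F \<longlonglongrightarrow> l" by (auto simp: convergent_def)
  then have t: "(\<lambda>n. fact d * F n) \<longlonglongrightarrow> fact d * l" by (intro tendsto_mult tendsto_const)
  have ev: "eventually (\<lambda>n. fact d * F n = amao_mult R (ideal_pow R I n) (sat (ideal_pow R I n)) / real n ^ d) sequentially"
    using eventually_ge_at_top[of 1]
  proof eventually_elim
    case (elim n)
    show ?case unfolding amao[OF elim] F_def by simp
  qed
  show ?thesis using Lim_transform_eventually[OF t ev] by (rule convergentI)
qed

text \<open>For \<open>I = R\<close> the numbers do not depend on \<open>n\<close>, except through the denominator.\<close>

theorem amao_limit:
  assumes I: "ideal I R" and dim: "krull_dim R = enat d"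
  shows "convergent (\<lambda>n. amao_mult R (ideal_pow R I n) (sat (ideal_pow R I n)) / real n ^ d)"
proof (cases "\<one> \<in> I")
  case True
  then have IR: "I = carrier R" using ideal.one_imp_carrier[OF I] by simp
  have pw: "ideal_pow R I n = carrier R" for n
    unfolding IR by (induction n) (simp_all add: ideal_prod_one[OF oneideal])
  let ?c = "amao_mult R (carrier R) (sat (carrier R))"
  have "(\<lambda>n. ?c * inverse (real n) ^ d) \<longlonglongrightarrow> ?c * 0 ^ d" by (intro tendsto_intros lim_inverse_n)
  then show ?thesis unfolding pw by (simp add: divide_inverse power_inverse convergentI)
next
  case False
  then show ?thesis using amao_limit_proper[OF I proper_ideal_le_max[OF I False] dim] by blast
qed

end

theorem theorem1p2:
  fixes k :: "('k, 'p) ring_scheme"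
    and A :: "('a, 'q) ring_scheme"
    and R :: "('r, 's) ring_scheme"
    and f :: "'k \<Rightarrow> 'a" and g :: "'a \<Rightarrow> 'r" and W :: "'a set"
    and d :: nat and I :: "'r set"
  assumes "field k"
    and "local_ring R" and "noetherian_ring R"
    and "finite_type_algebra k A f" and "is_localization A W R g"
    and "krull_dim R = enat d"
    and "ideal I R"
  shows "convergent (\<lambda>n. amao_mult R (ideal_pow R I n) (saturation R (ideal_pow R I n)) / real n ^ d)"
proof -
  interpret L: local_ring R by fact
  interpret N: noetherian_ring R by fact
  interpret noetherian_local R by unfold_locales
  show ?thesis using assms(7,6) by (rule amao_limit)
qed

end
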